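(* Consider the lifted Heston model for the log-asset price $X_t$ and the variance components $V_{t,i}$, $i=1,\dots,N$, $$dX_t=-\tfrac{V_t^N}{2}\,dt+\sqrt{V_t^N}\,dZ_t,$$ $$dV_{t,i}=-x_i(V_{t,i}-v_0^i)\,dt+(\theta-\lambda V_t^N)\,dt+\nu\sqrt{V_t^N}\,dW_t,\qquad V_{0,i}=v_0^i,\quad i=1,\dots,N,$$ where $V^N_t=\sum_{i=1}^N w_iV_{t,i}$, $\theta\ge0$, $\lambda\ge0$, the weights satisfy $w_i\ge0$, the nodes satisfy $x_i\ge0$, and $Z_t=\rho W_t+\sqrt{1-\rho^2}\,W_t^\perp$ with $W,W^\perp$ independent Brownian motions. Let $\mathbf W=[w_1,\dots,w_N]$ (row vector), $\mathbf 1=[1,\dots,1]$ (row vector of length $N$), $\mathbf v_0=[v_0^1,\dots,v_0^N]^T$, $A=\lambda\mathbf 1^T\mathbf W+\mathrm{diag}(x_1,\dots,x_N)$, $\mathbf b=\theta\mathbf 1^T+\mathrm{diag}(x_1,\dots,x_N)\mathbf v_0$, and let $I$ be the $N\times N$ identity matrix. Then the second-order operator splitting scheme of the lifted Heston model over a time step $h$, given $X_t$ and $\mathbf V_t=[V_{t,1},\dots,V_{t,N}]^T$, is given by $$X^{\mathrm{split}}_{t+h}=X_t-\tfrac{I_t^h}{2}+N\!\left(0,(1-\rho^2)I_t^h\right)+\frac{\rho}{\nu\sum_{i=1}^Nw_i}\left(\hat V^{N,(2)}_{t+h}-\tilde V^{N,(1)}_{t+h/2}\right),$$ $$\mathbf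 V^{\mathrm{split}}_{t+h}=e^{-Ah/2}\hat{\mathbf V}^{(2)}_{t+h}+A^{-1}(I-e^{-Ah/2})\mathbf b,$$ $$I_t^h=\mathbf WA^{-1}\mathbf b\,h+\mathbf WA^{-1}\left[(I-e^{-Ah/2})(\mathbf V_t+\hat{\mathbf V}^{(2)}_{t+h})-2A^{-1}(I-e^{-Ah/2})\mathbf b\right],$$ $$V^{N,\mathrm{split}}_{t+h}=\mathbf W\mathbf V^{\mathrm{split}}_{t+h},$$ where $\tilde{\mathbf V}^{(1)}_{t+h/2}=e^{-Ah/2}\mathbf V_t+A^{-1}(I-e^{-Ah/2})\mathbf b$, $\tilde V^{N,(1)}_{t+h/2}=\mathbf W\tilde{\mathbf V}^{(1)}_{t+h/2}$, $\hat V^{N,(2)}_{t+h}=CIR\big(0,0,\nu\sum_{i=1}^Nw_i,h,\tilde V^{N,(1)}_{t+h/2}\big)$, $\hat{\mathbf V}^{(2)}_{t+h}=\tilde{\mathbf V}^{(1)}_{t+h/2}+\dfrac{\hat V^{N,(2)}_{t+h}-\tilde V^{N,(1)}_{t+h/2}}{\sum_{i=1}^Nw_i}$ (the scalar being added to every component), and $\mathbf V^{\mathrm{split}}_{t+h}=[V^{\mathrm{split}}_{t+h,1},\dots,V^{\mathrm{split}}_{t+h,N}]^T$.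
   Context: The model is split into the two systems (with $V^{N,(j)}_t=\sum_{i=1}^N w_iV^{(j)}_{t,i}$, $j=1,2$): (1) $dX^{(1)}_t=-\tfrac12V^{N,(1)}_t\,dt+\sqrt{1-\rho^2}\sqrt{V_t^{N,(1)}}\,dW^\perp_t$, $\;dV^{(1)}_{t,i}=-x_i(V^{(1)}_{t,i}-v_0^i)\,dt+(\theta-\lambda V_t^{N,(1)})\,dt$, $i=1,\dots,N$; (2) $dX^{(2)}_t=\rho\sqrt{V_t^{N,(2)}}\,dW_t$, $\;dV_{t,i}^{(2)}=\nu\sqrt{V_t^{N,(2)}}\,dW_t$, $i=1,\dots,N$. The second-order (Strang) operator splitting scheme over $[t,t+h]$ evolves the state by system (1) for time $h/2$, then by system (2) for time $h$, then by system (1) for time $h/2$, the output of each evolution being the initial state of the next. $CIR(\alpha,\beta,\sigma,h,v)$ denotes the solution $V_h$ at time $h$ of $dV_t=(\alpha-\beta V_t)\,dt+\sigma\sqrt{V_t}\,dW_t$ with $V_0=v$. $N(m,s)$ denotes a normal random variable with mean $m$ and variance $s$ (here, conditionally on $\hat V^{N,(2)}_{t+h}$). *)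

theory Defs
  imports "HOL-Probability.Probability"
begin

text \<open>
  Brownian motion on a time set \<open>T\<close> relative to a filtration \<open>F\<close>. Only increments matter,
  so no initial value is prescribed here.
\<close>

definition brownian_on ::
  "'a measure \<Rightarrow> (real \<Rightarrow> 'a measure) \<Rightarrow> (real \<Rightarrow> 'a \<Rightarrow> real) \<Rightarrow> real set \<Rightarrow> bool" where
  "brownian_on M F B T \<longleftrightarrow>
     filtration (space M) F \<and> (\<forall>s. subalgebra M (F s)) \<and>
     (\<forall>s\<in>T. B s \<in> borel_measurable (F s)) \<and>
     (\<forall>\<omega>\<in>space M. continuous_on T (\<lambda>s. B s \<omega>)) \<and>
     (\<forall>s\<in>T. \<forall>u\<in>T. s < u \<longrightarrow>
        prob_space.indep_set M (sets (F s))
          {(\<lambda>\<omega>. B u \<omega> - B s \<omega>) -` C \<inter> space M | C. C \<in> sets borel} \<and>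
        distributed M lborel (\<lambda>\<omega>. B u \<omega> - B s \<omega>) (normal_density 0 (sqrt (u - s))))"

definition brownian_motion :: "'a measure \<Rightarrow> (real \<Rightarrow> 'a \<Rightarrow> real) \<Rightarrow> bool" where
  "brownian_motion M B \<longleftrightarrow>
     (AE \<omega> in M. B 0 \<omega> = 0) \<and> (\<exists>F. brownian_on M F B {0..})"

definition independent_processes ::
  "'a measure \<Rightarrow> (real \<Rightarrow> 'a \<Rightarrow> real) \<Rightarrow> (real \<Rightarrow> 'a \<Rightarrow> real) \<Rightarrow> bool" where
  "independent_processes M B B' \<longleftrightarrow>
     prob_space.indep_var M
       (Pi\<^sub>M {0..} (\<lambda>_. borel)) (\<lambda>\<omega>. \<lambda>s\<in>{0..}. B s \<omega>)
       (Pi\<^sub>M {0..} (\<lambda>_. borel)) (\<lambda>\<omega>. \<lambda>s\<in>{0..}. B' s \<omega>)"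

text \<open>
  Measurability is part of the following notion because \<^const>\<open>measure\<close> is 0 on
  non-measurable sets.
\<close>

definition tendsto_in_prob ::
  "'a measure \<Rightarrow> (nat \<Rightarrow> 'a \<Rightarrow> real) \<Rightarrow> ('a \<Rightarrow> real) \<Rightarrow> bool" where
  "tendsto_in_prob M Y L \<longleftrightarrow>
     (\<forall>n. Y n \<in> borel_measurable M) \<and> L \<in> borel_measurable M \<and>
     (\<forall>e>0. (\<lambda>n. measure M {\<omega> \<in> space M. \<bar>Y n \<omega> - L \<omega>\<bar> > e}) \<longlonglongrightarrow> 0)"

text \<open>
  The filtrations along which \<open>W\<close> and \<open>W'\<close> drive their systems over a time step. For Brownian
  motions \<open>W\<close>, \<open>W'\<close> whose increments after \<open>t\<close> are independent of each other and, jointly, of a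
  \<open>\<sigma>\<close>-algebra \<open>F_t\<close> containing the information up to time \<open>t\<close>, one takes \<open>H s\<close> generated by
  \<open>F_t\<close> and \<open>W\<close> on \<open>[t, s]\<close>, and \<open>G s\<close> generated by \<open>H (t + h)\<close> and \<open>W'\<close> on \<open>[t, s]\<close>. By
  independence \<open>W'\<close> remains a Brownian motion although \<open>G t\<close> contains the future of \<open>W\<close>; this
  is what gives a meaning to the last step of the splitting, where the variance, which already
  depends on \<open>W\<close> up to time \<open>t + h\<close>, multiplies \<open>dW'\<close> from time \<open>t + h / 2\<close> on.
\<close>

definition driver_filtrations ::
  "'a measure \<Rightarrow> (real \<Rightarrow> 'a measure) \<Rightarrow> (real \<Rightarrow> 'a \<Rightarrow> real) \<Rightarrow>
   (real \<Rightarrow> 'a measure) \<Rightarrow> (real \<Rightarrow> 'a \<Rightarrow> real) \<Rightarrow> real \<Rightarrow> real \<Rightarrow> bool" where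
  "driver_filtrations M H W G W' t h \<longleftrightarrow>
     brownian_on M H W {t..t + h} \<and> brownian_on M G W' {t..t + h} \<and>
     sets (H (t + h)) \<subseteq> sets (G t)"

text \<open>
  A simple integrand on \<open>[a, b]\<close> has the value \<open>\<xi> i\<close> on \<open>(p i, p (i + 1)]\<close>, where
  \<open>a = p 0 \<le> \<dots> \<le> p k = b\<close> and \<open>\<xi> i\<close> is bounded and known at time \<open>p i\<close>.
\<close>

definition simple_integrand ::
  "'a measure \<Rightarrow> (real \<Rightarrow> 'a measure) \<Rightarrow> real \<Rightarrow> real \<Rightarrow>
   nat \<Rightarrow> (nat \<Rightarrow> real) \<Rightarrow> (nat \<Rightarrow> 'a \<Rightarrow> real) \<Rightarrow> bool" where
  "simple_integrand M F a b k p \<xi> \<longleftrightarrow>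
     p 0 = a \<and> p k = b \<and>
     (\<forall>i<k. p i \<le> p (Suc i) \<and> \<xi> i \<in> borel_measurable (F (p i)) \<and> bounded (\<xi> i ` space M))"

definition simple_value ::
  "nat \<Rightarrow> (nat \<Rightarrow> real) \<Rightarrow> (nat \<Rightarrow> 'a \<Rightarrow> real) \<Rightarrow> real \<Rightarrow> 'a \<Rightarrow> real" where
  "simple_value k p \<xi> u \<omega> = (\<Sum>i<k. indicator {p i<..p (Suc i)} u * \<xi> i \<omega>)"

definition simple_ito ::
  "(real \<Rightarrow> 'a \<Rightarrow> real) \<Rightarrow> nat \<Rightarrow> (nat \<Rightarrow> real) \<Rightarrow> (nat \<Rightarrow> 'a \<Rightarrow> real) \<Rightarrow> 'a \<Rightarrow> real" where
  "simple_ito B k p \<xi> \<omega> = (\<Sum>i<k. \<xi> i \<omega> * (B (p (Suc i)) \<omega> - B (p i) \<omega>))"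

text \<open>
  \<open>J\<close> is (a version of) the stochastic integral of \<open>H\<close> against the \<open>F\<close>-Brownian motion \<open>B\<close> over
  \<open>[a, b]\<close>: a limit in probability of integrals of simple integrands that converge to \<open>H\<close> in
  the sense that \<open>\<integral> (H_n - H)^2 du\<close> tends to 0 in probability. This is the Ito integral for
  adapted integrands with almost surely square-integrable paths; no moments are required.
\<close>

definition has_ito_integral ::
  "'a measure \<Rightarrow> (real \<Rightarrow> 'a measure) \<Rightarrow> (real \<Rightarrow> 'a \<Rightarrow> real) \<Rightarrow> real \<Rightarrow> real \<Rightarrow>
   (real \<Rightarrow> 'a \<Rightarrow> real) \<Rightarrow> ('a \<Rightarrow> real) \<Rightarrow> bool" where
  "has_ito_integral M F B a b H J \<longleftrightarrow>
     (AE \<omega> in M. (\<lambda>u. H u \<omega>) integrable_on {a..b} \<and> (\<lambda>u. (H u \<omega>)\<^sup>2) integrable_on {a..b}) \<and>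
     (\<exists>k p \<xi>.
        (\<forall>n. simple_integrand M F a b (k n) (p n) (\<xi> n)) \<and>
        tendsto_in_prob M
          (\<lambda>n \<omega>. integral {a..b} (\<lambda>u. (simple_value (k n) (p n) (\<xi> n) u \<omega> - H u \<omega>)\<^sup>2)) (\<lambda>_. 0) \<and>
        tendsto_in_prob M (\<lambda>n. simple_ito B (k n) (p n) (\<xi> n)) J)"

text \<open>\<open>dY = \<mu> dt + \<sigma> dB\<close> on \<open>[a, b]\<close>, in integrated form.\<close>

definition ito_differential ::
  "'a measure \<Rightarrow> (real \<Rightarrow> 'a measure) \<Rightarrow> (real \<Rightarrow> 'a \<Rightarrow> real) \<Rightarrow> real \<Rightarrow> real \<Rightarrow>
   (real \<Rightarrow> 'a \<Rightarrow> real) \<Rightarrow> (real \<Rightarrow> 'a \<Rightarrow> real) \<Rightarrow> (real \<Rightarrow> 'a \<Rightarrow> real) \<Rightarrow> bool" where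
  "ito_differential M F B a b Y \<mu> \<sigma> \<longleftrightarrow>
     (AE \<omega> in M. (\<lambda>u. \<mu> u \<omega>) integrable_on {a..b}) \<and>
     (\<forall>s\<in>{a..b}. has_ito_integral M F B a s \<sigma>
        (\<lambda>\<omega>. Y s \<omega> - Y a \<omega> - integral {a..s} (\<lambda>u. \<mu> u \<omega>)))"

definition continuous_paths ::
  "'a measure \<Rightarrow> real \<Rightarrow> real \<Rightarrow> (real \<Rightarrow> 'a \<Rightarrow> 'b::topological_space) \<Rightarrow> bool" where
  "continuous_paths M a b Y \<longleftrightarrow> (\<forall>\<omega>\<in>space M. continuous_on {a..b} (\<lambda>s. Y s \<omega>))"

definition adapted_on ::
  "(real \<Rightarrow> 'a measure) \<Rightarrow> real \<Rightarrow> real \<Rightarrow> (real \<Rightarrow> 'a \<Rightarrow> 'b::topological_space) \<Rightarrow> bool" where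
  "adapted_on F a b Y \<longleftrightarrow> (\<forall>s\<in>{a..b}. Y s \<in> borel_measurable (F s))"

text \<open>
  The two systems of the splitting on a time interval \<open>[a, b]\<close>. The aggregated variance
  \<open>\<Sum>i. w_i v_i\<close> is \<open>w \<bullet> v\<close>; being a solution includes that it stays nonnegative, so that its
  square root makes sense (\<^const>\<open>sqrt\<close> is a total function). The variance components solve an
  autonomous equation and are adapted to the filtration \<open>F\<close> of the driver. The log-price enters
  no coefficient and is merely the integral of its differential: its initial value at time \<open>a\<close>
  need not be \<open>F a\<close>-measurable (in the middle step of the splitting it depends on the other
  Brownian motion).
\<close>

definition system1 ::
  "'a measure \<Rightarrow> (real \<Rightarrow> 'a measure) \<Rightarrow> (real \<Rightarrow> 'a \<Rightarrow> real) \<Rightarrow>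
   real^'n \<Rightarrow> real^'n \<Rightarrow> real^'n \<Rightarrow> real \<Rightarrow> real \<Rightarrow> real \<Rightarrow> real \<Rightarrow> real \<Rightarrow>
   (real \<Rightarrow> 'a \<Rightarrow> real) \<Rightarrow> (real \<Rightarrow> 'a \<Rightarrow> real^'n) \<Rightarrow> bool" where
  "system1 M F B w x v0 \<theta> lam \<rho> a b X V \<longleftrightarrow>
     brownian_on M F B {a..b} \<and>
     continuous_paths M a b X \<and> adapted_on (\<lambda>_. M) a b X \<and>
     continuous_paths M a b V \<and> adapted_on F a b V \<and>
     (AE \<omega> in M. \<forall>s\<in>{a..b}. 0 \<le> w \<bullet> V s \<omega>) \<and>
     ito_differential M F B a b X
       (\<lambda>u \<omega>. - (w \<bullet> V u \<omega>) / 2)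
       (\<lambda>u \<omega>. sqrt (1 - \<rho>\<^sup>2) * sqrt (w \<bullet> V u \<omega>)) \<and>
     (AE \<omega> in M. \<forall>s\<in>{a..b}. \<forall>i.
        ((\<lambda>u. - x $ i * (V u \<omega> $ i - v0 $ i) + (\<theta> - lam * (w \<bullet> V u \<omega>)))
           has_integral (V s \<omega> $ i - V a \<omega> $ i)) {a..s})"

definition system2 ::
  "'a measure \<Rightarrow> (real \<Rightarrow> 'a measure) \<Rightarrow> (real \<Rightarrow> 'a \<Rightarrow> real) \<Rightarrow>
   real^'n \<Rightarrow> real \<Rightarrow> real \<Rightarrow> real \<Rightarrow> real \<Rightarrow>
   (real \<Rightarrow> 'a \<Rightarrow> real) \<Rightarrow> (real \<Rightarrow> 'a \<Rightarrow> real^'n) \<Rightarrow> bool" where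
  "system2 M F B w \<nu> \<rho> a b X V \<longleftrightarrow>
     brownian_on M F B {a..b} \<and>
     continuous_paths M a b X \<and> adapted_on (\<lambda>_. M) a b X \<and>
     continuous_paths M a b V \<and> adapted_on F a b V \<and>
     (AE \<omega> in M. \<forall>s\<in>{a..b}. 0 \<le> w \<bullet> V s \<omega>) \<and>
     ito_differential M F B a b X (\<lambda>_ _. 0) (\<lambda>u \<omega>. \<rho> * sqrt (w \<bullet> V u \<omega>)) \<and>
     (\<forall>i. ito_differential M F B a b (\<lambda>s \<omega>. V s \<omega> $ i)
            (\<lambda>_ _. 0) (\<lambda>u \<omega>. \<nu> * sqrt (w \<bullet> V u \<omega>)))"

text \<open>
  \<open>Y\<close> is the value, a time \<open>h\<close> after the starting time \<open>a\<close>, of a solution of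
  \<open>dU = (\<alpha> - \<beta> U) dt + \<sigma> sqrt U dB\<close> that starts at the random variable \<open>v\<close>.
\<close>

definition is_CIR ::
  "'a measure \<Rightarrow> (real \<Rightarrow> 'a measure) \<Rightarrow> (real \<Rightarrow> 'a \<Rightarrow> real) \<Rightarrow> real \<Rightarrow>
   real \<Rightarrow> real \<Rightarrow> real \<Rightarrow> real \<Rightarrow> ('a \<Rightarrow> real) \<Rightarrow> ('a \<Rightarrow> real) \<Rightarrow> bool" where
  "is_CIR M F B a \<alpha> \<beta> \<sigma> h v Y \<longleftrightarrow>
     brownian_on M F B {a..a + h} \<and>
     (\<exists>U. continuous_paths M a (a + h) U \<and> adapted_on F a (a + h) U \<and>
        (AE \<omega> in M. \<forall>s\<in>{a..a + h}. 0 \<le> U s \<omega>) \<and>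
        ito_differential M F B a (a + h) U
          (\<lambda>u \<omega>. \<alpha> - \<beta> * U u \<omega>) (\<lambda>u \<omega>. \<sigma> * sqrt (U u \<omega>)) \<and>
        (AE \<omega> in M. U a \<omega> = v \<omega>) \<and> (AE \<omega> in M. U (a + h) \<omega> = Y \<omega>))"

text \<open>The normal law with mean \<open>m\<close> and variance \<open>s \<ge> 0\<close>, a point mass if \<open>s = 0\<close>.\<close>

definition normal_law :: "real \<Rightarrow> real \<Rightarrow> real measure" where
  "normal_law m s = distr std_normal_distribution borel (\<lambda>z. m + sqrt s * z)"

text \<open>Given the sub-\<open>\<sigma>\<close>-algebra \<open>G\<close>, the conditional law of \<open>Z\<close> is normal with mean \<open>m\<close> and variance \<open>s\<close>.\<close>

definition conditionally_normal ::
  "'a measure \<Rightarrow> 'a measure \<Rightarrow> ('a \<Rightarrow> real) \<Rightarrow> ('a \<Rightarrow> real) \<Rightarrow> ('a \<Rightarrow> real) \<Rightarrow> bool" where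
  "conditionally_normal M G Z m s \<longleftrightarrow>
     subalgebra M G \<and> Z \<in> borel_measurable M \<and> (AE \<omega> in M. 0 \<le> s \<omega>) \<and>
     (\<forall>C\<in>sets borel. AE \<omega> in M.
        real_cond_exp M G (indicator (Z -` C \<inter> space M)) \<omega> = measure (normal_law (m \<omega>) (s \<omega>)) C)"

text \<open>
  The matrix exponential is defined by its series, since multiplication, and hence \<^const>\<open>exp\<close>, on
  the vector type is componentwise.
\<close>

definition matrix_exp :: "real^'n^'n \<Rightarrow> real^'n^'n" where
  "matrix_exp A = (\<Sum>k. (1 / fact k) *\<^sub>R (((\<lambda>B. A ** B) ^^ k) (mat 1)))"

definition diag :: "real^'n \<Rightarrow> real^'n^'n" where
  "diag x = (\<chi> i j. if i = j then x $ i else 0)"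

end

theory Submission
  imports Defs
begin

text \<open>
  In each half step with system (1) the variance vector solves \<open>V' = b - A V\<close> pathwise; this gives
  \<open>V\<close> by the matrix exponential and, integrating the equation, \<open>\<integral> V\<close>. In system (2) all components
  receive the same increment \<open>\<nu> \<integral> sqrt (V\<^sup>N) dW\<close>, by almost sure uniqueness of the Ito integral, so that
  this increment and that of the log-price are multiples of the increment of \<open>V\<^sup>N\<close>. The two
  integrals against the other Brownian motion have integrands that are functions of \<open>V_t\<close>
  and \<open>Vhat\<close>, both known at time \<open>t\<close> in the filtration \<open>G\<close>. Approximating them by sampled
  simple integrands gives the conditional characteristic function
  \<open>exp (- c\<^sup>2 (1 - \<rho>\<^sup>2) I / 2)\<close>.
\<close>

subsection \<open>Matrix exponential and linear differential equations\<close>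

text \<open>The Ito integral is only specified as a limit in probability along some sequence of
  simple integrands, so nothing can be computed from it until the choice of the sequence is shown to
  be immaterial. Almost sure uniqueness and the passage to sampled integrands rest on one
  comparison: if two sequences approach the same integrand, their integrals differ by a sequence
  tending to 0 in probability. No moments are available, so the isometry is applied only after a
  cut-off at a small energy level.

  Error integrals against a general integrand are not known to be measurable; errors that vanish
  almost surely are therefore kept apart from errors that vanish in probability.

  The conditional law is reached without regular conditional distributions: Levy uniqueness is
  applied under the measure conditioned on each single event of positive probability, and the
  characterisation of \<open>real_cond_exp\<close> by integrals over events collects the results.
  The price noise is a sum of two integrals because its integrand may jump at the half step, where
  the variance vector is replaced by its value after the second system.\<close>

lemma matrix_add_mult_distrib: "((A::real^'n^'m) + B) ** C = A ** C + B ** C"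
  by (vector matrix_matrix_mult_def sum.distrib[symmetric] field_simps)

lemma bounded_linear_matrix_mult_left: "bounded_linear (\<lambda>B. (A::real^'n^'n) ** B)"
  by (intro linear_conv_bounded_linear [THEN iffD1] linearI)
     (simp_all add: matrix_add_ldistrib matrix_scalar_ac flip: scalar_matrix_assoc)

lemma bounded_linear_matrix_mult_right: "bounded_linear (\<lambda>B. B ** (A::real^'n^'n))"
  by (intro linear_conv_bounded_linear [THEN iffD1] linearI)
     (simp_all add: matrix_add_mult_distrib flip: scalar_matrix_assoc)

text \<open>The iteration inside \<open>matrix_exp\<close> gets a name because \<open>A ^ k\<close>
  on this type would take powers entrywise.\<close>

definition matrix_power :: "real^'n^'n \<Rightarrow> nat \<Rightarrow> real^'n^'n" where
  "matrix_power A k = ((\<lambda>B. A ** B) ^^ k) (mat 1)"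

lemma matrix_power_0 [simp]: "matrix_power A 0 = mat 1"
  by (simp add: matrix_power_def)

lemma matrix_power_Suc: "matrix_power A (Suc k) = A ** matrix_power A k"
  by (simp add: matrix_power_def)

lemma matrix_power_Suc_right: "matrix_power A (Suc k) = matrix_power A k ** A"
proof (induction k)
  case (Suc k)
  have "matrix_power A (Suc (Suc k)) = A ** (matrix_power A k ** A)"
    by (simp add: matrix_power_Suc [of A "Suc k"] Suc.IH)
  then show ?case
    by (simp add: matrix_power_Suc matrix_mul_assoc)
qed (simp add: matrix_power_Suc)

lemma matrix_power_scaleR: "matrix_power (c *\<^sub>R A) k = c ^ k *\<^sub>R matrix_power A k"
  by (induction k) (simp_all add: matrix_power_Suc matrix_scalar_ac mult.commute flip: scalar_matrix_assoc)

lemma matrix_exp_eq: "matrix_exp A = (\<Sum>k. (1 / fact k) *\<^sub>R matrix_power A k)"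
  by (simp add: matrix_exp_def matrix_power_def)

text \<open>Boundedness of left multiplication by \<open>A\<close> supplies the constant
  \<open>C\<close>, in place of a submultiplicative norm; the series is then dominated by a multiple
  of the real exponential series at \<open>\<bar>C\<bar>\<close>.\<close>

lemma summable_matrix_exp: "summable (\<lambda>k. (1 / fact k) *\<^sub>R matrix_power A k)"
proof -
  obtain C where C: "\<And>B::real^'a^'a. norm (A ** B) \<le> norm B * C"
    using bounded_linear.bounded [OF bounded_linear_matrix_mult_left] by blast
  have "norm (matrix_power A k) \<le> norm (mat 1 :: real^'a^'a) * \<bar>C\<bar> ^ k" for k
  proof (induction k)
    case (Suc k)
    have "norm (matrix_power A (Suc k)) \<le> norm (matrix_power A k) * \<bar>C\<bar>"
      unfolding matrix_power_Suc by (rule order_trans [OF C]) (simp add: mult_left_mono)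
    also have "\<dots> \<le> norm (mat 1 :: real^'a^'a) * \<bar>C\<bar> ^ k * \<bar>C\<bar>"
      by (intro mult_right_mono Suc.IH) simp
    finally show ?case
      by (simp add: mult_ac)
  qed simp
  then have "norm ((1 / fact k) *\<^sub>R matrix_power A k) \<le> norm (mat 1 :: real^'a^'a) * (inverse (fact k) * \<bar>C\<bar> ^ k)" for k
    by (simp add: field_simps)
  then show ?thesis
    by (intro summable_comparison_test' [OF summable_mult [OF summable_exp]]) auto
qed

lemma matrix_exp_commute: "A ** matrix_exp A = matrix_exp A ** A"
  unfolding matrix_exp_eq
  by (simp add: bounded_linear.suminf [OF bounded_linear_matrix_mult_left summable_matrix_exp]
      bounded_linear.suminf [OF bounded_linear_matrix_mult_right summable_matrix_exp]
      matrix_scalar_ac flip: matrix_power_Suc matrix_power_Suc_right scalar_matrix_assoc)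

lemma matrix_exp_0 [simp]: "matrix_exp 0 = mat 1"
proof -
  have "matrix_exp 0 = (\<Sum>k\<in>{0}. (1 / fact k) *\<^sub>R matrix_power (0::real^'a^'a) k)"
    unfolding matrix_exp_eq by (rule suminf_finite) (auto simp: matrix_power_Suc gr0_conv_Suc)
  then show ?thesis by simp
qed

text \<open>Every entry is a real power series in \<open>s\<close> that converges everywhere, so
  termwise differentiation applies. The coefficients \<open>diffs c k\<close> are entries of
  \<open>matrix_power A (Suc k)\<close> divided by \<open>fact k\<close>; splitting \<open>A\<close>
  off on the right gives the product in this order.\<close>

lemma DERIV_matrix_exp:
  "((\<lambda>s. matrix_exp (s *\<^sub>R A) $ i $ j) has_real_derivative (matrix_exp (s *\<^sub>R A) ** A) $ i $ j) (at s)"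
proof -
  define c where "c k = matrix_power A k $ i $ j / fact k" for k
  have comp: "bounded_linear (\<lambda>B::real^'a^'a. B $ i $ j)" for i j
    by (intro bounded_linear_compose [OF bounded_linear_vec_nth bounded_linear_vec_nth])
  have entry: "(\<lambda>k. matrix_power A k $ i $ j / fact k * s ^ k) sums (matrix_exp (s *\<^sub>R A) $ i $ j)" for i j s
    using bounded_linear.sums [OF comp [of i j] summable_sums [OF summable_matrix_exp [of "s *\<^sub>R A"]]]
    by (simp add: matrix_exp_eq matrix_power_scaleR mult.commute)
  have "(\<lambda>s. \<Sum>k. c k * s ^ k) = (\<lambda>s. matrix_exp (s *\<^sub>R A) $ i $ j)"
    by (intro ext sums_unique [symmetric]) (use entry in \<open>simp add: c_def\<close>)
  moreover have "DERIV (\<lambda>s. \<Sum>k. c k * s ^ k) s :> (\<Sum>k. diffs c k * s ^ k)"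
    by (rule termdiffs_strong_converges_everywhere) (use entry [THEN sums_summable] in \<open>simp add: c_def\<close>)
  moreover have "diffs c k * s ^ k = (\<Sum>l\<in>UNIV. matrix_power A k $ i $ l / fact k * s ^ k * A $ l $ j)" for k
    unfolding diffs_def c_def matrix_power_Suc_right
    by (simp add: matrix_matrix_mult_def sum_distrib_left sum_distrib_right sum_divide_distrib fact_Suc del: of_nat_Suc)
       (simp add: field_simps del: of_nat_Suc)
  moreover have "(\<lambda>k. \<Sum>l\<in>UNIV. matrix_power A k $ i $ l / fact k * s ^ k * A $ l $ j) sums
      (\<Sum>l\<in>UNIV. matrix_exp (s *\<^sub>R A) $ i $ l * A $ l $ j)"
    by (intro sums_sum sums_mult2 entry)
  ultimately show ?thesis
    by (simp add: sums_unique [symmetric] matrix_matrix_mult_def)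
qed

lemma matrix_inv_mult:
  assumes "invertible (A::real^'n^'n)"
  shows "A ** matrix_inv A = mat 1" "matrix_inv A ** A = mat 1"
  using someI_ex [OF assms [unfolded invertible_def]] by (simp_all add: matrix_inv_def)

lemma matrix_inv_commute:
  assumes "invertible (A::real^'n^'n)" "A ** B = B ** A"
  shows "matrix_inv A ** B = B ** matrix_inv A"
proof -
  have "matrix_inv A ** B = matrix_inv A ** (B ** A) ** matrix_inv A"
    by (simp add: matrix_inv_mult assms(1) flip: matrix_mul_assoc)
  also have "\<dots> = B ** matrix_inv A"
    by (simp add: matrix_inv_mult assms(1) matrix_mul_assoc flip: assms(2))
  finally show ?thesis .
qed

text \<open>Invertibility of \<open>A\<close> supplies the equilibrium \<open>d\<close>, and
  \<open>V - d\<close> solves the homogeneous equation. The equation is assumed in integrated form;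
  continuity of \<open>V\<close> makes the integrand continuous, and only then can \<open>V\<close>
  be differentiated.\<close>

lemma linear_ode_solution:
  fixes A :: "real^'n^'n" and V :: "real \<Rightarrow> real^'n"
  assumes A: "invertible A" and "a \<le> T" and cont: "continuous_on {a..T} V"
    and ode: "\<And>s i. s \<in> {a..T} \<Longrightarrow> ((\<lambda>u. (c - A *v V u) $ i) has_integral (V s $ i - V a $ i)) {a..s}"
  defines "E \<equiv> matrix_exp ((a - T) *\<^sub>R A)"
  shows "V T = E *v V a + matrix_inv A *v ((mat 1 - E) *v c)" 
proof -
  define d where "d = matrix_inv A *v c"
  have c: "c = A *v d"
    by (simp add: d_def matrix_vector_mul_assoc matrix_inv_mult A)
  \<comment> \<open>\<open>F s *v (V s - d)\<close> turns out to be constant; no inverse of the exponential is needed.\<close>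
  define F where "F s = matrix_exp ((s - T) *\<^sub>R A)" for s
  \<comment> \<open>The exponential commutes with \<open>(s - T) *\<^sub>R A\<close>; cancelling the
    scalar requires \<open>s \<noteq> T\<close>, and for \<open>s = T\<close> the exponential is the
    identity.\<close>
  have comm: "A ** F s = F s ** A" for s
    using matrix_exp_commute [of "(s - T) *\<^sub>R A"] 
    by (cases "s = T") (simp_all add: F_def matrix_scalar_ac flip: scalar_matrix_assoc)
  have dF: "((\<lambda>s. F s $ i $ j) has_real_derivative (F s ** A) $ i $ j) (at s within {a..T})" for s i j
  proof -
    have "((\<lambda>s. s - T) has_real_derivative 1) (at s within {a..T})"
      by (auto intro!: derivative_eq_intros)
    from DERIV_chain2 [where g = "\<lambda>s. s - T", OF DERIV_matrix_exp this] show ?thesis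
      by (simp add: F_def)
  qed
  have dV: "((\<lambda>s. V s $ i) has_real_derivative (A *v (d - V s)) $ i) (at s within {a..T})" if "s \<in> {a..T}" for s i
  proof -
    have *: "continuous_on {a..T} (\<lambda>u. (c - A *v V u) $ i)"
      by (intro continuous_intros bounded_linear.continuous_on [OF matrix_vector_mul_bounded_linear] cont)
    have "((\<lambda>s. integral {a..s} (\<lambda>u. (c - A *v V u) $ i)) has_real_derivative (c - A *v V s) $ i) (at s within {a..T})"
      using integral_has_real_derivative [OF * that] .
    then have "((\<lambda>s. V a $ i + integral {a..s} (\<lambda>u. (c - A *v V u) $ i)) has_real_derivative (c - A *v V s) $ i) (at s within {a..T})"
      by (auto intro!: derivative_eq_intros)
    then have "((\<lambda>s. V s $ i) has_real_derivative (c - A *v V s) $ i) (at s within {a..T})"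
      by (rule has_field_derivative_transform_within [where d = 1])
         (use that integral_unique [OF ode] in auto)
    then show ?thesis
      by (simp add: c matrix_vector_mult_diff_distrib)
  qed
  have const: "(F T *v (V T - d)) $ i = (F a *v (V a - d)) $ i" for i
  proof -
    have deriv: "((\<lambda>s. \<Sum>j\<in>UNIV. F s $ i $ j * (V s $ j - d $ j)) has_real_derivative
        (\<Sum>j\<in>UNIV. (F s ** A) $ i $ j * (V s $ j - d $ j) + (A *v (d - V s)) $ j * F s $ i $ j)) (at s within {a..T})"
      if "s \<in> {a..T}" for s
      by (rule derivative_eq_intros dF dV that refl | simp)+
    have zero: "(\<Sum>j\<in>UNIV. (F s ** A) $ i $ j * (V s $ j - d $ j) + (A *v (d - V s)) $ j * F s $ i $ j) = 0" for s
    proof -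
      have "(\<Sum>j\<in>UNIV. (F s ** A) $ i $ j * (V s $ j - d $ j) + (A *v (d - V s)) $ j * F s $ i $ j)
         = ((F s ** A) *v (V s - d) + F s *v (A *v (d - V s))) $ i"
        by (simp add: matrix_vector_mult_def sum.distrib mult.commute)
      also have "F s *v (A *v (d - V s)) = - ((F s ** A) *v (V s - d))"
        by (simp add: matrix_vector_mul_assoc algebra_simps)
      finally show ?thesis by simp
    qed
    have "((\<lambda>s. \<Sum>j\<in>UNIV. F s $ i $ j * (V s $ j - d $ j)) has_real_derivative 0) (at s within {a..T})"
      if "s \<in> {a..T}" for s
      using deriv [OF that] by (simp only: zero)
    then obtain k where "\<And>s. s \<in> {a..T} \<Longrightarrow> (\<Sum>j\<in>UNIV. F s $ i $ j * (V s $ j - d $ j)) = k"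
      using has_field_derivative_zero_constant [of "{a..T}" "\<lambda>s. \<Sum>j\<in>UNIV. F s $ i $ j * (V s $ j - d $ j)"] by auto
    then show ?thesis
      using \<open>a \<le> T\<close> by (simp add: matrix_vector_mult_def)
  qed
  then have "F T *v (V T - d) = F a *v (V a - d)"
    by (simp add: vec_eq_iff)
  \<comment> \<open>\<open>F T\<close> is the exponential of 0, so evaluation at the right end
    isolates \<open>V T\<close>.\<close>
  then have "V T = d + E *v (V a - d)"
    by (simp add: F_def E_def algebra_simps)
  moreover have "matrix_inv A *v ((mat 1 - E) *v c) = d - E *v d"
    using matrix_inv_commute [OF A comm [of a]]
    by (simp add: d_def E_def F_def matrix_vector_mult_diff_rdistrib matrix_vector_mult_diff_distrib matrix_vector_mul_assoc)
  ultimately show ?thesis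
    by (simp add: matrix_vector_mult_diff_distrib)
qed

text \<open>Integrating the equation leaves \<open>A *v J\<close> as its only unknown, so inverting
  \<open>A\<close> takes the place of integrating the matrix exponential in time.\<close>

lemma linear_ode_integral:
  fixes A :: "real^'n^'n" and V :: "real \<Rightarrow> real^'n"
  assumes A: "invertible A" and "a \<le> T" and cont: "continuous_on {a..T} V"
    and ode: "\<And>i. ((\<lambda>u. (c - A *v V u) $ i) has_integral (V T $ i - V a $ i)) {a..T}"
  shows "(V has_integral matrix_inv A *v ((T - a) *\<^sub>R c - (V T - V a))) {a..T}"
proof -
  have "V integrable_on {a..T}"
    using cont integrable_continuous_interval by blast
  then obtain J where J: "(V has_integral J) {a..T}" by blast
  have "((\<lambda>u. c - A *v V u) has_integral ((T - a) *\<^sub>R c - A *v J)) {a..T}"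
    using has_integral_linear [OF J matrix_vector_mul_bounded_linear [of A]] has_integral_const_real [of c a T] \<open>a \<le> T\<close>
    by (intro has_integral_diff) (auto simp: o_def)
  from has_integral_linear [OF this bounded_linear_vec_nth]
  have comp: "((\<lambda>u. (c - A *v V u) $ i) has_integral ((T - a) *\<^sub>R c - A *v J) $ i) {a..T}" for i
    by (simp add: o_def)
  have "(T - a) *\<^sub>R c - A *v J = V T - V a"
    unfolding vec_eq_iff using has_integral_unique [OF comp ode] by simp
  then have "A *v J = (T - a) *\<^sub>R c - (V T - V a)"
    by (simp add: algebra_simps)
  then have "J = matrix_inv A *v ((T - a) *\<^sub>R c - (V T - V a))"
    by (metis matrix_inv_mult(2) A matrix_vector_mul_assoc matrix_vector_mul_lid)
  with J show ?thesis by simp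
qed

subsection \<open>Increments of Brownian motion\<close>

lemma brownian_on_subalgebra: "brownian_on M F B T \<Longrightarrow> subalgebra M (F s)"
  by (simp add: brownian_on_def)

lemma brownian_on_adapted:
  assumes "brownian_on M F B T" "s \<in> T" "s \<le> u"
  shows "B s \<in> borel_measurable (F u)"
proof -
  have "subalgebra (F u) (F s)"
    using assms(1,3) unfolding brownian_on_def subalgebra_def by (auto simp: filtration_def)
  then show ?thesis
    using assms(1,2) measurable_from_subalg unfolding brownian_on_def by blast
qed

lemma brownian_on_measurable_mono:
  assumes "brownian_on M F B T" "s \<le> u" "f \<in> measurable (F s) N"
  shows "f \<in> measurable (F u) N"
proof -
  have "subalgebra (F u) (F s)"
    using assms(1,2) unfolding brownian_on_def subalgebra_def by (auto simp: filtration_def)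
  then show ?thesis
    using assms(3) measurable_from_subalg by blast
qed

lemma brownian_on_measurable:
  assumes "brownian_on M F B T" "f \<in> measurable (F s) N"
  shows "f \<in> measurable M N"
  using assms measurable_from_subalg brownian_on_subalgebra by blast

context prob_space
begin

lemma brownian_indep_increment:
  assumes B: "brownian_on M F B T" and "s \<in> T" "u \<in> T" "s < u" and "A \<in> sets (F s)" "C \<in> sets borel"
  shows "prob (A \<inter> ((\<lambda>\<omega>. B u \<omega> - B s \<omega>) -` C \<inter> space M)) = prob A * prob ((\<lambda>\<omega>. B u \<omega> - B s \<omega>) -` C \<inter> space M)"
proof (rule indep_setD)
  show "indep_set (sets (F s)) {(\<lambda>\<omega>. B u \<omega> - B s \<omega>) -` C \<inter> space M | C. C \<in> sets borel}"
    using assms unfolding brownian_on_def by blast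
qed (use assms in auto)

text \<open>The two families of preimages are closed under intersection, so the product formula
  extends to the generated sigma-algebras. The function \<open>g\<close> lets one statement serve
  the increment and its square.\<close>

lemma brownian_indep_var:
  assumes B: "brownian_on M F B T" and su: "s \<in> T" "u \<in> T" "s < u"
    and Y: "Y \<in> borel_measurable (F s)" and g [measurable]: "g \<in> borel_measurable borel"
  shows "indep_var borel Y borel (\<lambda>\<omega>. g (B u \<omega> - B s \<omega>) :: real)"
proof -
  have [measurable]: "B u \<in> borel_measurable M" "B s \<in> borel_measurable M" "Y \<in> borel_measurable M"
    using brownian_on_measurable [OF B brownian_on_adapted [OF B _ order_refl]] brownian_on_measurable [OF B Y] assms by auto
  have sp: "space (F s) = space M"
    using brownian_on_subalgebra [OF B] by (auto simp: subalgebra_def)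
  have stable: "Int_stable {f -` A \<inter> space M | A. A \<in> sets borel}" for f :: "'a \<Rightarrow> real"
    unfolding Int_stable_def
  proof safe
    fix A C :: "real set"
    assume "A \<in> sets borel" "C \<in> sets borel"
    then show "\<exists>D. f -` A \<inter> space M \<inter> (f -` C \<inter> space M) = f -` D \<inter> space M \<and> D \<in> sets borel"
      by (intro exI [of _ "A \<inter> C"]) auto
  qed
  have "indep_set {Y -` A \<inter> space M | A. A \<in> sets borel} {(\<lambda>\<omega>. g (B u \<omega> - B s \<omega>)) -` C \<inter> space M | C. C \<in> sets borel}"
    unfolding indep_sets2_eq
  proof (intro conjI ballI)
    fix a b
    assume "a \<in> {Y -` A \<inter> space M | A. A \<in> sets borel}"
      and "b \<in> {(\<lambda>\<omega>. g (B u \<omega> - B s \<omega>)) -` C \<inter> space M | C. C \<in> sets borel}"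
    then obtain A C where A: "a = Y -` A \<inter> space M" "A \<in> sets borel"
      and C: "b = (\<lambda>\<omega>. g (B u \<omega> - B s \<omega>)) -` C \<inter> space M" "C \<in> sets borel"
      by blast
    have "a \<in> sets (F s)"
      using measurable_sets [OF Y A(2)] by (simp add: A(1) sp)
    moreover have "g -` C \<in> sets borel"
      using measurable_sets [OF g C(2)] by simp
    ultimately show "prob (a \<inter> b) = prob a * prob b"
      using brownian_indep_increment [OF B su, of a "g -` C"] by (simp add: C(1) vimage_def)
  qed auto
  then have "indep_set (sigma_sets (space M) {Y -` A \<inter> space M | A. A \<in> sets borel})
      (sigma_sets (space M) {(\<lambda>\<omega>. g (B u \<omega> - B s \<omega>)) -` C \<inter> space M | C. C \<in> sets borel})"
    by (rule indep_set_sigma_sets [OF _ stable [of Y] stable [of "\<lambda>\<omega>. g (B u \<omega> - B s \<omega>)"]])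
  moreover have "(\<lambda>\<omega>. g (B u \<omega> - B s \<omega>)) \<in> borel_measurable M" "Y \<in> borel_measurable M"
    by measurable
  ultimately show ?thesis
    unfolding indep_var_eq by blast
qed

lemma brownian_distributed:
  assumes "brownian_on M F B T" "s \<in> T" "u \<in> T" "s < u"
  shows "distributed M lborel (\<lambda>\<omega>. B u \<omega> - B s \<omega>) (normal_density 0 (sqrt (u - s)))"
  using assms unfolding brownian_on_def by blast

lemma brownian_increment_moments:
  assumes B: "brownian_on M F B T" and "s \<in> T" "u \<in> T" "s < u"
  shows "integrable M (\<lambda>\<omega>. B u \<omega> - B s \<omega>)" "expectation (\<lambda>\<omega>. B u \<omega> - B s \<omega>) = 0"
    and "integrable M (\<lambda>\<omega>. (B u \<omega> - B s \<omega>)\<^sup>2)" "expectation (\<lambda>\<omega>. (B u \<omega> - B s \<omega>)\<^sup>2) = u - s"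
proof -
  note D = brownian_distributed [OF assms]
  have pos: "0 < sqrt (u - s)" using \<open>s < u\<close> by simp
  show 0: "expectation (\<lambda>\<omega>. B u \<omega> - B s \<omega>) = 0"
    by (rule normal_distributed_expectation [OF pos D])
  show "expectation (\<lambda>\<omega>. (B u \<omega> - B s \<omega>)\<^sup>2) = u - s"
    using normal_distributed_variance [OF pos D] \<open>s < u\<close> unfolding 0 by simp
  show "integrable M (\<lambda>\<omega>. B u \<omega> - B s \<omega>)"
    using distributed_integrable [OF D, of "\<lambda>x. x"] integrable_normal_moment [of "sqrt (u - s)" 0 1] pos by simp
  show "integrable M (\<lambda>\<omega>. (B u \<omega> - B s \<omega>)\<^sup>2)"
    using distributed_integrable [OF D, of "\<lambda>x. x\<^sup>2"] integrable_normal_moment [of "sqrt (u - s)" 0 2] pos by simp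
qed

lemma brownian_increment_char:
  assumes B: "brownian_on M F B T" and "s \<in> T" "u \<in> T" "s < u"
  shows "(\<integral>z. iexp (c * z) \<partial>distr M borel (\<lambda>\<omega>. B u \<omega> - B s \<omega>)) = complex_of_real (exp (- c\<^sup>2 * (u - s) / 2))"
proof -
  define \<sigma> where "\<sigma> = sqrt (u - s)"
  have pos: "0 < \<sigma>" using \<open>s < u\<close> by (simp add: \<sigma>_def)
  have [measurable]: "B u \<in> borel_measurable M" "B s \<in> borel_measurable M"
    using brownian_on_measurable [OF B brownian_on_adapted [OF B _ order_refl]] assms by auto
  have "distributed M lborel (\<lambda>\<omega>. (B u \<omega> - B s \<omega>) / \<sigma>) std_normal_density"
    using brownian_distributed [OF assms] normal_standard_normal_convert [OF pos, of _ 0] by (simp add: \<sigma>_def)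
  then have std: "distr M lborel (\<lambda>\<omega>. (B u \<omega> - B s \<omega>) / \<sigma>) = std_normal_distribution"
    by (rule distributed_distr_eq_density)
  have "(\<integral>z. iexp (c * z) \<partial>distr M borel (\<lambda>\<omega>. B u \<omega> - B s \<omega>)) = (\<integral>\<omega>. iexp (c * (B u \<omega> - B s \<omega>)) \<partial>M)"
    by (intro integral_distr) measurable
  also have "\<dots> = (\<integral>\<omega>. iexp (c * \<sigma> * ((B u \<omega> - B s \<omega>) / \<sigma>)) \<partial>M)"
    using pos by simp
  also have "\<dots> = (\<integral>z. iexp (c * \<sigma> * z) \<partial>distr M lborel (\<lambda>\<omega>. (B u \<omega> - B s \<omega>) / \<sigma>))"
    by (intro integral_distr [symmetric]) measurable
  also have "\<dots> = char std_normal_distribution (c * \<sigma>)"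
    unfolding std char_def ..
  also have "\<dots> = exp (- (c * \<sigma>)\<^sup>2 / 2)"
    unfolding char_std_normal_distribution ..
  also have "(c * \<sigma>)\<^sup>2 = c\<^sup>2 * (u - s)"
    using \<open>s < u\<close> by (simp add: \<sigma>_def power_mult_distrib)
  finally show ?thesis by simp
qed

lemma brownian_increment_integral:
  assumes B: "brownian_on M F B T" and su: "s \<in> T" "u \<in> T" "s \<le> u" and Y: "Y \<in> borel_measurable (F s)"
    and int: "integrable M Y"
  shows "integrable M (\<lambda>\<omega>. Y \<omega> * (B u \<omega> - B s \<omega>))" (is ?A)
    and "expectation (\<lambda>\<omega>. Y \<omega> * (B u \<omega> - B s \<omega>)) = 0" (is ?B)
    and "integrable M (\<lambda>\<omega>. Y \<omega> * (B u \<omega> - B s \<omega>)\<^sup>2)" (is ?C)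
    and "expectation (\<lambda>\<omega>. Y \<omega> * (B u \<omega> - B s \<omega>)\<^sup>2) = expectation Y * (u - s)" (is ?D)
proof -
  have "?A \<and> ?B \<and> ?C \<and> ?D"
  proof (cases "s = u")
    case False
    with su have "s < u" by simp
    have ind: "indep_var borel Y borel (\<lambda>\<omega>. B u \<omega> - B s \<omega>)"
      "indep_var borel Y borel (\<lambda>\<omega>. (B u \<omega> - B s \<omega>)\<^sup>2)"
      using brownian_indep_var [OF B su(1,2) \<open>s < u\<close> Y, of "\<lambda>x. x"]
        brownian_indep_var [OF B su(1,2) \<open>s < u\<close> Y, of "\<lambda>x. x\<^sup>2"] by simp_all
    note mom = brownian_increment_moments [OF B su(1,2) \<open>s < u\<close>]
    show ?thesis
      using indep_var_integrable [OF ind(1) int mom(1)] indep_var_lebesgue_integral [OF ind(1) int mom(1)]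
        indep_var_integrable [OF ind(2) int mom(3)] indep_var_lebesgue_integral [OF ind(2) int mom(3)] mom
      by simp
  qed simp
  then show ?A ?B ?C ?D by auto
qed

text \<open>The identity map into \<open>F s\<close> represents the whole past as one random
  element. Its joint law with the increment is a product, so Fubini can freeze all
  \<open>F s\<close>-measurable quantities at once.\<close>

lemma brownian_joint_distr:
  assumes B: "brownian_on M F B T" and su: "s \<in> T" "u \<in> T" "s < u"
  shows "distr M (F s) (\<lambda>\<omega>. \<omega>) \<Otimes>\<^sub>M distr M borel (\<lambda>\<omega>. B u \<omega> - B s \<omega>)
    = distr M (F s \<Otimes>\<^sub>M borel) (\<lambda>\<omega>. (\<omega>, B u \<omega> - B s \<omega>))" (is "?L \<Otimes>\<^sub>M ?D = _")
proof -
  have [measurable]: "B u \<in> borel_measurable M" "B s \<in> borel_measurable M"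
    using brownian_on_measurable [OF B brownian_on_adapted [OF B _ order_refl]] assms by auto
  have id [measurable]: "(\<lambda>\<omega>. \<omega>) \<in> measurable M (F s)"
    by (rule brownian_on_measurable [OF B, of _ s]) simp
  show ?thesis
  proof (rule pair_measure_eqI)
    show "sigma_finite_measure ?L" "sigma_finite_measure ?D"
      by (rule prob_space_imp_sigma_finite, rule prob_space_distr, simp)+
    show "sets (?L \<Otimes>\<^sub>M ?D) = sets (distr M (F s \<Otimes>\<^sub>M borel) (\<lambda>\<omega>. (\<omega>, B u \<omega> - B s \<omega>)))"
      by (simp cong: sets_pair_measure_cong)
    fix A C assume "A \<in> sets ?L" "C \<in> sets ?D"
    then have AC [measurable]: "A \<in> sets (F s)" "C \<in> sets borel" by simp_all
    have A: "A \<subseteq> space M"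
      using sets.sets_into_space [OF AC(1)] brownian_on_subalgebra [OF B, of s] by (simp add: subalgebra_def)
    have "emeasure (distr M (F s \<Otimes>\<^sub>M borel) (\<lambda>\<omega>. (\<omega>, B u \<omega> - B s \<omega>))) (A \<times> C)
        = emeasure M (A \<inter> ((\<lambda>\<omega>. B u \<omega> - B s \<omega>) -` C \<inter> space M))"
      using A by (subst emeasure_distr) (auto intro!: arg_cong [where f = "emeasure M"])
    also have "\<dots> = emeasure M A * emeasure M ((\<lambda>\<omega>. B u \<omega> - B s \<omega>) -` C \<inter> space M)"
      using brownian_indep_increment [OF B su AC] by (simp add: emeasure_eq_measure ennreal_mult')
    also have "\<dots> = emeasure ?L A * emeasure ?D C"
      using A by (simp add: emeasure_distr Int_absorb2)
    finally show "emeasure ?L A * emeasure ?D C = emeasure (distr M (F s \<Otimes>\<^sub>M borel) (\<lambda>\<omega>. (\<omega>, B u \<omega> - B s \<omega>))) (A \<times> C)" ..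
  qed
qed

text \<open>With the past frozen, the inner integral is the characteristic function of a centred
  normal variable at \<open>\<xi> \<omega>\<close>. The weight \<open>Y\<close> is complex so that
  it can later contain the oscillating factor of the preceding increments.\<close>

lemma brownian_increment_iexp:
  assumes B: "brownian_on M F B T" and su: "s \<in> T" "u \<in> T" "s \<le> u"
    and Y [measurable]: "Y \<in> borel_measurable (F s)" and \<xi> [measurable]: "\<xi> \<in> borel_measurable (F s)"
    and int: "integrable M Y"
  shows "(\<integral>\<omega>. Y \<omega> * iexp (\<xi> \<omega> * (B u \<omega> - B s \<omega>)) \<partial>M) = (\<integral>\<omega>. Y \<omega> * exp (- (\<xi> \<omega>)\<^sup>2 * (u - s) / 2) \<partial>M)"
proof (cases "s = u")
  case False
  with su have "s < u" by simp
  have [measurable]: "B u \<in> borel_measurable M" "B s \<in> borel_measurable M"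
    using brownian_on_measurable [OF B brownian_on_adapted [OF B _ order_refl]] assms by auto
  define D where "D = distr M borel (\<lambda>\<omega>. B u \<omega> - B s \<omega>)"
  define L where "L = distr M (F s) (\<lambda>\<omega>. \<omega>)"
  have id [measurable]: "(\<lambda>\<omega>. \<omega>) \<in> measurable M (F s)"
    by (rule brownian_on_measurable [OF B, of _ s]) simp
  have YM [measurable]: "Y \<in> borel_measurable M" "\<xi> \<in> borel_measurable M"
    using brownian_on_measurable [OF B] Y \<xi> by blast+
  note joint = brownian_joint_distr [OF B su(1,2) \<open>s < u\<close>, folded L_def D_def]
    and normal = brownian_increment_char [OF B su(1,2) \<open>s < u\<close>]
  interpret D: prob_space D unfolding D_def by (rule prob_space_distr) simp
  interpret L: prob_space L unfolding L_def by (rule prob_space_distr) simp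
  interpret pair_prob_space L D ..
  let ?f = "\<lambda>(\<omega>, z). Y \<omega> * iexp (\<xi> \<omega> * z)"
  have meas: "?f \<in> borel_measurable (F s \<Otimes>\<^sub>M borel)"
    by measurable
  have int': "integrable M (\<lambda>\<omega>. Y \<omega> * iexp (\<xi> \<omega> * (B u \<omega> - B s \<omega>)))"
    by (rule Bochner_Integration.integrable_bound [OF int]) (auto simp: norm_mult)
  have "(\<integral>\<omega>. Y \<omega> * iexp (\<xi> \<omega> * (B u \<omega> - B s \<omega>)) \<partial>M) = integral\<^sup>L (L \<Otimes>\<^sub>M D) ?f"
    unfolding joint by (subst integral_distr) (use meas in auto)
  also have "\<dots> = (\<integral>\<omega>. \<integral>z. ?f (\<omega>, z) \<partial>D \<partial>L)"
    by (rule integral_fst' [symmetric], unfold joint, subst integrable_distr_eq) (use meas int' in auto)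
  also have "\<dots> = (\<integral>\<omega>. Y \<omega> * exp (- (\<xi> \<omega>)\<^sup>2 * (u - s) / 2) \<partial>L)"
    using normal by (simp add: D_def)
  also have "\<dots> = (\<integral>\<omega>. Y \<omega> * exp (- (\<xi> \<omega>)\<^sup>2 * (u - s) / 2) \<partial>M)"
    unfolding L_def by (subst integral_distr) auto
  finally show ?thesis .
qed simp

end

subsection \<open>Simple integrands\<close>

lemma bounded_imageE:
  fixes f :: "'a \<Rightarrow> real"
  assumes "bounded (f ` A)"
  obtains K where "0 \<le> K" "\<And>x. x \<in> A \<Longrightarrow> \<bar>f x\<bar> \<le> K"
  using assms unfolding bounded_iff by (metis abs_ge_zero image_eqI order_trans real_norm_def abs_le_D1 empty_iff image_empty le_cases)

lemma chain_mono:
  fixes p :: "nat \<Rightarrow> real"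
  assumes "\<And>i. i < k \<Longrightarrow> p i \<le> p (Suc i)" "i \<le> j" "j \<le> k"
  shows "p i \<le> p j"
  using assms(2,3)
proof (induction rule: dec_induct)
  case (step n)
  then show ?case using assms(1) [of n] by simp
qed simp

lemma simple_integrandD:
  assumes "simple_integrand M F a b k p \<xi>"
  shows "p 0 = a" "p k = b" "\<And>i. i < k \<Longrightarrow> p i \<le> p (Suc i)"
    and "\<And>i. i < k \<Longrightarrow> \<xi> i \<in> borel_measurable (F (p i))" "\<And>i. i < k \<Longrightarrow> bounded (\<xi> i ` space M)"
    and "\<And>i. i \<le> k \<Longrightarrow> p i \<in> {a..b}"
proof -
  show *: "p 0 = a" "p k = b" "\<And>i. i < k \<Longrightarrow> p i \<le> p (Suc i)"
    "\<And>i. i < k \<Longrightarrow> \<xi> i \<in> borel_measurable (F (p i))" "\<And>i. i < k \<Longrightarrow> bounded (\<xi> i ` space M)"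
    using assms unfolding simple_integrand_def by auto
  show "p i \<in> {a..b}" if "i \<le> k" for i
    using chain_mono [of k p 0 i] chain_mono [of k p i k] * that by simp
qed

text \<open>This is the time integral of the squared integrand along one path, written as a finite
  sum.\<close>

definition simple_energy :: "nat \<Rightarrow> (nat \<Rightarrow> real) \<Rightarrow> (nat \<Rightarrow> 'a \<Rightarrow> real) \<Rightarrow> 'a \<Rightarrow> real" where
  "simple_energy k p \<xi> \<omega> = (\<Sum>i<k. (\<xi> i \<omega>)\<^sup>2 * (p (Suc i) - p i))"

lemma simple_ito_Suc:
  "simple_ito B (Suc k) p \<xi> \<omega> = simple_ito B k p \<xi> \<omega> + \<xi> k \<omega> * (B (p (Suc k)) \<omega> - B (p k) \<omega>)"
  by (simp add: simple_ito_def)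

lemma simple_energy_Suc:
  "simple_energy (Suc k) p \<xi> \<omega> = simple_energy k p \<xi> \<omega> + (\<xi> k \<omega>)\<^sup>2 * (p (Suc k) - p k)"
  by (simp add: simple_energy_def)

lemma simple_energy_nonneg: "(\<And>i. i < k \<Longrightarrow> p i \<le> p (Suc i)) \<Longrightarrow> 0 \<le> simple_energy k p \<xi> \<omega>"
  unfolding simple_energy_def by (auto intro!: sum_nonneg)

lemma simple_value_eq:
  assumes mono: "\<And>i. i < k \<Longrightarrow> p i \<le> p (Suc i)" and "i < k" "u \<in> {p i<..p (Suc i)}"
  shows "simple_value k p \<xi> u \<omega> = \<xi> i \<omega>"
proof -
  have "u \<notin> {p j<..p (Suc j)}" if "j < k" "j \<noteq> i" for j
  proof (cases "j < i")
    case True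
    then show ?thesis using chain_mono [of k p "Suc j" i] mono assms by force
  next
    case False
    with that show ?thesis using chain_mono [of k p "Suc i" j] mono assms by force
  qed
  then have "simple_value k p \<xi> u \<omega> = (\<Sum>j<k. if j = i then \<xi> i \<omega> else 0)"
    unfolding simple_value_def using assms by (intro sum.cong) (auto simp: indicator_def)
  then show ?thesis using \<open>i < k\<close> by simp
qed

lemma has_integral_chain:
  fixes p :: "nat \<Rightarrow> real" and f :: "real \<Rightarrow> real"
  assumes "\<And>i. i < k \<Longrightarrow> p i \<le> p (Suc i)" "\<And>i. i < k \<Longrightarrow> (f has_integral J i) {p i..p (Suc i)}"
  shows "(f has_integral (\<Sum>i<k. J i)) {p 0..p k}"
  using assms
proof (induction k)
  case (Suc k)
  have le: "p 0 \<le> p k" "p k \<le> p (Suc k)"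
    using chain_mono [of k p 0 k] Suc.prems(1) by auto
  have "(f has_integral (\<Sum>i<k. J i) + J k) {p 0..p (Suc k)}"
    by (rule has_integral_combine [OF le]) (use Suc in auto)
  then show ?case by simp
qed (simp add: has_integral_refl)

text \<open>A function \<open>f\<close> of value and time covers the energy, the squared distance to
  an integrand and the grid estimates. On a closed piece the simple value can differ from
  \<open>\<xi> i \<omega>\<close> only at the left end, which is negligible.\<close>

lemma has_integral_simple_value:
  fixes f :: "real \<Rightarrow> real \<Rightarrow> real"
  assumes mono: "\<And>i. i < k \<Longrightarrow> p i \<le> p (Suc i)"
    and "\<And>i. i < k \<Longrightarrow> ((\<lambda>u. f (\<xi> i \<omega>) u) has_integral J i) {p i..p (Suc i)}"
  shows "((\<lambda>u. f (simple_value k p \<xi> u \<omega>) u) has_integral (\<Sum>i<k. J i)) {p 0..p k}"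
proof (rule has_integral_chain [of k p, OF mono])
  fix i assume "i < k"
  show "((\<lambda>u. f (simple_value k p \<xi> u \<omega>) u) has_integral J i) {p i..p (Suc i)}"
  proof (rule has_integral_spike_finite [OF _ _ assms(2) [OF \<open>i < k\<close>]])
    show "f (simple_value k p \<xi> u \<omega>) u = f (\<xi> i \<omega>) u" if "u \<in> {p i..p (Suc i)} - {p i}" for u
      using simple_value_eq [of k p i u \<xi> \<omega>, OF mono \<open>i < k\<close>] that by simp
  qed simp
qed auto

lemma has_integral_simple_value_sq:
  assumes "\<And>i. i < k \<Longrightarrow> p i \<le> p (Suc i)"
  shows "((\<lambda>u. (simple_value k p \<xi> u \<omega>)\<^sup>2) has_integral simple_energy k p \<xi> \<omega>) {p 0..p k}"
  unfolding simple_energy_def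
proof (rule has_integral_simple_value [of k p "\<lambda>x u. x\<^sup>2", OF assms])
  fix i assume "i < k"
  show "((\<lambda>u. (\<xi> i \<omega>)\<^sup>2) has_integral (\<xi> i \<omega>)\<^sup>2 * (p (Suc i) - p i)) {p i..p (Suc i)}"
    using has_integral_const_real [of "(\<xi> i \<omega>)\<^sup>2" "p i" "p (Suc i)"] assms [OF \<open>i < k\<close>] by (simp add: mult.commute)
qed auto

lemma integrable_simple_value_diff_sq:
  assumes mono: "\<And>i. i < k \<Longrightarrow> p i \<le> p (Suc i)"
    and H: "H integrable_on {p 0..p k}" "(\<lambda>u. (H u)\<^sup>2) integrable_on {p 0..p k}"
  shows "(\<lambda>u. (simple_value k p \<xi> u \<omega> - H u)\<^sup>2) integrable_on {p 0..p k}"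
proof -
  have "(\<lambda>u. (\<xi> i \<omega> - H u)\<^sup>2) integrable_on {p i..p (Suc i)}" if "i < k" for i
  proof -
    have sub: "{p i..p (Suc i)} \<subseteq> {p 0..p k}"
      using chain_mono [of k p 0 i, OF mono] chain_mono [of k p "Suc i" k, OF mono] that by auto
    have "(\<lambda>u. (\<xi> i \<omega>)\<^sup>2 - 2 * \<xi> i \<omega> * H u + (H u)\<^sup>2) integrable_on {p i..p (Suc i)}"
      using integrable_on_subinterval [OF H(1) sub] integrable_on_subinterval [OF H(2) sub]
      by (intro integrable_add integrable_diff integrable_const_ivl integrable_on_mult_right) auto
    then show ?thesis
      by (simp add: power2_diff algebra_simps)
  qed
  then show ?thesis
    using has_integral_simple_value [of k p "\<lambda>x u. (x - H u)\<^sup>2" \<xi> \<omega>, OF mono integrable_integral] by blast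
qed

text \<open>The isometry and the tail bound concern a single simple integrand, so a difference of
  two must be rewritten over the merged nodes. The identity for the integrals is a telescoping sum
  and thus holds for an arbitrary process \<open>B\<close>.\<close>

lemma simple_integrand_diff:
  assumes F: "\<And>s u (f :: 'a \<Rightarrow> real). s \<le> u \<Longrightarrow> f \<in> borel_measurable (F s) \<Longrightarrow> f \<in> borel_measurable (F u)"
    and \<xi>: "simple_integrand M F a b k p \<xi>" and \<xi>': "simple_integrand M F a b k' p' \<xi>'"
  obtains K q \<eta> where "simple_integrand M F a b K q \<eta>"
    and "\<And>u \<omega>. u \<in> {a<..b} \<Longrightarrow> simple_value K q \<eta> u \<omega> = simple_value k p \<xi> u \<omega> - simple_value k' p' \<xi>' u \<omega>"
    and "\<And>B \<omega>. simple_ito B K q \<eta> \<omega> = simple_ito B k p \<xi> \<omega> - simple_ito B k' p' \<xi>' \<omega>"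
proof -
  define Q where "Q = p ` {..k} \<union> p' ` {..k'}"
  define K where "K = card Q - 1"
  \<comment> \<open>The value on \<open>(q j, q (j + 1)]\<close> is taken at the right endpoint, yet it is known at time \<open>q j\<close>
    because no \<open>p i\<close> lies strictly between.\<close>
  define q where "q i = sorted_list_of_set Q ! i" for i
  have Q: "finite Q" "a \<in> Q" "b \<in> Q" "Q \<subseteq> {a..b}" "p ` {..k} \<subseteq> Q" "p' ` {..k'} \<subseteq> Q"
    using simple_integrandD(1,2,6) [OF \<xi>] simple_integrandD(6) [OF \<xi>'] by (force simp: Q_def)+
  have cardQ: "card Q = Suc K"
    using Q(1,2) card_gt_0_iff [of Q] by (auto simp: K_def)
  have qless: "q i < q j" if "i < j" "j \<le> K" for i j
    using strict_sorted_list_of_set [of Q] sorted_wrt_nth_less [of "(<)" "sorted_list_of_set Q" i j] that cardQ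
    by (auto simp: q_def)
  have qiff: "q i < q j \<longleftrightarrow> i < j" if "i \<le> K" "j \<le> K" for i j
    using qless [of i j] qless [of j i] that by (cases i j rule: linorder_cases) auto
  have qle: "q i \<le> q j \<longleftrightarrow> i \<le> j" if "i \<le> K" "j \<le> K" for i j
    using qiff [of j i] that by auto
  have qmono: "q i \<le> q (Suc i)" if "i < K" for i
    using qless [of i "Suc i"] that by simp
  have qQ: "q i \<in> Q" if "i \<le> K" for i
    using that cardQ Q(1) set_sorted_list_of_set [of Q] nth_mem [of i "sorted_list_of_set Q"] by (auto simp: q_def)
  have Qq: "\<exists>i\<le>K. x = q i" if "x \<in> Q" for x
    using that cardQ Q(1) set_sorted_list_of_set [of Q] in_set_conv_nth [of x "sorted_list_of_set Q"]
    by (auto simp: q_def less_Suc_eq_le)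
  have q0: "q 0 = a"
  proof -
    obtain i where "i \<le> K" "a = q i" using Qq Q(2) by blast
    then show ?thesis using qQ [of 0] Q(4) qle [of 0 i] by force
  qed
  have qK: "q K = b"
  proof -
    obtain i where "i \<le> K" "b = q i" using Qq Q(3) by blast
    then show ?thesis using qQ [of K] Q(4) qle [of i K] by force
  qed
  have part: "(\<forall>u\<in>{a<..b}. \<forall>\<omega>. simple_value K q (\<lambda>j. simple_value k p \<xi> (q (Suc j))) u \<omega> = simple_value k p \<xi> u \<omega>) \<and>
      (\<forall>B \<omega>. simple_ito B K q (\<lambda>j. simple_value k p \<xi> (q (Suc j))) \<omega> = simple_ito B k p \<xi> \<omega>) \<and>
      (\<forall>j<K. simple_value k p \<xi> (q (Suc j)) \<in> borel_measurable (F (q j)) \<and> bounded (simple_value k p \<xi> (q (Suc j)) ` space M))"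
    if \<xi>: "simple_integrand M F a b k p \<xi>" and pQ: "p ` {..k} \<subseteq> Q" for k p \<xi>
  proof (intro conjI allI impI ballI)
    have pq: "\<exists>l\<le>K. p i = q l" if "i \<le> k" for i
      using Qq pQ that by blast
    fix u \<omega> assume u: "u \<in> {a<..b}"
    \<comment> \<open>Since \<open>q 0 = a < u\<close>, the least node at or after \<open>u\<close>
      has a predecessor \<open>j\<close>, and \<open>u\<close> lies in
      \<open>{q j<..q (Suc j)}\<close>.\<close>
    define n where "n = (LEAST n. u \<le> q n)"
    have "u \<le> q K" using u qK by simp
    have n: "u \<le> q n"
      unfolding n_def by (rule LeastI [of "\<lambda>n. u \<le> q n", OF \<open>u \<le> q K\<close>])
    have nK: "n \<le> K"
      unfolding n_def by (rule Least_le [of "\<lambda>n. u \<le> q n", OF \<open>u \<le> q K\<close>])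
    have "n \<noteq> 0" using n u q0 by (cases "n = 0") auto
    then obtain j where nj: "n = Suc j" by (cases n) auto
    have j: "j < K \<and> q j < u"
      using nK not_less_Least [of j "\<lambda>n. u \<le> q n", folded n_def] by (simp add: nj)
    have uj: "u \<le> q (Suc j)"
      using n by (simp add: nj)
    \<comment> \<open>The ends of the coarse piece are themselves nodes of \<open>q\<close>, and
      none of them separates \<open>u\<close> from \<open>q (Suc j)\<close>; both points therefore
      lie in the same coarse pieces.\<close>
    have "indicator {p i<..p (Suc i)} (q (Suc j)) = (indicator {p i<..p (Suc i)} u :: real)" if "i < k" for i
    proof -
      obtain l m where l: "l \<le> K" "p i = q l" and m: "m \<le> K" "p (Suc i) = q m"
        using pq [of i] pq [of "Suc i"] \<open>i < k\<close> by auto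
      have "q l < u \<longleftrightarrow> q l < q (Suc j)"
        using l j uj qiff [of l "Suc j"] qle [of l j] by auto
      moreover have "u \<le> q m \<longleftrightarrow> q (Suc j) \<le> q m"
        using m j uj qle [of "Suc j" m] qle [of m j] by (auto simp: not_less_eq_eq)
      ultimately show ?thesis by (simp add: l m indicator_def)
    qed
    then have "simple_value k p \<xi> (q (Suc j)) \<omega> = simple_value k p \<xi> u \<omega>"
      unfolding simple_value_def by simp
    then show "simple_value K q (\<lambda>j. simple_value k p \<xi> (q (Suc j))) u \<omega> = simple_value k p \<xi> u \<omega>"
      using j uj by (simp add: simple_value_eq [of K q j u, OF qmono])
  next
    note pD = simple_integrandD [OF \<xi>]
    have pq: "\<exists>l\<le>K. p i = q l" if "i \<le> k" for i
      using Qq pQ that by blast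
    fix B :: "real \<Rightarrow> 'a \<Rightarrow> real" and \<omega>
    \<comment> \<open>The fine intervals inside one coarse piece are those with index in
      \<open>{l..<m}\<close>, and their increments collapse to the coarse increment.\<close>
    have tele: "(\<Sum>j<K. indicator {p i<..p (Suc i)} (q (Suc j)) * (B (q (Suc j)) \<omega> - B (q j) \<omega>)) = B (p (Suc i)) \<omega> - B (p i) \<omega>"
      if "i < k" for i
    proof -
      obtain l m where l: "l \<le> K" "p i = q l" and m: "m \<le> K" "p (Suc i) = q m"
        using pq [of i] pq [of "Suc i"] \<open>i < k\<close> by auto
      have "l \<le> m" using pD(3) [OF that] l m qle by simp
      have "(\<Sum>j<K. indicator {p i<..p (Suc i)} (q (Suc j)) * (B (q (Suc j)) \<omega> - B (q j) \<omega>))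
         = (\<Sum>j<K. if j \<in> {l..<m} then B (q (Suc j)) \<omega> - B (q j) \<omega> else 0)"
        using l m qiff [of l "Suc _"] qle [of "Suc _" m] by (intro sum.cong) (auto simp: indicator_def)
      also have "\<dots> = (\<Sum>j\<in>{l..<m}. B (q (Suc j)) \<omega> - B (q j) \<omega>)"
        using m by (subst sum.inter_restrict [symmetric]) (auto intro!: sum.cong)
      also have "\<dots> = B (q m) \<omega> - B (q l) \<omega>"
        using sum_Suc_diff' [OF \<open>l \<le> m\<close>, of "\<lambda>j. B (q j) \<omega>"] .
      finally show ?thesis by (simp add: l m)
    qed
    have "simple_ito B K q (\<lambda>j. simple_value k p \<xi> (q (Suc j))) \<omega>
       = (\<Sum>i<k. \<xi> i \<omega> * (\<Sum>j<K. indicator {p i<..p (Suc i)} (q (Suc j)) * (B (q (Suc j)) \<omega> - B (q j) \<omega>)))"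
      unfolding simple_ito_def simple_value_def sum_distrib_right sum_distrib_left
      by (subst sum.swap) (simp add: mult_ac)
    also have "\<dots> = simple_ito B k p \<xi> \<omega>"
      unfolding simple_ito_def by (intro sum.cong refl) (simp only: tele lessThan_iff)
    finally show "simple_ito B K q (\<lambda>j. simple_value k p \<xi> (q (Suc j))) \<omega> = simple_ito B k p \<xi> \<omega>" .
  next
    note pD = simple_integrandD [OF \<xi>]
    fix j assume "j < K"
    have "(\<lambda>\<omega>. indicator {p i<..p (Suc i)} (q (Suc j)) * \<xi> i \<omega>) \<in> borel_measurable (F (q j))" if "i < k" for i
    proof (cases "p i < q (Suc j)")
      case True
      have "p i \<in> Q" using pQ \<open>i < k\<close> by auto
      then obtain l where l: "l \<le> K" "p i = q l" using Qq by blast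
      then have "p i \<le> q j" using True \<open>j < K\<close> qiff [of l "Suc j"] qle [of l j] by simp
      then show ?thesis using F [OF _ pD(4) [OF \<open>i < k\<close>]] by simp
    qed (simp add: indicator_def)
    then show "simple_value k p \<xi> (q (Suc j)) \<in> borel_measurable (F (q j))"
      unfolding simple_value_def by (intro borel_measurable_sum) auto
    have "\<forall>i. \<exists>C. i < k \<longrightarrow> (\<forall>\<omega>\<in>space M. \<bar>\<xi> i \<omega>\<bar> \<le> C)"
      using pD(5) bounded_imageE by metis
    then obtain C where C: "\<And>i \<omega>. i < k \<Longrightarrow> \<omega> \<in> space M \<Longrightarrow> \<bar>\<xi> i \<omega>\<bar> \<le> C i" by metis
    have "\<bar>simple_value k p \<xi> (q (Suc j)) \<omega>\<bar> \<le> (\<Sum>i<k. \<bar>C i\<bar>)" if "\<omega> \<in> space M" for \<omega>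
      unfolding simple_value_def
      by (rule order_trans [OF sum_abs sum_mono]) (use C that in \<open>force simp: indicator_def\<close>)
    then show "bounded (simple_value k p \<xi> (q (Suc j)) ` space M)"
      unfolding bounded_iff by auto
  qed
  note P = part [OF \<xi> Q(5)] and P' = part [OF \<xi>' Q(6)]
  show thesis
  proof (rule that [of K q "\<lambda>j \<omega>. simple_value k p \<xi> (q (Suc j)) \<omega> - simple_value k' p' \<xi>' (q (Suc j)) \<omega>"])
    show "simple_integrand M F a b K q (\<lambda>j \<omega>. simple_value k p \<xi> (q (Suc j)) \<omega> - simple_value k' p' \<xi>' (q (Suc j)) \<omega>)"
      unfolding simple_integrand_def using q0 qK qmono P P' by (auto intro!: bounded_minus_comp borel_measurable_diff)
    fix u \<omega> assume "u \<in> {a<..b}"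
    then show "simple_value K q (\<lambda>j \<omega>. simple_value k p \<xi> (q (Suc j)) \<omega> - simple_value k' p' \<xi>' (q (Suc j)) \<omega>) u \<omega>
        = simple_value k p \<xi> u \<omega> - simple_value k' p' \<xi>' u \<omega>"
      using P P' by (simp add: simple_value_def [of K] right_diff_distrib sum_subtractf)
  next
    fix B \<omega>
    show "simple_ito B K q (\<lambda>j \<omega>. simple_value k p \<xi> (q (Suc j)) \<omega> - simple_value k' p' \<xi>' (q (Suc j)) \<omega>) \<omega>
        = simple_ito B k p \<xi> \<omega> - simple_ito B k' p' \<xi>' \<omega>"
      using P P' by (simp add: simple_ito_def [of _ K] left_diff_distrib sum_subtractf)
  qed
qed

section \<open>Moments, tails and characteristic functions of simple stochastic integrals\<close>

context prob_space
begin

lemma simple_ito_measurable: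
  assumes B: "brownian_on M F B T" and "\<And>i. i < k \<Longrightarrow> p i \<le> p (Suc i)" "\<And>i. i \<le> k \<Longrightarrow> p i \<in> T"
    and "\<And>i. i < k \<Longrightarrow> \<xi> i \<in> borel_measurable (F (p i))"
  shows "simple_ito B k p \<xi> \<in> borel_measurable (F (p k))"
  using assms(2-)
proof (induction k)
  case (Suc k)
  have le: "p k \<le> p (Suc k)" using Suc by simp
  have "simple_ito B k p \<xi> \<in> borel_measurable (F (p (Suc k)))"
    by (rule brownian_on_measurable_mono [OF B le]) (use Suc in auto)
  moreover have "\<xi> k \<in> borel_measurable (F (p (Suc k)))"
    by (rule brownian_on_measurable_mono [OF B le]) (use Suc in auto)
  moreover have "B (p k) \<in> borel_measurable (F (p (Suc k)))" "B (p (Suc k)) \<in> borel_measurable (F (p (Suc k)))"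
    using Suc le by (auto intro!: brownian_on_adapted [OF B])
  ultimately show ?case
    by (simp add: simple_ito_Suc [abs_def] borel_measurable_add borel_measurable_times borel_measurable_diff)
qed (simp add: simple_ito_def [abs_def])

text \<open>The last increment is independent of \<open>F (p k)\<close>: the cross term has mean 0,
  and its square contributes the length of the step. Boundedness of the coefficient makes the cross
  term integrable, given the square integrability from the induction hypothesis.\<close>

lemma simple_ito_isometry:
  assumes B: "brownian_on M F B T" and "\<And>i. i < k \<Longrightarrow> p i \<le> p (Suc i)" "\<And>i. i \<le> k \<Longrightarrow> p i \<in> T"
    and "\<And>i. i < k \<Longrightarrow> \<xi> i \<in> borel_measurable (F (p i))" "\<And>i. i < k \<Longrightarrow> bounded (\<xi> i ` space M)"
  shows "integrable M (\<lambda>\<omega>. (simple_ito B k p \<xi> \<omega>)\<^sup>2) \<and> integrable M (simple_energy k p \<xi>) \<and>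
    expectation (\<lambda>\<omega>. (simple_ito B k p \<xi> \<omega>)\<^sup>2) = expectation (simple_energy k p \<xi>)"
  using assms(2-)
proof (induction k)
  case (Suc k)
  let ?S = "simple_ito B k p \<xi>" and ?D = "\<lambda>\<omega>. B (p (Suc k)) \<omega> - B (p k) \<omega>"
  have IH: "integrable M (\<lambda>\<omega>. (?S \<omega>)\<^sup>2)" "integrable M (simple_energy k p \<xi>)"
    "expectation (\<lambda>\<omega>. (?S \<omega>)\<^sup>2) = expectation (simple_energy k p \<xi>)"
    using Suc by auto
  have SF [measurable]: "?S \<in> borel_measurable (F (p k))"
    by (rule simple_ito_measurable [OF B]) (use Suc in auto)
  have \<xi>F [measurable]: "\<xi> k \<in> borel_measurable (F (p k))"
    using Suc by simp
  have meas: "?S \<in> borel_measurable M" "\<xi> k \<in> borel_measurable M"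
    using brownian_on_measurable [OF B] SF \<xi>F by blast+
  obtain C where C: "0 \<le> C" "\<And>\<omega>. \<omega> \<in> space M \<Longrightarrow> \<bar>\<xi> k \<omega>\<bar> \<le> C"
    using Suc.prems(4) [of k] bounded_imageE [of "\<xi> k" "space M"] by blast
  have intS: "integrable M ?S"
    using square_integrable_imp_integrable [OF meas(1) IH(1)] .
  have i1: "integrable M (\<lambda>\<omega>. 2 * ?S \<omega> * \<xi> k \<omega>)"
  proof (rule Bochner_Integration.integrable_bound [OF integrable_mult_right [OF intS, of "2 * C"]])
    show "AE \<omega> in M. norm (2 * ?S \<omega> * \<xi> k \<omega>) \<le> norm (2 * C * ?S \<omega>)"
    proof (intro AE_I2)
      fix \<omega> assume "\<omega> \<in> space M"
      then show "norm (2 * ?S \<omega> * \<xi> k \<omega>) \<le> norm (2 * C * ?S \<omega>)"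
        using C(1) mult_left_mono [OF C(2), of \<omega> "\<bar>?S \<omega>\<bar>"] by (simp add: abs_mult mult_ac)
    qed
  qed (use meas in measurable)
  have i2: "integrable M (\<lambda>\<omega>. (\<xi> k \<omega>)\<^sup>2)"
  proof (rule integrable_const_bound [where B = "C\<^sup>2"])
    show "AE \<omega> in M. norm ((\<xi> k \<omega>)\<^sup>2) \<le> C\<^sup>2"
      using C by (intro AE_I2) (auto simp: abs_le_square_iff [symmetric] power2_abs intro: order_trans)
  qed (use meas in measurable)
  have su: "p k \<in> T" "p (Suc k) \<in> T" "p k \<le> p (Suc k)"
    using Suc by auto
  have m1: "(\<lambda>\<omega>. 2 * ?S \<omega> * \<xi> k \<omega>) \<in> borel_measurable (F (p k))" and m2: "(\<lambda>\<omega>. (\<xi> k \<omega>)\<^sup>2) \<in> borel_measurable (F (p k))"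
    by measurable
  note r1 = brownian_increment_integral [OF B su m1 i1] and r2 = brownian_increment_integral [OF B su m2 i2]
  have sq: "(simple_ito B (Suc k) p \<xi> \<omega>)\<^sup>2 = (?S \<omega>)\<^sup>2 + 2 * ?S \<omega> * \<xi> k \<omega> * ?D \<omega> + (\<xi> k \<omega>)\<^sup>2 * (?D \<omega>)\<^sup>2" for \<omega>
    by (simp add: simple_ito_Suc power2_eq_square algebra_simps)
  have en: "simple_energy (Suc k) p \<xi> = (\<lambda>\<omega>. simple_energy k p \<xi> \<omega> + (\<xi> k \<omega>)\<^sup>2 * (p (Suc k) - p k))"
    by (simp add: simple_energy_Suc fun_eq_iff)
  show ?case
    unfolding sq en using r1 r2 IH i2 by simp
qed (simp add: simple_ito_def simple_energy_def [abs_def])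

text \<open>Once the accumulated energy exceeds \<open>\<delta>\<close> the integrand is switched off; the isometry and
  Chebyshev's inequality apply to the truncated integrand, which has energy at most \<open>\<delta>\<close>.\<close>

lemma simple_ito_tail:
  assumes B: "brownian_on M F B T" and mono: "\<And>i. i < k \<Longrightarrow> p i \<le> p (Suc i)" and T: "\<And>i. i \<le> k \<Longrightarrow> p i \<in> T"
    and \<xi>: "\<And>i. i < k \<Longrightarrow> \<xi> i \<in> borel_measurable (F (p i))" "\<And>i. i < k \<Longrightarrow> bounded (\<xi> i ` space M)"
    and "0 < \<delta>" "0 < \<epsilon>"
  shows "prob {\<omega> \<in> space M. \<epsilon> < \<bar>simple_ito B k p \<xi> \<omega>\<bar>}
    \<le> prob {\<omega> \<in> space M. \<delta> < simple_energy k p \<xi> \<omega>} + \<delta> / \<epsilon>\<^sup>2"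
proof -
  \<comment> \<open>The cut-off tests the energy including step \<open>i\<close>, which is already
    known at \<open>p i\<close> because \<open>\<xi> i\<close> is; so \<open>\<eta>\<close> is
    adapted and never overshoots \<open>\<delta>\<close>.\<close>
  define \<eta> where "\<eta> i \<omega> = (if simple_energy (Suc i) p \<xi> \<omega> \<le> \<delta> then \<xi> i \<omega> else 0)" for i \<omega>
  have \<xi>M: "\<xi> i \<in> borel_measurable M" if "i < k" for i
    using brownian_on_measurable [OF B \<xi>(1) [OF that]] .
  have enF: "simple_energy (Suc i) p \<xi> \<in> borel_measurable (F (p i))" if "i < k" for i
  proof -
    have "\<xi> j \<in> borel_measurable (F (p i))" if "j < Suc i" for j
      by (rule brownian_on_measurable_mono [OF B _ \<xi>(1)])
         (use that \<open>i < k\<close> chain_mono [of k p j i] mono in auto)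
    then show ?thesis
      unfolding simple_energy_def [abs_def] by (intro borel_measurable_sum borel_measurable_times) (auto intro: borel_measurable_power)
  qed
  have en_mono: "simple_energy i p \<xi> \<omega> \<le> simple_energy j p \<xi> \<omega>" if "i \<le> j" "j \<le> k" for i j \<omega>
    unfolding simple_energy_def using that mono by (intro sum_mono2) auto
  have \<eta>F: "\<eta> i \<in> borel_measurable (F (p i))" if "i < k" for i
    using enF [OF that] \<xi>(1) [OF that] unfolding \<eta>_def [abs_def] by measurable
  have \<eta>b: "bounded (\<eta> i ` space M)" if "i < k" for i
    by (rule bounded_subset [OF bounded_insert [THEN iffD2, OF \<xi>(2) [OF that], of 0]]) (auto simp: \<eta>_def)
  note iso = simple_ito_isometry [of F B T k p \<eta>, OF B mono T \<eta>F \<eta>b]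
  have small: "simple_energy k p \<eta> \<omega> \<le> \<delta>" for \<omega>
  proof -
    \<comment> \<open>The comparison with the energy of \<open>\<xi>\<close> is carried along for
      the steps that are kept: there the bound \<open>\<delta>\<close> is known only for
      \<open>\<xi>\<close>. At a step that is switched off the energy of \<open>\<eta>\<close> does
      not change.\<close>
    have "simple_energy m p \<eta> \<omega> \<le> \<delta> \<and> simple_energy m p \<eta> \<omega> \<le> simple_energy m p \<xi> \<omega>" if "m \<le> k" for m
      using that
    proof (induction m)
      case (Suc m)
      then have "0 \<le> (\<xi> m \<omega>)\<^sup>2 * (p (Suc m) - p m)" using mono [of m] by simp
      with Suc show ?case
        by (cases "simple_energy (Suc m) p \<xi> \<omega> \<le> \<delta>") (auto simp: simple_energy_Suc \<eta>_def)
    qed (use \<open>0 < \<delta>\<close> in \<open>simp add: simple_energy_def\<close>)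
    then show ?thesis by blast
  qed
  have same: "simple_ito B k p \<eta> \<omega> = simple_ito B k p \<xi> \<omega>" if "simple_energy k p \<xi> \<omega> \<le> \<delta>" for \<omega>
    unfolding simple_ito_def using that en_mono [of "Suc _" k \<omega>]
    by (intro sum.cong) (auto simp: \<eta>_def Suc_le_eq intro: order_trans)
  have [measurable]: "simple_ito B k p \<eta> \<in> borel_measurable M" "simple_ito B k p \<xi> \<in> borel_measurable M"
    using brownian_on_measurable [OF B simple_ito_measurable [of F B T k p \<eta>, OF B mono T \<eta>F]]
      brownian_on_measurable [OF B simple_ito_measurable [of F B T k p \<xi>, OF B mono T \<xi>(1)]] by blast+
  have [measurable]: "simple_energy k p \<xi> \<in> borel_measurable M"
    unfolding simple_energy_def [abs_def] using \<xi>M by (intro borel_measurable_sum borel_measurable_times) (auto intro: borel_measurable_power)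
  have "expectation (\<lambda>\<omega>. (simple_ito B k p \<eta> \<omega>)\<^sup>2) \<le> \<delta>"
    using iso small by (auto intro!: integral_le_const)
  moreover have "prob {\<omega> \<in> space M. \<epsilon>\<^sup>2 \<le> (simple_ito B k p \<eta> \<omega>)\<^sup>2} \<le> expectation (\<lambda>\<omega>. (simple_ito B k p \<eta> \<omega>)\<^sup>2) / \<epsilon>\<^sup>2"
    using iso \<open>0 < \<epsilon>\<close> by (intro integral_Markov_inequality_measure [where A = "space M"]) auto
  ultimately have cheb: "prob {\<omega> \<in> space M. \<epsilon>\<^sup>2 \<le> (simple_ito B k p \<eta> \<omega>)\<^sup>2} \<le> \<delta> / \<epsilon>\<^sup>2"
    using \<open>0 < \<epsilon>\<close> by (meson divide_right_mono order_trans zero_le_power2)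
  have "{\<omega> \<in> space M. \<epsilon> < \<bar>simple_ito B k p \<xi> \<omega>\<bar>} \<subseteq>
    {\<omega> \<in> space M. \<delta> < simple_energy k p \<xi> \<omega>} \<union> {\<omega> \<in> space M. \<epsilon>\<^sup>2 \<le> (simple_ito B k p \<eta> \<omega>)\<^sup>2}"
    using same \<open>0 < \<epsilon>\<close> by (auto simp: abs_le_square_iff [symmetric]) (metis less_imp_le not_le)
  then have "prob {\<omega> \<in> space M. \<epsilon> < \<bar>simple_ito B k p \<xi> \<omega>\<bar>} \<le>
    prob ({\<omega> \<in> space M. \<delta> < simple_energy k p \<xi> \<omega>} \<union> {\<omega> \<in> space M. \<epsilon>\<^sup>2 \<le> (simple_ito B k p \<eta> \<omega>)\<^sup>2})"
    by (intro finite_measure_mono) measurable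
  also have "\<dots> \<le> prob {\<omega> \<in> space M. \<delta> < simple_energy k p \<xi> \<omega>} + prob {\<omega> \<in> space M. \<epsilon>\<^sup>2 \<le> (simple_ito B k p \<eta> \<omega>)\<^sup>2}"
    by (intro measure_Un_le) measurable
  finally show ?thesis
    using cheb by simp
qed

text \<open>All coefficients are known at \<open>p 0\<close>. Hence the Gaussian factor that appears
  when the last increment is integrated out may be absorbed into the weight, which is why the
  induction generalises over \<open>Y\<close>. For merely adapted coefficients this factor would
  depend on later times and could not be carried back.\<close>

lemma simple_ito_char:
  assumes B: "brownian_on M F B T" and "\<And>i. i < k \<Longrightarrow> p i \<le> p (Suc i)" "\<And>i. i \<le> k \<Longrightarrow> p i \<in> T"
    and "\<And>i. i < k \<Longrightarrow> \<xi> i \<in> borel_measurable (F (p 0))"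
    and "Y \<in> borel_measurable (F (p 0))" "integrable M Y"
  shows "(\<integral>\<omega>. Y \<omega> * iexp (simple_ito B k p \<xi> \<omega>) \<partial>M) = (\<integral>\<omega>. Y \<omega> * exp (- simple_energy k p \<xi> \<omega> / 2) \<partial>M)"
  using assms(2-)
proof (induction k arbitrary: Y)
  case (Suc k)
  let ?S = "simple_ito B k p \<xi>" and ?v = "p (Suc k) - p k"
  have le: "p 0 \<le> p k" "p k \<le> p (Suc k)"
    using chain_mono [of k p 0 k] Suc.prems(1) by auto
  have lift: "f \<in> borel_measurable (F (p i))" if "f \<in> borel_measurable (F (p 0))" "i \<le> k" for i and f :: "'a \<Rightarrow> 'c::topological_space"
    using brownian_on_measurable_mono [OF B _ that(1)] chain_mono [of k p 0 i] Suc.prems(1) that(2) by auto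
  have [measurable]: "?S \<in> borel_measurable (F (p k))" 
    by (rule simple_ito_measurable [OF B _ _ lift]) (use Suc.prems in auto)
  have [measurable]: "\<xi> k \<in> borel_measurable (F (p k))" "Y \<in> borel_measurable (F (p k))"
    by (rule lift; use Suc.prems in simp)+
  have M [measurable]: "?S \<in> borel_measurable M" "\<xi> k \<in> borel_measurable M" "Y \<in> borel_measurable M"
    by (rule brownian_on_measurable [OF B, of _ "p k"]; measurable)+
  have \<xi>0 [measurable]: "\<xi> k \<in> borel_measurable (F (p 0))" "Y \<in> borel_measurable (F (p 0))"
    using Suc.prems by auto
  have int1: "integrable M (\<lambda>\<omega>. Y \<omega> * iexp (?S \<omega>))"
    by (rule Bochner_Integration.integrable_bound [OF Suc.prems(5)]) (auto simp: norm_mult)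
  have int2: "integrable M (\<lambda>\<omega>. Y \<omega> * exp (- (\<xi> k \<omega>)\<^sup>2 * ?v / 2))"
  proof (rule Bochner_Integration.integrable_bound [OF Suc.prems(5)])
    have "0 \<le> (\<xi> k \<omega>)\<^sup>2 * ?v" for \<omega> using le by simp
    then show "AE \<omega> in M. norm (Y \<omega> * exp (- (\<xi> k \<omega>)\<^sup>2 * ?v / 2)) \<le> norm (Y \<omega>)"
      by (intro AE_I2) (auto simp: norm_mult intro!: mult_left_le)
  qed measurable
  have "(\<integral>\<omega>. Y \<omega> * iexp (simple_ito B (Suc k) p \<xi> \<omega>) \<partial>M)
      = (\<integral>\<omega>. Y \<omega> * iexp (?S \<omega>) * iexp (\<xi> k \<omega> * (B (p (Suc k)) \<omega> - B (p k) \<omega>)) \<partial>M)"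
    by (simp add: simple_ito_Suc exp_add [symmetric] algebra_simps)
  also have "\<dots> = (\<integral>\<omega>. Y \<omega> * iexp (?S \<omega>) * exp (- (\<xi> k \<omega>)\<^sup>2 * ?v / 2) \<partial>M)"
  proof (rule brownian_increment_iexp [OF B _ _ le(2) _ _ int1])
    show "p k \<in> T" "p (Suc k) \<in> T" using Suc.prems(2) by auto
  qed measurable
  also have "\<dots> = (\<integral>\<omega>. (Y \<omega> * exp (- (\<xi> k \<omega>)\<^sup>2 * ?v / 2)) * iexp (?S \<omega>) \<partial>M)"
    by (simp add: mult_ac)
  also have "\<dots> = (\<integral>\<omega>. (Y \<omega> * exp (- (\<xi> k \<omega>)\<^sup>2 * ?v / 2)) * exp (- simple_energy k p \<xi> \<omega> / 2) \<partial>M)"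
  proof (rule Suc.IH [OF _ _ _ _ int2])
    show "(\<lambda>\<omega>. Y \<omega> * exp (- (\<xi> k \<omega>)\<^sup>2 * ?v / 2)) \<in> borel_measurable (F (p 0))"
      by measurable
  qed (use Suc.prems in auto)
  also have "\<dots> = (\<integral>\<omega>. Y \<omega> * exp (- simple_energy (Suc k) p \<xi> \<omega> / 2) \<partial>M)"
  proof -
    have "exp (- (\<xi> k \<omega>)\<^sup>2 * ?v / 2) * exp (- simple_energy k p \<xi> \<omega> / 2) = exp (- simple_energy (Suc k) p \<xi> \<omega> / 2)" for \<omega>
      by (simp add: simple_energy_Suc exp_add [symmetric] add_divide_distrib)
    then show ?thesis
      by (simp only: mult.assoc of_real_mult [symmetric])
  qed
  finally show ?case .
qed (simp add: simple_ito_def simple_energy_def)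

end

subsection \<open>Convergence in probability and the Ito integral\<close>

lemma tendsto_in_probD:
  assumes "tendsto_in_prob M Y L"
  shows "Y n \<in> borel_measurable M" "L \<in> borel_measurable M"
    and "0 < e \<Longrightarrow> (\<lambda>n. measure M {\<omega> \<in> space M. \<bar>Y n \<omega> - L \<omega>\<bar> > e}) \<longlonglongrightarrow> 0"
  using assms unfolding tendsto_in_prob_def by auto

context prob_space
begin

lemma tendsto_in_prob_add:
  assumes "tendsto_in_prob M X L" "tendsto_in_prob M Y L'"
  shows "tendsto_in_prob M (\<lambda>n \<omega>. X n \<omega> + Y n \<omega>) (\<lambda>\<omega>. L \<omega> + L' \<omega>)"
proof -
  note [measurable] = tendsto_in_probD(1,2) [OF assms(1)] tendsto_in_probD(1,2) [OF assms(2)]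
  have "(\<lambda>n. prob {\<omega> \<in> space M. \<bar>X n \<omega> + Y n \<omega> - (L \<omega> + L' \<omega>)\<bar> > e}) \<longlonglongrightarrow> 0" if "0 < e" for e
  proof (rule tendsto_sandwich [OF _ _ tendsto_const])
    show "(\<lambda>n. prob {\<omega> \<in> space M. \<bar>X n \<omega> - L \<omega>\<bar> > e / 2} + prob {\<omega> \<in> space M. \<bar>Y n \<omega> - L' \<omega>\<bar> > e / 2}) \<longlonglongrightarrow> 0"
      using tendsto_in_probD(3) [OF assms(1), of "e / 2"] tendsto_in_probD(3) [OF assms(2), of "e / 2"] that
      by (auto intro: tendsto_add_zero)
    have "prob {\<omega> \<in> space M. \<bar>X n \<omega> + Y n \<omega> - (L \<omega> + L' \<omega>)\<bar> > e}
      \<le> prob ({\<omega> \<in> space M. \<bar>X n \<omega> - L \<omega>\<bar> > e / 2} \<union> {\<omega> \<in> space M. \<bar>Y n \<omega> - L' \<omega>\<bar> > e / 2})" for n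
    proof (rule finite_measure_mono)
      have "e / 2 < \<bar>x - l\<bar> \<or> e / 2 < \<bar>y - l'\<bar>" if "e < \<bar>x + y - (l + l')\<bar>" for x y l l' :: real
        using that by linarith
      then show "{\<omega> \<in> space M. \<bar>X n \<omega> + Y n \<omega> - (L \<omega> + L' \<omega>)\<bar> > e}
        \<subseteq> {\<omega> \<in> space M. \<bar>X n \<omega> - L \<omega>\<bar> > e / 2} \<union> {\<omega> \<in> space M. \<bar>Y n \<omega> - L' \<omega>\<bar> > e / 2}"
        by blast
    qed measurable
    also have "\<dots> n \<le> prob {\<omega> \<in> space M. \<bar>X n \<omega> - L \<omega>\<bar> > e / 2} + prob {\<omega> \<in> space M. \<bar>Y n \<omega> - L' \<omega>\<bar> > e / 2}" for n
      by (rule measure_Un_le) auto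
    finally show "\<forall>\<^sub>F n in sequentially. prob {\<omega> \<in> space M. \<bar>X n \<omega> + Y n \<omega> - (L \<omega> + L' \<omega>)\<bar> > e}
      \<le> prob {\<omega> \<in> space M. \<bar>X n \<omega> - L \<omega>\<bar> > e / 2} + prob {\<omega> \<in> space M. \<bar>Y n \<omega> - L' \<omega>\<bar> > e / 2}"
      by (intro always_eventually allI)
  qed auto
  then show ?thesis
    unfolding tendsto_in_prob_def by auto
qed

lemma tendsto_in_prob_cmult:
  assumes "tendsto_in_prob M X L"
  shows "tendsto_in_prob M (\<lambda>n \<omega>. c * X n \<omega>) (\<lambda>\<omega>. c * L \<omega>)"
proof (cases "c = 0")
  case False
  note [measurable] = tendsto_in_probD(1,2) [OF assms]
  have "e < \<bar>c * x - c * l\<bar> \<longleftrightarrow> e / \<bar>c\<bar> < \<bar>x - l\<bar>" for e x l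
    using False by (simp add: right_diff_distrib [symmetric] abs_mult pos_divide_less_eq mult.commute)
  moreover have "(\<lambda>n. prob {\<omega> \<in> space M. e / \<bar>c\<bar> < \<bar>X n \<omega> - L \<omega>\<bar>}) \<longlonglongrightarrow> 0" if "0 < e" for e
    using tendsto_in_probD(3) [OF assms, of "e / \<bar>c\<bar>"] that False by simp
  ultimately show ?thesis
    unfolding tendsto_in_prob_def by simp
qed (simp add: tendsto_in_prob_def)

lemma tendsto_in_prob_diff:
  assumes "tendsto_in_prob M X L" "tendsto_in_prob M Y L'"
  shows "tendsto_in_prob M (\<lambda>n \<omega>. X n \<omega> - Y n \<omega>) (\<lambda>\<omega>. L \<omega> - L' \<omega>)"
  using tendsto_in_prob_add [OF assms(1) tendsto_in_prob_cmult [OF assms(2), of "-1"]] by simp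

lemma tendsto_in_prob_AE_unique:
  assumes "tendsto_in_prob M X L" "tendsto_in_prob M X L'"
  shows "AE \<omega> in M. L \<omega> = L' \<omega>"
proof -
  note [measurable] = tendsto_in_probD(1,2) [OF assms(1)] tendsto_in_probD(1,2) [OF assms(2)]
  \<comment> \<open>Subtracting the sequence from itself gives a constant sequence, so its
    probabilities of deviation do not depend on the index and must vanish.\<close>
  have lim: "tendsto_in_prob M (\<lambda>n \<omega>. 0) (\<lambda>\<omega>. L \<omega> - L' \<omega>)"
    using tendsto_in_prob_diff [OF assms] by simp
  have "AE \<omega> in M. \<not> 1 / real (Suc m) < \<bar>L \<omega> - L' \<omega>\<bar>" for m
  proof -
    have "prob {\<omega> \<in> space M. 1 / real (Suc m) < \<bar>L \<omega> - L' \<omega>\<bar>} = 0"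
      using tendsto_in_probD(3) [OF lim, of "1 / real (Suc m)"] by (simp add: tendsto_const_iff abs_minus_commute)
    then show ?thesis
      by (subst AE_iff_measurable [OF _ refl]) (auto simp: emeasure_eq_measure)
  qed
  then have "AE \<omega> in M. \<forall>m. \<not> 1 / real (Suc m) < \<bar>L \<omega> - L' \<omega>\<bar>"
    by (simp add: AE_all_countable)
  then show ?thesis
  proof eventually_elim
    case (elim \<omega>)
    show ?case
    proof (rule ccontr)
      assume "L \<omega> \<noteq> L' \<omega>"
      then obtain m where "inverse (real (Suc m)) < \<bar>L \<omega> - L' \<omega>\<bar>"
        using reals_Archimedean [of "\<bar>L \<omega> - L' \<omega>\<bar>"] by auto
      with elim show False by (auto simp: inverse_eq_divide)
    qed
  qed
qed

lemma tendsto_in_prob_cong_AE: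
  assumes "tendsto_in_prob M X L" "AE \<omega> in M. L \<omega> = L' \<omega>" "L' \<in> borel_measurable M"
  shows "tendsto_in_prob M X L'"
proof -
  note [measurable] = tendsto_in_probD(1,2) [OF assms(1)] assms(3)
  have "prob {\<omega> \<in> space M. e < \<bar>X n \<omega> - L' \<omega>\<bar>} = prob {\<omega> \<in> space M. e < \<bar>X n \<omega> - L \<omega>\<bar>}" for n e
    by (rule measure_eq_AE) (use assms(2) in auto)
  then show ?thesis
    using assms(1,3) unfolding tendsto_in_prob_def by simp
qed

lemma AE_tendsto_in_prob_0:
  assumes [measurable]: "\<And>n. V n \<in> borel_measurable M" and lim: "AE \<omega> in M. (\<lambda>n. V n \<omega>) \<longlonglongrightarrow> (0::real)"
  shows "tendsto_in_prob M V (\<lambda>_. 0)"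
proof -
  have "(\<lambda>n. prob {\<omega> \<in> space M. \<bar>V n \<omega>\<bar> > e}) \<longlonglongrightarrow> 0" if "0 < e" for e
  proof -
    have "(\<lambda>n. \<integral>\<omega>. indicator {\<omega> \<in> space M. \<bar>V n \<omega>\<bar> > e} \<omega> \<partial>M) \<longlonglongrightarrow> (\<integral>\<omega>. (0::real) \<partial>M)"
    proof (rule integral_dominated_convergence [where w = "\<lambda>_. 1"])
      show "AE \<omega> in M. (\<lambda>n. indicat_real {\<omega> \<in> space M. \<bar>V n \<omega>\<bar> > e} \<omega>) \<longlonglongrightarrow> 0"
        using lim
      proof eventually_elim
        case (elim \<omega>)
        then have "\<forall>\<^sub>F n in sequentially. \<bar>V n \<omega>\<bar> < e"
          using that by (simp add: tendsto_iff)
        then have "\<forall>\<^sub>F n in sequentially. indicat_real {\<omega> \<in> space M. \<bar>V n \<omega>\<bar> > e} \<omega> = 0"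
          by eventually_elim auto
        then show ?case by (rule tendsto_eventually)
      qed
    qed (auto simp: indicator_def)
    then show ?thesis by simp
  qed
  then show ?thesis
    unfolding tendsto_in_prob_def by auto
qed

text \<open>\<open>T\<close> need not be measurable, which is why its almost sure convergence is assumed.\<close>

lemma tendsto_in_prob_0_le:
  assumes [measurable]: "\<And>n. Q n \<in> borel_measurable M" and Q: "\<And>n \<omega>. 0 \<le> Q n \<omega>"
    and R: "tendsto_in_prob M R (\<lambda>_. 0)"
    and le: "AE \<omega> in M. \<forall>n. Q n \<omega> \<le> R n \<omega> + T n \<omega>" and T: "AE \<omega> in M. (\<lambda>n. T n \<omega>) \<longlonglongrightarrow> (0::real)"
  shows "tendsto_in_prob M Q (\<lambda>_. 0)"
proof -
  note [measurable] = tendsto_in_probD(1) [OF R]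
  \<comment> \<open>The positive part of \<open>Q - R\<close> is measurable and at most the positive
    part of \<open>T\<close>; it replaces \<open>T\<close> by an error whose convergence in
    probability can be stated.\<close>
  define V where "V n \<omega> = max 0 (Q n \<omega> - R n \<omega>)" for n \<omega>
  have [measurable]: "V n \<in> borel_measurable M" for n
    unfolding V_def [abs_def] by measurable
  have "AE \<omega> in M. (\<lambda>n. V n \<omega>) \<longlonglongrightarrow> 0"
    using le T
  proof eventually_elim
    case (elim \<omega>)
    have lim: "(\<lambda>n. max 0 (T n \<omega>)) \<longlonglongrightarrow> 0"
      using tendsto_max [OF tendsto_const elim(2), of 0] by simp
    show ?case
    proof (rule tendsto_sandwich [OF _ _ tendsto_const lim])
      show "\<forall>\<^sub>F n in sequentially. V n \<omega> \<le> max 0 (T n \<omega>)"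
        unfolding V_def using elim(1)
        by (intro always_eventually allI max.mono) (simp_all add: diff_le_eq add.commute)
    qed (simp add: V_def)
  qed
  then have RV: "tendsto_in_prob M (\<lambda>n \<omega>. R n \<omega> + V n \<omega>) (\<lambda>_. 0)"
    using tendsto_in_prob_add [OF R AE_tendsto_in_prob_0 [of V]] by simp
  have "(\<lambda>n. prob {\<omega> \<in> space M. \<bar>Q n \<omega> - 0\<bar> > e}) \<longlonglongrightarrow> 0" if "0 < e" for e
  proof (rule tendsto_sandwich [OF _ _ tendsto_const tendsto_in_probD(3) [OF RV that]])
    have "Q n \<omega> \<le> R n \<omega> + V n \<omega>" for n \<omega>
      by (auto simp: V_def)
    then have "\<bar>Q n \<omega> - 0\<bar> \<le> \<bar>R n \<omega> + V n \<omega> - 0\<bar>" for n \<omega>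
      using Q [of n \<omega>] by (smt (verit))
    then show "\<forall>\<^sub>F n in sequentially. prob {\<omega> \<in> space M. \<bar>Q n \<omega> - 0\<bar> > e} \<le> prob {\<omega> \<in> space M. \<bar>R n \<omega> + V n \<omega> - 0\<bar> > e}"
      by (intro always_eventually allI finite_measure_mono) (auto intro: less_le_trans)
  qed auto
  then show ?thesis
    unfolding tendsto_in_prob_def by auto
qed

section \<open>Independence of the Ito integral from the approximating sequence\<close>

lemma simple_energy_measurable:
  assumes B: "brownian_on M F B T" and \<xi>: "simple_integrand M F a b k p \<xi>"
  shows "simple_energy k p \<xi> \<in> borel_measurable M"
  unfolding simple_energy_def [abs_def]
  using brownian_on_measurable [OF B simple_integrandD(4) [OF \<xi>]]
  by (intro borel_measurable_sum borel_measurable_times borel_measurable_power) auto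

lemma simple_ito_tendsto_0:
  assumes B: "brownian_on M F B T" and ab: "{a..b} \<subseteq> T"
    and \<xi>: "\<And>n. simple_integrand M F a b (k n) (p n) (\<xi> n)"
    and lim: "tendsto_in_prob M (\<lambda>n. simple_energy (k n) (p n) (\<xi> n)) (\<lambda>_. 0)"
  shows "tendsto_in_prob M (\<lambda>n. simple_ito B (k n) (p n) (\<xi> n)) (\<lambda>_. 0)"
proof -
  note \<xi>D = simple_integrandD [OF \<xi>]
  have pT: "p n i \<in> T" if "i \<le> k n" for n i
    using \<xi>D(6) [OF that] ab by blast
  have meas: "simple_ito B (k n) (p n) (\<xi> n) \<in> borel_measurable M" for n
    by (rule brownian_on_measurable [OF B], rule simple_ito_measurable [OF B]) (use \<xi>D pT in auto)
  have "(\<lambda>n. prob {\<omega> \<in> space M. \<epsilon> < \<bar>simple_ito B (k n) (p n) (\<xi> n) \<omega>\<bar>}) \<longlonglongrightarrow> 0" if "0 < \<epsilon>" for \<epsilon>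
  proof (rule LIMSEQ_I)
    fix r :: real assume "0 < r"
    \<comment> \<open>Chosen so that the Chebyshev term \<open>\<delta> / \<epsilon>\<^sup>2\<close>
      of the tail bound equals \<open>r / 2\<close>.\<close>
    define \<delta> where "\<delta> = r / 2 * \<epsilon>\<^sup>2"
    have "0 < \<delta>" using \<open>0 < r\<close> \<open>0 < \<epsilon>\<close> by (simp add: \<delta>_def)
    have "0 \<le> simple_energy (k n) (p n) (\<xi> n) \<omega>" for n \<omega>
      using \<xi>D(3) by (rule simple_energy_nonneg)
    then have "(\<lambda>n. prob {\<omega> \<in> space M. \<delta> < simple_energy (k n) (p n) (\<xi> n) \<omega>}) \<longlonglongrightarrow> 0"
      using tendsto_in_probD(3) [OF lim \<open>0 < \<delta>\<close>] by simp
    then obtain N where N: "\<And>n. n \<ge> N \<Longrightarrow> prob {\<omega> \<in> space M. \<delta> < simple_energy (k n) (p n) (\<xi> n) \<omega>} < r / 2"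
      using LIMSEQ_D [of _ 0 "r / 2"] \<open>0 < r\<close> by force
    have "prob {\<omega> \<in> space M. \<epsilon> < \<bar>simple_ito B (k n) (p n) (\<xi> n) \<omega>\<bar>} < r" if "n \<ge> N" for n
    proof -
      have "prob {\<omega> \<in> space M. \<epsilon> < \<bar>simple_ito B (k n) (p n) (\<xi> n) \<omega>\<bar>}
        \<le> prob {\<omega> \<in> space M. \<delta> < simple_energy (k n) (p n) (\<xi> n) \<omega>} + \<delta> / \<epsilon>\<^sup>2"
        by (rule simple_ito_tail [OF B]) (use \<xi>D pT \<open>0 < \<delta>\<close> \<open>0 < \<epsilon>\<close> in auto)
      also have "\<delta> / \<epsilon>\<^sup>2 = r / 2" using \<open>0 < \<epsilon>\<close> by (simp add: \<delta>_def)
      finally show ?thesis using N [OF that] by simp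
    qed
    then show "\<exists>N. \<forall>n\<ge>N. norm (prob {\<omega> \<in> space M. \<epsilon> < \<bar>simple_ito B (k n) (p n) (\<xi> n) \<omega>\<bar>} - 0) < r"
      by auto
  qed
  then show ?thesis
    using meas unfolding tendsto_in_prob_def by simp
qed

text \<open>The energy of the difference is controlled by
  \<open>(x - y)\<^sup>2 \<le> 2 * x\<^sup>2 + 2 * y\<^sup>2\<close>. The bound has two parts:
  \<open>R\<close> takes errors that vanish in probability, as in the definition of the integral,
  and \<open>U\<close> takes the error of sampled integrands, which vanishes almost surely but is
  not known to be measurable.\<close>

lemma simple_ito_diff_tendsto_0:
  assumes B: "brownian_on M F B T" and ab: "{a..b} \<subseteq> T"
    and H: "AE \<omega> in M. (\<lambda>u. H u \<omega>) integrable_on {a..b} \<and> (\<lambda>u. (H u \<omega>)\<^sup>2) integrable_on {a..b}"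
    and \<xi>: "\<And>n. simple_integrand M F a b (k n) (p n) (\<xi> n)" and \<xi>': "\<And>n. simple_integrand M F a b (k' n) (p' n) (\<xi>' n)"
    and R: "tendsto_in_prob M R (\<lambda>_. 0)" and U: "AE \<omega> in M. (\<lambda>n. U n \<omega>) \<longlonglongrightarrow> (0::real)"
    and le: "AE \<omega> in M. \<forall>n. 2 * integral {a..b} (\<lambda>u. (simple_value (k n) (p n) (\<xi> n) u \<omega> - H u \<omega>)\<^sup>2)
      + 2 * integral {a..b} (\<lambda>u. (simple_value (k' n) (p' n) (\<xi>' n) u \<omega> - H u \<omega>)\<^sup>2) \<le> R n \<omega> + U n \<omega>"
  shows "tendsto_in_prob M (\<lambda>n \<omega>. simple_ito B (k n) (p n) (\<xi> n) \<omega> - simple_ito B (k' n) (p' n) (\<xi>' n) \<omega>) (\<lambda>_. 0)"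
proof -
  have "\<exists>K q \<eta>. simple_integrand M F a b K q \<eta> \<and>
    (\<forall>u\<in>{a<..b}. \<forall>\<omega>. simple_value K q \<eta> u \<omega> = simple_value (k n) (p n) (\<xi> n) u \<omega> - simple_value (k' n) (p' n) (\<xi>' n) u \<omega>) \<and>
    (\<forall>\<omega>. simple_ito B K q \<eta> \<omega> = simple_ito B (k n) (p n) (\<xi> n) \<omega> - simple_ito B (k' n) (p' n) (\<xi>' n) \<omega>)" for n
    by (rule simple_integrand_diff [OF brownian_on_measurable_mono [OF B] \<xi> [of n] \<xi>' [of n]]) blast+
  then obtain K q \<eta> where \<eta>: "\<And>n. simple_integrand M F a b (K n) (q n) (\<eta> n)"
    and val: "\<And>n u \<omega>. u \<in> {a<..b} \<Longrightarrow> simple_value (K n) (q n) (\<eta> n) u \<omega> =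
      simple_value (k n) (p n) (\<xi> n) u \<omega> - simple_value (k' n) (p' n) (\<xi>' n) u \<omega>"
    and ito: "\<And>n \<omega>. simple_ito B (K n) (q n) (\<eta> n) \<omega> = simple_ito B (k n) (p n) (\<xi> n) \<omega> - simple_ito B (k' n) (p' n) (\<xi>' n) \<omega>"
    by metis
  note \<eta>D = simple_integrandD [OF \<eta>] and \<xi>D = simple_integrandD [OF \<xi>] and \<xi>'D = simple_integrandD [OF \<xi>']
  have "tendsto_in_prob M (\<lambda>n. simple_energy (K n) (q n) (\<eta> n)) (\<lambda>_. 0)"
  proof (rule tendsto_in_prob_0_le [OF _ _ R _ U])
    show "simple_energy (K n) (q n) (\<eta> n) \<in> borel_measurable M" for n
      by (rule simple_energy_measurable [OF B \<eta>])
    show "0 \<le> simple_energy (K n) (q n) (\<eta> n) \<omega>" for n \<omega>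
      using \<eta>D(3) by (rule simple_energy_nonneg)
    show "AE \<omega> in M. \<forall>n. simple_energy (K n) (q n) (\<eta> n) \<omega> \<le> R n \<omega> + U n \<omega>"
      using le H
    proof eventually_elim
      case (elim \<omega>)
      show ?case
      proof
        fix n
        let ?f = "\<lambda>u. simple_value (k n) (p n) (\<xi> n) u \<omega> - H u \<omega>"
        let ?g = "\<lambda>u. simple_value (k' n) (p' n) (\<xi>' n) u \<omega> - H u \<omega>"
        have int: "(\<lambda>u. (?f u)\<^sup>2) integrable_on {a..b}" "(\<lambda>u. (?g u)\<^sup>2) integrable_on {a..b}"
          using integrable_simple_value_diff_sq [of "k n" "p n", OF \<xi>D(3), of "\<lambda>u. H u \<omega>" "\<xi> n" \<omega>]
            integrable_simple_value_diff_sq [of "k' n" "p' n", OF \<xi>'D(3), of "\<lambda>u. H u \<omega>" "\<xi>' n" \<omega>] elim(2)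
          by (simp_all add: \<xi>D(1,2) \<xi>'D(1,2))
        have hi: "((\<lambda>u. (?f u - ?g u)\<^sup>2) has_integral simple_energy (K n) (q n) (\<eta> n) \<omega>) {a..b}"
        \<comment> \<open>The refinement identity for the values holds on \<open>{a<..b}\<close>, so
          the left end is spiked out.\<close>
        proof (rule has_integral_spike_finite [of "{a}"])
          show "((\<lambda>u. (simple_value (K n) (q n) (\<eta> n) u \<omega>)\<^sup>2) has_integral simple_energy (K n) (q n) (\<eta> n) \<omega>) {a..b}"
            using has_integral_simple_value_sq [of "K n" "q n", OF \<eta>D(3)] by (simp add: \<eta>D(1,2))
        qed (use val in auto)
        have "simple_energy (K n) (q n) (\<eta> n) \<omega> \<le> integral {a..b} (\<lambda>u. 2 * (?f u)\<^sup>2 + 2 * (?g u)\<^sup>2)"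
        proof (rule has_integral_le [OF hi integrable_integral])
          show "(\<lambda>u. 2 * (?f u)\<^sup>2 + 2 * (?g u)\<^sup>2) integrable_on {a..b}"
            using int by (intro integrable_add integrable_on_mult_right)
          fix u
          have "(x - y)\<^sup>2 \<le> 2 * x\<^sup>2 + 2 * y\<^sup>2" for x y :: real
            using zero_le_power2 [of "x + y"] by (simp add: power2_eq_square algebra_simps)
          then show "(?f u - ?g u)\<^sup>2 \<le> 2 * (?f u)\<^sup>2 + 2 * (?g u)\<^sup>2" .
        qed
        also have "\<dots> = 2 * integral {a..b} (\<lambda>u. (?f u)\<^sup>2) + 2 * integral {a..b} (\<lambda>u. (?g u)\<^sup>2)"
          using int by (subst integral_add) (auto intro: integrable_on_mult_right)
        also have "\<dots> \<le> R n \<omega> + U n \<omega>"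
          using elim(1) by blast
        finally show "simple_energy (K n) (q n) (\<eta> n) \<omega> \<le> R n \<omega> + U n \<omega>" .
      qed
    qed
  qed
  from simple_ito_tendsto_0 [OF B ab \<eta> this] show ?thesis
    by (simp add: ito [abs_def])
qed

text \<open>The difference of the two approximating sequences of integrals tends to 0 as well as to
  \<open>J - J'\<close>.\<close>

lemma has_ito_integral_unique:
  assumes B: "brownian_on M F B T" and ab: "{a..b} \<subseteq> T"
    and J: "has_ito_integral M F B a b H J" and J': "has_ito_integral M F B a b H J'"
  shows "AE \<omega> in M. J \<omega> = J' \<omega>"
proof -
  from J obtain k p \<xi> where \<xi>: "\<And>n. simple_integrand M F a b (k n) (p n) (\<xi> n)"
    "tendsto_in_prob M (\<lambda>n \<omega>. integral {a..b} (\<lambda>u. (simple_value (k n) (p n) (\<xi> n) u \<omega> - H u \<omega>)\<^sup>2)) (\<lambda>_. 0)"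
    "tendsto_in_prob M (\<lambda>n. simple_ito B (k n) (p n) (\<xi> n)) J"
    unfolding has_ito_integral_def by blast
  from J' obtain k' p' \<xi>' where \<xi>': "\<And>n. simple_integrand M F a b (k' n) (p' n) (\<xi>' n)"
    "tendsto_in_prob M (\<lambda>n \<omega>. integral {a..b} (\<lambda>u. (simple_value (k' n) (p' n) (\<xi>' n) u \<omega> - H u \<omega>)\<^sup>2)) (\<lambda>_. 0)"
    "tendsto_in_prob M (\<lambda>n. simple_ito B (k' n) (p' n) (\<xi>' n)) J'"
    unfolding has_ito_integral_def by blast
  have H: "AE \<omega> in M. (\<lambda>u. H u \<omega>) integrable_on {a..b} \<and> (\<lambda>u. (H u \<omega>)\<^sup>2) integrable_on {a..b}"
    using J unfolding has_ito_integral_def by blast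
  have R: "tendsto_in_prob M (\<lambda>n \<omega>. 2 * integral {a..b} (\<lambda>u. (simple_value (k n) (p n) (\<xi> n) u \<omega> - H u \<omega>)\<^sup>2)
      + 2 * integral {a..b} (\<lambda>u. (simple_value (k' n) (p' n) (\<xi>' n) u \<omega> - H u \<omega>)\<^sup>2)) (\<lambda>_. 0)"
    using tendsto_in_prob_add [OF tendsto_in_prob_cmult [OF \<xi>(2), of 2] tendsto_in_prob_cmult [OF \<xi>'(2), of 2]] by simp
  have "tendsto_in_prob M (\<lambda>n \<omega>. simple_ito B (k n) (p n) (\<xi> n) \<omega> - simple_ito B (k' n) (p' n) (\<xi>' n) \<omega>) (\<lambda>_. 0)"
    by (rule simple_ito_diff_tendsto_0 [OF B ab H \<xi>(1) \<xi>'(1) R, where U = "\<lambda>_ _. 0"]) auto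
  from tendsto_in_prob_AE_unique [OF this tendsto_in_prob_diff [OF \<xi>(3) \<xi>'(3)]] show ?thesis
    by (auto elim: AE_mp)
qed

lemma has_ito_integral_cong_AE:
  assumes "has_ito_integral M F B a b H J" "AE \<omega> in M. J \<omega> = J' \<omega>" "J' \<in> borel_measurable M"
  shows "has_ito_integral M F B a b H J'"
  using assms tendsto_in_prob_cong_AE unfolding has_ito_integral_def by blast

text \<open>Uniqueness identifies integrals of one and the same integrand; scaling extends this to
  the proportional integrands of price and variance.\<close>

lemma has_ito_integral_cmult:
  assumes "has_ito_integral M F B a b H J"
  shows "has_ito_integral M F B a b (\<lambda>u \<omega>. c * H u \<omega>) (\<lambda>\<omega>. c * J \<omega>)"
proof -
  from assms obtain k p \<xi> where \<xi>: "\<And>n. simple_integrand M F a b (k n) (p n) (\<xi> n)"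
    "tendsto_in_prob M (\<lambda>n \<omega>. integral {a..b} (\<lambda>u. (simple_value (k n) (p n) (\<xi> n) u \<omega> - H u \<omega>)\<^sup>2)) (\<lambda>_. 0)"
    "tendsto_in_prob M (\<lambda>n. simple_ito B (k n) (p n) (\<xi> n)) J"
    unfolding has_ito_integral_def by blast
  have H: "AE \<omega> in M. (\<lambda>u. H u \<omega>) integrable_on {a..b} \<and> (\<lambda>u. (H u \<omega>)\<^sup>2) integrable_on {a..b}"
    using assms unfolding has_ito_integral_def by blast
  have "AE \<omega> in M. (\<lambda>u. c * H u \<omega>) integrable_on {a..b} \<and> (\<lambda>u. (c * H u \<omega>)\<^sup>2) integrable_on {a..b}"
    using H by eventually_elim (auto simp: power_mult_distrib intro: integrable_on_mult_right)
  moreover have "simple_integrand M F a b (k n) (p n) (\<lambda>i \<omega>. c * \<xi> n i \<omega>)" for n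
    using \<xi>(1) [of n] bounded_scaling [of "\<xi> n _ ` space M" c] unfolding simple_integrand_def by (auto simp: image_image)
  moreover have "(simple_value (k n) (p n) (\<lambda>i \<omega>. c * \<xi> n i \<omega>) u \<omega> - c * H u \<omega>)\<^sup>2
      = c\<^sup>2 * (simple_value (k n) (p n) (\<xi> n) u \<omega> - H u \<omega>)\<^sup>2" for n u \<omega>
  proof -
    have "simple_value (k n) (p n) (\<lambda>i \<omega>. c * \<xi> n i \<omega>) u \<omega> = c * simple_value (k n) (p n) (\<xi> n) u \<omega>"
      unfolding simple_value_def sum_distrib_left by (intro sum.cong refl) (simp only: mult_ac)
    then show ?thesis
      by (simp add: right_diff_distrib [symmetric] power_mult_distrib)
  qed
  then have "tendsto_in_prob M (\<lambda>n \<omega>. integral {a..b} (\<lambda>u. (simple_value (k n) (p n) (\<lambda>i \<omega>. c * \<xi> n i \<omega>) u \<omega> - c * H u \<omega>)\<^sup>2)) (\<lambda>_. 0)"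
    using tendsto_in_prob_cmult [OF \<xi>(2), of "c\<^sup>2"] by simp
  moreover have "tendsto_in_prob M (\<lambda>n. simple_ito B (k n) (p n) (\<lambda>i \<omega>. c * \<xi> n i \<omega>)) (\<lambda>\<omega>. c * J \<omega>)"
    using tendsto_in_prob_cmult [OF \<xi>(3), of c] by (simp add: simple_ito_def [abs_def] sum_distrib_left mult.assoc)
  ultimately show ?thesis
    unfolding has_ito_integral_def by (intro conjI exI [of _ k] exI [of _ p] exI [of _ "\<lambda>n i \<omega>. c * \<xi> n i \<omega>"]) auto
qed

end

subsection \<open>Integrands known in advance\<close>

text \<open>The partition has \<open>Suc n\<close> pieces, so that index 0 already gives a partition
  of the interval.\<close>

definition grid :: "real \<Rightarrow> real \<Rightarrow> nat \<Rightarrow> nat \<Rightarrow> real" where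
  "grid a b n i = a + real i * ((b - a) / real (Suc n))"

definition clip :: "nat \<Rightarrow> real \<Rightarrow> real" where
  "clip n x = max (- real n) (min (real n) x)"

text \<open>Clipping keeps the integrand bounded, as required of simple integrands.\<close>

definition sampled :: "real \<Rightarrow> real \<Rightarrow> (real \<Rightarrow> 'a \<Rightarrow> real) \<Rightarrow> nat \<Rightarrow> nat \<Rightarrow> 'a \<Rightarrow> real" where
  "sampled a b g n i \<omega> = clip n (g (grid a b n i) \<omega>)"

lemma grid_0 [simp]: "grid a b n 0 = a"
  by (simp add: grid_def)

lemma grid_Suc_n [simp]: "grid a b n (Suc n) = b"
  by (simp add: grid_def)

lemma grid_step: "grid a b n (Suc i) - grid a b n i = (b - a) / real (Suc n)"
proof -
  have "a + real (Suc i) * x - (a + real i * x) = x" for x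
    by (simp add: algebra_simps)
  then show ?thesis unfolding grid_def .
qed

lemma grid_mono: "a \<le> b \<Longrightarrow> grid a b n i \<le> grid a b n (Suc i)"
  using grid_step [of a b n i] by (smt (verit) divide_nonneg_nonneg of_nat_0_le_iff)

lemma grid_mem: "a \<le> b \<Longrightarrow> i \<le> Suc n \<Longrightarrow> grid a b n i \<in> {a..b}"
  using chain_mono [of "Suc n" "grid a b n" 0 i] chain_mono [of "Suc n" "grid a b n" i "Suc n"] grid_mono by simp

lemma clip_bound: "\<bar>clip n x\<bar> \<le> real n" "\<bar>clip n x\<bar> \<le> \<bar>x\<bar>"
  by (auto simp: clip_def)

lemma clip_eq: "\<bar>x\<bar> \<le> real n \<Longrightarrow> clip n x = x"
  by (auto simp: clip_def)

lemma simple_integrand_sampled: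
  assumes B: "brownian_on M F B T" and "a \<le> b" and g: "\<And>u. u \<in> {a..b} \<Longrightarrow> g u \<in> borel_measurable (F a)"
  shows "simple_integrand M F a b (Suc n) (grid a b n) (sampled a b g n)"
  unfolding simple_integrand_def
proof (intro conjI allI impI)
  fix i assume i: "i < Suc n"
  have "g (grid a b n i) \<in> borel_measurable (F (grid a b n i))"
    by (rule brownian_on_measurable_mono [OF B _ g]) (use grid_mem [of a b i n] \<open>a \<le> b\<close> i in auto)
  then show "sampled a b g n i \<in> borel_measurable (F (grid a b n i))"
    unfolding sampled_def [abs_def] clip_def [abs_def] by measurable
  show "bounded (sampled a b g n i ` space M)"
    unfolding bounded_iff sampled_def using clip_bound(1) by (auto intro!: exI [of _ "real n"])
qed (use grid_mono \<open>a \<le> b\<close> in auto)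

text \<open>The estimate is pathwise: \<open>N\<close> depends on \<open>\<omega>\<close> through
  the modulus of continuity and the bound of the path, so only almost sure convergence can be drawn
  from it.\<close>

lemma sampled_approx:
  assumes "a \<le> b" and cont: "continuous_on {a..b} (\<lambda>u. g u \<omega>)" and "0 < e"
  obtains N where "\<And>n i u. N \<le> n \<Longrightarrow> i < Suc n \<Longrightarrow> u \<in> {grid a b n i..grid a b n (Suc i)} \<Longrightarrow>
    \<bar>sampled a b g n i \<omega> - g u \<omega>\<bar> \<le> e"
proof -
  have "uniformly_continuous_on {a..b} (\<lambda>u. g u \<omega>)"
    by (rule compact_uniformly_continuous [OF cont compact_Icc])
  then obtain d where "0 < d" and d: "\<And>u v. u \<in> {a..b} \<Longrightarrow> v \<in> {a..b} \<Longrightarrow> \<bar>u - v\<bar> < d \<Longrightarrow> \<bar>g u \<omega> - g v \<omega>\<bar> < e"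
    using \<open>0 < e\<close> unfolding uniformly_continuous_on_def by (auto simp: dist_real_def)
  obtain K where "0 < K" and K: "\<And>u. u \<in> {a..b} \<Longrightarrow> \<bar>g u \<omega>\<bar> \<le> K"
    using compact_imp_bounded [OF compact_continuous_image [OF cont compact_Icc]]
    unfolding bounded_pos by auto
  \<comment> \<open>From \<open>N1\<close> on the clipping is inactive along this path; from
    \<open>N2\<close> on the mesh is below the modulus \<open>d\<close>.\<close>
  obtain N1 :: nat where N1: "K \<le> real N1" using real_arch_simple by blast
  obtain N2 :: nat where N2: "(b - a) / d < real N2" using reals_Archimedean2 by blast
  show thesis
  proof (rule that [of "max N1 N2"])
    fix n i u assume n: "max N1 N2 \<le> n" and i: "i < Suc n" and u: "u \<in> {grid a b n i..grid a b n (Suc i)}"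
    have gi: "grid a b n i \<in> {a..b}" "grid a b n (Suc i) \<in> {a..b}"
      using grid_mem [OF \<open>a \<le> b\<close>] i by auto
    have "\<bar>g (grid a b n i) \<omega>\<bar> \<le> real n"
      using K [OF gi(1)] N1 n by simp
    then have s: "sampled a b g n i \<omega> = g (grid a b n i) \<omega>"
      by (simp add: sampled_def clip_eq)
    have "b - a < d * real N2"
      using N2 \<open>0 < d\<close> by (simp add: field_simps)
    also have "\<dots> \<le> d * real (Suc n)"
      using n \<open>0 < d\<close> by (intro mult_left_mono) auto
    finally have "(b - a) / real (Suc n) < d"
      by (simp add: divide_less_eq)
    then have "\<bar>grid a b n i - u\<bar> < d"
      using u grid_step [of a b n i] by simp
    then show "\<bar>sampled a b g n i \<omega> - g u \<omega>\<bar> \<le> e"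
      using d [of "grid a b n i" u] gi u by (simp add: s less_imp_le)
  qed
qed

text \<open>Used with \<open>(x - g u \<omega>)\<^sup>2\<close> for the approximation error and with
  \<open>x\<^sup>2 - (g u \<omega>)\<^sup>2\<close> for the error in the energy; both are small on
  every piece and continuous in time once the value is frozen.\<close>

lemma grid_integral_bound:
  fixes \<phi> :: "real \<Rightarrow> real \<Rightarrow> real"
  assumes "a \<le> b" and cont: "\<And>x. continuous_on {a..b} (\<phi> x)" and "0 \<le> c"
    and bound: "\<And>i u. i < Suc n \<Longrightarrow> u \<in> {grid a b n i..grid a b n (Suc i)} \<Longrightarrow> \<bar>\<phi> (\<xi> i \<omega>) u\<bar> \<le> c"
  obtains J where "((\<lambda>u. \<phi> (simple_value (Suc n) (grid a b n) \<xi> u \<omega>) u) has_integral J) {a..b}" "\<bar>J\<bar> \<le> c * (b - a)"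
proof -
  define J where "J i = integral {grid a b n i..grid a b n (Suc i)} (\<phi> (\<xi> i \<omega>))" for i
  have J: "(\<phi> (\<xi> i \<omega>) has_integral J i) {grid a b n i..grid a b n (Suc i)}" if "i < Suc n" for i
  proof -
    have "{grid a b n i..grid a b n (Suc i)} \<subseteq> {a..b}"
      using grid_mem [OF \<open>a \<le> b\<close>, of i n] grid_mem [OF \<open>a \<le> b\<close>, of "Suc i" n] that by auto
    then show ?thesis
      unfolding J_def by (intro integrable_integral integrable_continuous_interval continuous_on_subset [OF cont])
  qed
  have bJ: "\<bar>J i\<bar> \<le> c * ((b - a) / real (Suc n))" if "i < Suc n" for i
    using has_integral_bound [of c "\<phi> (\<xi> i \<omega>)" "J i" "grid a b n i" "grid a b n (Suc i)"] J [OF that] bound [OF that]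
      \<open>0 \<le> c\<close> grid_mono [OF \<open>a \<le> b\<close>, of n i] by (simp add: grid_step)
  show thesis
  proof (rule that)
    show "((\<lambda>u. \<phi> (simple_value (Suc n) (grid a b n) \<xi> u \<omega>) u) has_integral (\<Sum>i<Suc n. J i)) {a..b}"
      using has_integral_simple_value [of "Suc n" "grid a b n" \<phi> \<xi> \<omega> J] J grid_mono [OF \<open>a \<le> b\<close>] by simp
    have "\<bar>\<Sum>i<Suc n. J i\<bar> \<le> (\<Sum>i<Suc n. c * ((b - a) / real (Suc n)))"
      by (rule order_trans [OF sum_abs sum_mono]) (use bJ in auto)
    then show "\<bar>\<Sum>i<Suc n. J i\<bar> \<le> c * (b - a)"
      by (simp del: of_nat_Suc sum.lessThan_Suc)
  qed
qed

lemma sampled_L2_tendsto: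
  assumes "a \<le> b" and cont: "continuous_on {a..b} (\<lambda>u. g u \<omega>)"
  shows "(\<lambda>n. integral {a..b} (\<lambda>u. (simple_value (Suc n) (grid a b n) (sampled a b g n) u \<omega> - g u \<omega>)\<^sup>2)) \<longlonglongrightarrow> 0"
proof (rule LIMSEQ_I)
  fix r :: real assume "0 < r"
  \<comment> \<open>The summand 1 keeps the denominator positive for \<open>a = b\<close>, and the
    factor 2 makes the final inequality strict.\<close>
  define e where "e = sqrt (r / (2 * (b - a + 1)))"
  have e: "0 < e" "e\<^sup>2 * (b - a) < r"
  proof -
    show "0 < e" using \<open>0 < r\<close> \<open>a \<le> b\<close> by (simp add: e_def)
    have "e\<^sup>2 = r / (2 * (b - a + 1))"
      using \<open>0 < r\<close> \<open>a \<le> b\<close> by (simp add: e_def)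
    moreover have "r * (b - a) < r * (2 * (b - a + 1))"
      using \<open>0 < r\<close> \<open>a \<le> b\<close> by (intro mult_strict_left_mono) auto
    ultimately show "e\<^sup>2 * (b - a) < r"
      using \<open>a \<le> b\<close> by (simp add: divide_less_eq)
  qed
  obtain N where N: "\<And>n i u. N \<le> n \<Longrightarrow> i < Suc n \<Longrightarrow> u \<in> {grid a b n i..grid a b n (Suc i)} \<Longrightarrow>
      \<bar>sampled a b g n i \<omega> - g u \<omega>\<bar> \<le> e"
    using sampled_approx [of a b g \<omega>, OF \<open>a \<le> b\<close> cont e(1)] by blast
  have "\<bar>integral {a..b} (\<lambda>u. (simple_value (Suc n) (grid a b n) (sampled a b g n) u \<omega> - g u \<omega>)\<^sup>2)\<bar> < r" if n: "N \<le> n" for n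
  proof -
    obtain J where J: "((\<lambda>u. (simple_value (Suc n) (grid a b n) (sampled a b g n) u \<omega> - g u \<omega>)\<^sup>2) has_integral J) {a..b}"
      "\<bar>J\<bar> \<le> e\<^sup>2 * (b - a)"
    proof (rule grid_integral_bound [of a b "\<lambda>x u. (x - g u \<omega>)\<^sup>2" "e\<^sup>2" n "sampled a b g n" \<omega>])
      fix i u assume "i < Suc n" "u \<in> {grid a b n i..grid a b n (Suc i)}"
      from N [OF n this] show "\<bar>(sampled a b g n i \<omega> - g u \<omega>)\<^sup>2\<bar> \<le> e\<^sup>2"
        using e(1) by (simp add: abs_le_square_iff [symmetric])
    qed (use \<open>a \<le> b\<close> in \<open>auto intro!: continuous_intros cont\<close>)
    then show ?thesis using e(2) by (simp add: integral_unique)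
  qed
  then show "\<exists>N. \<forall>n\<ge>N. norm (integral {a..b} (\<lambda>u. (simple_value (Suc n) (grid a b n) (sampled a b g n) u \<omega> - g u \<omega>)\<^sup>2) - 0) < r"
    by auto
qed

lemma sampled_energy_tendsto:
  assumes "a \<le> b" and cont: "continuous_on {a..b} (\<lambda>u. g u \<omega>)"
  shows "(\<lambda>n. simple_energy (Suc n) (grid a b n) (sampled a b g n) \<omega>) \<longlonglongrightarrow> integral {a..b} (\<lambda>u. (g u \<omega>)\<^sup>2)"
proof (rule LIMSEQ_I)
  fix r :: real assume "0 < r"
  obtain K where "0 < K" and K: "\<And>u. u \<in> {a..b} \<Longrightarrow> \<bar>g u \<omega>\<bar> \<le> K"
    using compact_imp_bounded [OF compact_continuous_image [OF cont compact_Icc]]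
    unfolding bounded_pos by auto
  \<comment> \<open>A difference of squares is at most \<open>e * (2 * K)\<close>, where
    \<open>2 * K\<close> bounds the sum of the two values; integrating over \<open>{a..b}\<close>
    still leaves less than \<open>r\<close>.\<close>
  define e where "e = r / (4 * K * (b - a + 1))"
  have e: "0 < e" "e * (2 * K) * (b - a) < r"
  proof -
    show "0 < e" using \<open>0 < r\<close> \<open>a \<le> b\<close> \<open>0 < K\<close> by (simp add: e_def)
    have "e * (2 * K) * (b - a) = r * ((b - a) / (2 * (b - a + 1)))"
    proof -
      have "r / (4 * K * y) * (2 * K) * z = r * (z / (2 * y))" if "0 < y" for y z
        using \<open>0 < K\<close> that by (simp add: field_simps)
      then show ?thesis using \<open>a \<le> b\<close> by (simp add: e_def)
    qed
    also have "\<dots> < r * 1"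
      using \<open>0 < r\<close> \<open>a \<le> b\<close> by (intro mult_strict_left_mono) (auto simp: divide_less_eq)
    finally show "e * (2 * K) * (b - a) < r" by simp
  qed
  obtain N where N: "\<And>n i u. N \<le> n \<Longrightarrow> i < Suc n \<Longrightarrow> u \<in> {grid a b n i..grid a b n (Suc i)} \<Longrightarrow>
      \<bar>sampled a b g n i \<omega> - g u \<omega>\<bar> \<le> e"
    using sampled_approx [of a b g \<omega>, OF \<open>a \<le> b\<close> cont e(1)] by blast
  have gint: "(\<lambda>u. (g u \<omega>)\<^sup>2) integrable_on {a..b}"
    by (intro integrable_continuous_interval continuous_intros cont)
  have "\<bar>simple_energy (Suc n) (grid a b n) (sampled a b g n) \<omega> - integral {a..b} (\<lambda>u. (g u \<omega>)\<^sup>2)\<bar> < r" if n: "N \<le> n" for n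
  proof -
    obtain J where J: "((\<lambda>u. (simple_value (Suc n) (grid a b n) (sampled a b g n) u \<omega>)\<^sup>2 - (g u \<omega>)\<^sup>2) has_integral J) {a..b}"
      "\<bar>J\<bar> \<le> e * (2 * K) * (b - a)"
    proof (rule grid_integral_bound [of a b "\<lambda>x u. x\<^sup>2 - (g u \<omega>)\<^sup>2" "e * (2 * K)" n "sampled a b g n" \<omega>])
      fix i u assume iu: "i < Suc n" "u \<in> {grid a b n i..grid a b n (Suc i)}"
      have gi: "grid a b n i \<in> {a..b}" "u \<in> {a..b}"
        using grid_mem [OF \<open>a \<le> b\<close>, of i n] grid_mem [OF \<open>a \<le> b\<close>, of "Suc i" n] iu by auto
      \<comment> \<open>Clipping does not increase absolute values, so the bound of the path passes
        to its samples.\<close>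
      have "\<bar>sampled a b g n i \<omega>\<bar> \<le> K"
        using clip_bound(2) K [OF gi(1)] unfolding sampled_def by (rule order_trans)
      then have "\<bar>sampled a b g n i \<omega> + g u \<omega>\<bar> \<le> 2 * K"
        using K [OF gi(2)] by linarith
      then have "\<bar>sampled a b g n i \<omega> - g u \<omega>\<bar> * \<bar>sampled a b g n i \<omega> + g u \<omega>\<bar> \<le> e * (2 * K)"
        using N [OF n iu] e(1) by (intro mult_mono) auto
      then show "\<bar>(sampled a b g n i \<omega>)\<^sup>2 - (g u \<omega>)\<^sup>2\<bar> \<le> e * (2 * K)"
        by (simp add: abs_mult [symmetric] power2_eq_square algebra_simps)
    qed (use \<open>a \<le> b\<close> e \<open>0 < K\<close> in \<open>auto intro!: continuous_intros cont\<close>)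
    have "((\<lambda>u. (simple_value (Suc n) (grid a b n) (sampled a b g n) u \<omega>)\<^sup>2 - (g u \<omega>)\<^sup>2) has_integral
        simple_energy (Suc n) (grid a b n) (sampled a b g n) \<omega> - integral {a..b} (\<lambda>u. (g u \<omega>)\<^sup>2)) {a..b}"
      using has_integral_simple_value_sq [of "Suc n" "grid a b n" "sampled a b g n" \<omega>] grid_mono [OF \<open>a \<le> b\<close>]
      by (intro has_integral_diff integrable_integral gint) simp
    from has_integral_unique [OF this J(1)] J(2) e(2) show ?thesis by simp
  qed
  then show "\<exists>N. \<forall>n\<ge>N. norm (simple_energy (Suc n) (grid a b n) (sampled a b g n) \<omega> - integral {a..b} (\<lambda>u. (g u \<omega>)\<^sup>2)) < r"
    by auto
qed

lemma norm_iexp_diff_le: "norm (iexp x - iexp y) \<le> \<bar>x - y\<bar>"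
proof -
  have "iexp x - iexp y = iexp y * (iexp (x - y) - 1)"
    by (simp add: right_diff_distrib exp_add [symmetric] algebra_simps)
  then have "norm (iexp x - iexp y) = norm (iexp (x - y) - 1)"
    by (simp add: norm_mult)
  also have "\<dots> \<le> \<bar>x - y\<bar>"
    using iexp_approx1 [of "x - y" 0] by simp
  finally show ?thesis .
qed

section \<open>Characteristic functions of integrals whose integrands are known at the start\<close>

context prob_space
begin

text \<open>The approximants that come with \<open>J\<close> are arbitrary adapted ones. Replacing
  them by grid samples of \<open>g\<close> yields coefficients known at time \<open>a\<close>, for
  which the characteristic function is explicit. The version \<open>g\<close> is introduced because
  the integrand \<open>H\<close> agrees with quantities known at \<open>a\<close> only almost
  surely.\<close>

lemma sampled_ito_tendsto:
  assumes B: "brownian_on M F B T" and ab: "{a..b} \<subseteq> T" "a \<le> b"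
    and J: "has_ito_integral M F B a b H J"
    and g: "\<And>u. u \<in> {a..b} \<Longrightarrow> g u \<in> borel_measurable (F a)"
    and cont: "\<And>\<omega>. \<omega> \<in> space M \<Longrightarrow> continuous_on {a..b} (\<lambda>u. g u \<omega>)"
    and eq: "AE \<omega> in M. \<forall>u\<in>{a..b}. H u \<omega> = g u \<omega>"
  shows "tendsto_in_prob M (\<lambda>n. simple_ito B (Suc n) (grid a b n) (sampled a b g n)) J"
proof -
  from J obtain k p \<xi> where \<xi>: "\<And>n. simple_integrand M F a b (k n) (p n) (\<xi> n)"
    "tendsto_in_prob M (\<lambda>n \<omega>. integral {a..b} (\<lambda>u. (simple_value (k n) (p n) (\<xi> n) u \<omega> - H u \<omega>)\<^sup>2)) (\<lambda>_. 0)"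
    "tendsto_in_prob M (\<lambda>n. simple_ito B (k n) (p n) (\<xi> n)) J"
    unfolding has_ito_integral_def by blast
  have H: "AE \<omega> in M. (\<lambda>u. H u \<omega>) integrable_on {a..b} \<and> (\<lambda>u. (H u \<omega>)\<^sup>2) integrable_on {a..b}"
    using J unfolding has_ito_integral_def by blast
  let ?T = "\<lambda>n \<omega>. integral {a..b} (\<lambda>u. (simple_value (Suc n) (grid a b n) (sampled a b g n) u \<omega> - H u \<omega>)\<^sup>2)"
  have R: "tendsto_in_prob M (\<lambda>n \<omega>. 2 * integral {a..b} (\<lambda>u. (simple_value (k n) (p n) (\<xi> n) u \<omega> - H u \<omega>)\<^sup>2)) (\<lambda>_. 0)"
    using tendsto_in_prob_cmult [OF \<xi>(2), of 2] by simp
  have T: "AE \<omega> in M. (\<lambda>n. 2 * ?T n \<omega>) \<longlonglongrightarrow> 0"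
    using eq AE_space
  proof eventually_elim
    case (elim \<omega>)
    have "?T n \<omega> = integral {a..b} (\<lambda>u. (simple_value (Suc n) (grid a b n) (sampled a b g n) u \<omega> - g u \<omega>)\<^sup>2)" for n
      using elim(1) by (intro integral_cong) simp
    then show ?case
      using tendsto_mult_right_zero [OF sampled_L2_tendsto [of a b g \<omega>, OF ab(2) cont [OF elim(2)]], of 2] by simp
  qed
  have "tendsto_in_prob M (\<lambda>n \<omega>. simple_ito B (k n) (p n) (\<xi> n) \<omega> - simple_ito B (Suc n) (grid a b n) (sampled a b g n) \<omega>) (\<lambda>_. 0)"
    by (rule simple_ito_diff_tendsto_0 [OF B ab(1) H \<xi>(1) simple_integrand_sampled [OF B ab(2) g] R T]) auto
  from tendsto_in_prob_diff [OF \<xi>(3) this] show ?thesis by simp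
qed

lemma tendsto_in_prob_iexp:
  assumes X: "tendsto_in_prob M X L" and A [measurable]: "A \<in> sets M"
  shows "(\<lambda>n. \<integral>\<omega>. indicator A \<omega> * iexp (X n \<omega>) \<partial>M) \<longlonglongrightarrow> (\<integral>\<omega>. indicator A \<omega> * iexp (L \<omega>) \<partial>M)"
proof (rule LIMSEQ_I)
  note [measurable] = tendsto_in_probD(1,2) [OF X]
  fix r :: real assume "0 < r"
  have int: "complex_integrable M (\<lambda>\<omega>. indicator A \<omega> * iexp (f \<omega>))" if [measurable]: "f \<in> borel_measurable M" for f :: "'a \<Rightarrow> real"
    by (rule integrable_const_bound [where B = 1]) (auto simp: norm_mult indicator_def)
  \<comment> \<open>Off the exceptional event the integrand differs by at most \<open>r / 2\<close>;
    on it the difference is at most 2, and the event has probability below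
    \<open>r / 4\<close>.\<close>
  obtain N where N: "\<And>n. N \<le> n \<Longrightarrow> prob {\<omega> \<in> space M. \<bar>X n \<omega> - L \<omega>\<bar> > r / 2} < r / 4"
    using LIMSEQ_D [OF tendsto_in_probD(3) [OF X, of "r / 2"], of "r / 4"] \<open>0 < r\<close> by auto
  have "norm ((\<integral>\<omega>. indicator A \<omega> * iexp (X n \<omega>) \<partial>M) - (\<integral>\<omega>. indicator A \<omega> * iexp (L \<omega>) \<partial>M)) < r" if "N \<le> n" for n
  proof -
    let ?E = "{\<omega> \<in> space M. \<bar>X n \<omega> - L \<omega>\<bar> > r / 2}"
    have "norm ((\<integral>\<omega>. indicator A \<omega> * iexp (X n \<omega>) \<partial>M) - (\<integral>\<omega>. indicator A \<omega> * iexp (L \<omega>) \<partial>M))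
      = norm (\<integral>\<omega>. indicator A \<omega> * iexp (X n \<omega>) - indicator A \<omega> * iexp (L \<omega>) \<partial>M)"
      by (subst Bochner_Integration.integral_diff) (auto intro: int)
    also have "\<dots> \<le> (\<integral>\<omega>. norm (indicator A \<omega> * iexp (X n \<omega>) - indicator A \<omega> * iexp (L \<omega>)) \<partial>M)"
      by (rule integral_norm_bound)
    also have "\<dots> \<le> (\<integral>\<omega>. r / 2 + 2 * indicator ?E \<omega> \<partial>M)"
    proof (rule integral_mono)
      show "integrable M (\<lambda>\<omega>. norm (indicator A \<omega> * iexp (X n \<omega>) - indicator A \<omega> * iexp (L \<omega>)))"
        by (intro integrable_norm Bochner_Integration.integrable_diff int) auto
      show "integrable M (\<lambda>\<omega>. r / 2 + 2 * indicat_real ?E \<omega>)"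
        by (intro Bochner_Integration.integrable_add integrable_mult_right) (auto simp: emeasure_eq_measure)
      fix \<omega> assume "\<omega> \<in> space M"
      have le: "norm (indicator A \<omega> * iexp (X n \<omega>) - indicator A \<omega> * iexp (L \<omega>)) \<le> norm (iexp (X n \<omega>) - iexp (L \<omega>))"
        by (auto simp: indicator_def)
      show "norm (indicator A \<omega> * iexp (X n \<omega>) - indicator A \<omega> * iexp (L \<omega>)) \<le> r / 2 + 2 * indicator ?E \<omega>"
      proof (cases "\<omega> \<in> ?E")
        case True
        have "norm (iexp (X n \<omega>) - iexp (L \<omega>)) \<le> 2"
          using norm_triangle_ineq4 [of "iexp (X n \<omega>)" "iexp (L \<omega>)"] by simp
        then show ?thesis using le True \<open>0 < r\<close> by simp
      next
        case False
        then show ?thesis using le norm_iexp_diff_le [of "X n \<omega>" "L \<omega>"] \<open>\<omega> \<in> space M\<close> by simp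
      qed
    qed
    also have "\<dots> = r / 2 + 2 * prob ?E"
      by (subst Bochner_Integration.integral_add) (auto simp: emeasure_eq_measure prob_space)
    also have "\<dots> < r"
      using N [OF that] by simp
    finally show ?thesis .
  qed
  then show "\<exists>N. \<forall>n\<ge>N. norm ((\<integral>\<omega>. indicator A \<omega> * iexp (X n \<omega>) \<partial>M) - (\<integral>\<omega>. indicator A \<omega> * iexp (L \<omega>) \<partial>M)) < r"
    by blast
qed

text \<open>Continuity of the integrand is assumed on each side of \<open>m\<close> only, so a jump
  at \<open>m\<close> is allowed. For the simple approximants the later interval is integrated out
  first, then the earlier one; the two energies add up in the limit to \<open>Q\<close>.\<close>

lemma ito_sum_char:
  assumes B: "brownian_on M F B {a..b}" and am: "a \<le> m" "m \<le> b"
    and J1: "has_ito_integral M F B a m H1 J1" and J2: "has_ito_integral M F B m b H2 J2"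
    and g1: "\<And>u. u \<in> {a..m} \<Longrightarrow> g1 u \<in> borel_measurable (F a)" and g2: "\<And>u. u \<in> {m..b} \<Longrightarrow> g2 u \<in> borel_measurable (F a)"
    and c1: "\<And>\<omega>. \<omega> \<in> space M \<Longrightarrow> continuous_on {a..m} (\<lambda>u. g1 u \<omega>)"
    and c2: "\<And>\<omega>. \<omega> \<in> space M \<Longrightarrow> continuous_on {m..b} (\<lambda>u. g2 u \<omega>)"
    and eq1: "AE \<omega> in M. \<forall>u\<in>{a..m}. H1 u \<omega> = g1 u \<omega>" and eq2: "AE \<omega> in M. \<forall>u\<in>{m..b}. H2 u \<omega> = g2 u \<omega>"
    and Q [measurable]: "Q \<in> borel_measurable M"
    and eqQ: "AE \<omega> in M. integral {a..m} (\<lambda>u. (g1 u \<omega>)\<^sup>2) + integral {m..b} (\<lambda>u. (g2 u \<omega>)\<^sup>2) = Q \<omega>"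
    and A: "A \<in> sets (F a)"
  shows "(\<integral>\<omega>. indicator A \<omega> * iexp (c * (J1 \<omega> + J2 \<omega>)) \<partial>M)
    = (\<integral>\<omega>. indicator A \<omega> * exp (- (c\<^sup>2 * Q \<omega> / 2)) \<partial>M)"
proof -
  let ?S1 = "\<lambda>n. simple_ito B (Suc n) (grid a m n) (sampled a m g1 n)"
  let ?S2 = "\<lambda>n. simple_ito B (Suc n) (grid m b n) (sampled m b g2 n)"
  let ?E1 = "\<lambda>n. simple_energy (Suc n) (grid a m n) (sampled a m g1 n)"
  let ?E2 = "\<lambda>n. simple_energy (Suc n) (grid m b n) (sampled m b g2 n)"
  have g2': "g2 u \<in> borel_measurable (F m)" if "u \<in> {m..b}" for u
    using brownian_on_measurable_mono [OF B am(1) g2 [OF that]] .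
  note si1 = simple_integrand_sampled [OF B am(1) g1] and si2 = simple_integrand_sampled [OF B am(2) g2']
  have AM [measurable]: "A \<in> sets M"
    using A brownian_on_subalgebra [OF B, of a] by (auto simp: subalgebra_def)
  have "tendsto_in_prob M ?S1 J1"
    by (rule sampled_ito_tendsto [OF B _ am(1) J1 g1 c1 eq1]) (use am in auto)
  moreover have "tendsto_in_prob M ?S2 J2"
    by (rule sampled_ito_tendsto [OF B _ am(2) J2 g2' c2 eq2]) (use am in auto)
  ultimately have "tendsto_in_prob M (\<lambda>n \<omega>. c * (?S1 n \<omega> + ?S2 n \<omega>)) (\<lambda>\<omega>. c * (J1 \<omega> + J2 \<omega>))"
    by (intro tendsto_in_prob_cmult tendsto_in_prob_add)
  from tendsto_in_prob_iexp [OF this AM]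
  have lim1: "(\<lambda>n. \<integral>\<omega>. indicator A \<omega> * iexp (c * (?S1 n \<omega> + ?S2 n \<omega>)) \<partial>M) \<longlonglongrightarrow>
    (\<integral>\<omega>. indicator A \<omega> * iexp (c * (J1 \<omega> + J2 \<omega>)) \<partial>M)" .
  have EM [measurable]: "?E1 n \<in> borel_measurable M" "?E2 n \<in> borel_measurable M" for n
    using simple_energy_measurable [OF B si1] simple_energy_measurable [OF B si2] by auto
  have E0: "0 \<le> ?E1 n \<omega>" "0 \<le> ?E2 n \<omega>" for n \<omega>
    using grid_mono [OF am(1)] grid_mono [OF am(2)] by (auto intro!: simple_energy_nonneg)
  have lim2: "(\<lambda>n. \<integral>\<omega>. indicator A \<omega> * exp (- (c\<^sup>2 * (?E1 n \<omega> + ?E2 n \<omega>) / 2)) \<partial>M) \<longlonglongrightarrow>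
    (\<integral>\<omega>. indicator A \<omega> * exp (- (c\<^sup>2 * Q \<omega> / 2)) \<partial>M)"
    (is "(\<lambda>n. integral\<^sup>L M (?f n)) \<longlonglongrightarrow> integral\<^sup>L M ?F")
  proof -
    have lim: "AE \<omega> in M. (\<lambda>n. ?f n \<omega>) \<longlonglongrightarrow> ?F \<omega>"
      using eqQ AE_space
    proof eventually_elim
      case (elim \<omega>)
      show ?case
        unfolding elim(1) [symmetric]
        by (intro tendsto_intros sampled_energy_tendsto am c1 c2 elim(2)) simp
    qed
    have [measurable]: "?f n \<in> borel_measurable M" for n by measurable
    have [measurable]: "?F \<in> borel_measurable M" by measurable
    show ?thesis
    proof (rule integral_dominated_convergence [where w = "\<lambda>_. 1"])
      show "AE \<omega> in M. norm (?f n \<omega>) \<le> 1" for n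
        using E0 by (intro AE_I2) (auto simp: indicator_def)
    qed (use lim in auto)
  qed
  have "(\<integral>\<omega>. indicator A \<omega> * iexp (c * (?S1 n \<omega> + ?S2 n \<omega>)) \<partial>M)
    = (\<integral>\<omega>. indicator A \<omega> * exp (- (c\<^sup>2 * (?E1 n \<omega> + ?E2 n \<omega>) / 2)) \<partial>M)" for n
  proof -
    let ?\<xi>1 = "\<lambda>i \<omega>. c * sampled a m g1 n i \<omega>" and ?\<xi>2 = "\<lambda>i \<omega>. c * sampled m b g2 n i \<omega>"
    let ?T1 = "simple_ito B (Suc n) (grid a m n) ?\<xi>1" and ?T2 = "simple_ito B (Suc n) (grid m b n) ?\<xi>2"
    let ?D1 = "simple_energy (Suc n) (grid a m n) ?\<xi>1" and ?D2 = "simple_energy (Suc n) (grid m b n) ?\<xi>2"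
    have T: "?T1 \<omega> = c * ?S1 n \<omega>" "?T2 \<omega> = c * ?S2 n \<omega>" for \<omega>
      by (simp_all only: simple_ito_def sum_distrib_left mult.assoc)
    have D: "?D1 \<omega> = c\<^sup>2 * ?E1 n \<omega>" "?D2 \<omega> = c\<^sup>2 * ?E2 n \<omega>" for \<omega>
      by (simp_all only: simple_energy_def sum_distrib_left mult.assoc power_mult_distrib)
    have \<xi>1: "?\<xi>1 i \<in> borel_measurable (F a)" if "i < Suc n" for i
    proof -
      have [measurable]: "g1 (grid a m n i) \<in> borel_measurable (F a)"
        using g1 [of "grid a m n i"] grid_mem [OF am(1), of i n] that by simp
      show ?thesis unfolding sampled_def clip_def by measurable
    qed
    have \<xi>2: "?\<xi>2 i \<in> borel_measurable (F a)" if "i < Suc n" for i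
    proof -
      have [measurable]: "g2 (grid m b n i) \<in> borel_measurable (F a)"
        using g2 [of "grid m b n i"] grid_mem [OF am(2), of i n] that by simp
      show ?thesis unfolding sampled_def clip_def by measurable
    qed
    have T1F: "?T1 \<in> borel_measurable (F m)"
    proof -
      have "?T1 \<in> borel_measurable (F (grid a m n (Suc n)))"
      proof (rule simple_ito_measurable [OF B])
        show "?\<xi>1 i \<in> borel_measurable (F (grid a m n i))" if "i < Suc n" for i
          by (rule brownian_on_measurable_mono [OF B _ \<xi>1 [OF that]]) (use grid_mem [OF am(1), of i n] that in auto)
        show "grid a m n i \<in> {a..b}" if "i \<le> Suc n" for i
          using grid_mem [OF am(1) that] am by auto
      qed (use grid_mono am in auto)
      then show ?thesis by simp
    qed
    have AF [measurable]: "A \<in> sets (F m)"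
      using A B am(1) unfolding brownian_on_def filtration_def by blast
    note [measurable] = T1F A
    have T1M [measurable]: "?T1 \<in> borel_measurable M"
      using brownian_on_measurable [OF B T1F] .
    have D2F [measurable]: "?D2 \<in> borel_measurable (F a)"
      unfolding simple_energy_def [abs_def]
      by (intro borel_measurable_sum borel_measurable_times borel_measurable_power \<xi>2) auto
    have D2M [measurable]: "?D2 \<in> borel_measurable M"
      using brownian_on_measurable [OF B D2F] .
    have D20: "0 \<le> ?D2 \<omega>" for \<omega>
      unfolding D using E0 by simp
    have "(\<integral>\<omega>. indicator A \<omega> * iexp (c * (?S1 n \<omega> + ?S2 n \<omega>)) \<partial>M)
      = (\<integral>\<omega>. (indicator A \<omega> * iexp (?T1 \<omega>)) * iexp (?T2 \<omega>) \<partial>M)"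
      unfolding T by (simp add: distrib_left exp_add mult.assoc)
    also have "\<dots> = (\<integral>\<omega>. (indicator A \<omega> * iexp (?T1 \<omega>)) * exp (- ?D2 \<omega> / 2) \<partial>M)"
    proof (rule simple_ito_char [OF B])
      show "?\<xi>2 i \<in> borel_measurable (F (grid m b n 0))" if "i < Suc n" for i
        using brownian_on_measurable_mono [OF B am(1) \<xi>2 [OF that]] by simp
      show "grid m b n i \<in> {a..b}" if "i \<le> Suc n" for i
        using grid_mem [OF am(2) that] am by auto
      show "(\<lambda>\<omega>. indicator A \<omega> * iexp (?T1 \<omega>)) \<in> borel_measurable (F (grid m b n 0))"
        unfolding grid_0 by measurable
      show "complex_integrable M (\<lambda>\<omega>. indicator A \<omega> * iexp (?T1 \<omega>))"
        by (rule integrable_const_bound [where B = 1]) (auto simp: norm_mult indicator_def)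
    qed (use grid_mono am in auto)
    \<comment> \<open>The Gaussian factor of the later interval is \<open>F a\<close>-measurable
      because \<open>g2\<close> is known at \<open>a\<close>; it now joins the weight while the
      earlier interval is integrated out.\<close>
    also have "\<dots> = (\<integral>\<omega>. (indicator A \<omega> * complex_of_real (exp (- ?D2 \<omega> / 2))) * iexp (?T1 \<omega>) \<partial>M)"
      by (simp only: mult_ac)
    also have "\<dots> = (\<integral>\<omega>. (indicator A \<omega> * complex_of_real (exp (- ?D2 \<omega> / 2))) * exp (- ?D1 \<omega> / 2) \<partial>M)"
    proof (rule simple_ito_char [OF B])
      show "?\<xi>1 i \<in> borel_measurable (F (grid a m n 0))" if "i < Suc n" for i
        using \<xi>1 [OF that] by simp
      show "grid a m n i \<in> {a..b}" if "i \<le> Suc n" for i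
        using grid_mem [OF am(1) that] am by auto
      show "(\<lambda>\<omega>. indicator A \<omega> * complex_of_real (exp (- ?D2 \<omega> / 2))) \<in> borel_measurable (F (grid a m n 0))"
        unfolding grid_0 by measurable
      show "complex_integrable M (\<lambda>\<omega>. indicator A \<omega> * complex_of_real (exp (- ?D2 \<omega> / 2)))"
        using D20 by (intro integrable_const_bound [where B = 1]) (auto simp: norm_mult indicator_def)
    qed (use grid_mono am in auto)
    also have "\<dots> = (\<integral>\<omega>. complex_of_real (indicator A \<omega> * exp (- (c\<^sup>2 * (?E1 n \<omega> + ?E2 n \<omega>) / 2))) \<partial>M)"
    proof (rule Bochner_Integration.integral_cong [OF refl])
      fix \<omega>
      have "exp (- (c\<^sup>2 * (?E1 n \<omega> + ?E2 n \<omega>) / 2)) = exp (- ?D2 \<omega> / 2) * exp (- ?D1 \<omega> / 2)"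
        unfolding D exp_add [symmetric] by (simp add: algebra_simps add_divide_distrib)
      then show "indicator A \<omega> * complex_of_real (exp (- ?D2 \<omega> / 2)) * complex_of_real (exp (- ?D1 \<omega> / 2)) =
        complex_of_real (indicator A \<omega> * exp (- (c\<^sup>2 * (?E1 n \<omega> + ?E2 n \<omega>) / 2)))"
        by (simp only: of_real_mult of_real_indicator mult.assoc)
    qed
    finally show ?thesis by (simp only: integral_complex_of_real)
  qed
  with lim1 have "(\<lambda>n. complex_of_real (\<integral>\<omega>. indicator A \<omega> * exp (- (c\<^sup>2 * (?E1 n \<omega> + ?E2 n \<omega>) / 2)) \<partial>M)) \<longlonglongrightarrow>
    (\<integral>\<omega>. indicator A \<omega> * iexp (c * (J1 \<omega> + J2 \<omega>)) \<partial>M)"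
    by simp
  from LIMSEQ_unique [OF this tendsto_of_real [OF lim2]] show ?thesis .
qed

end

subsection \<open>Conditional normality\<close>

text \<open>Written as an integral over a fixed law, the probability is measurable in the variance
  \<open>x\<close> and can be combined with another integration by Fubini.\<close>

lemma measure_normal_law:
  assumes [measurable]: "C \<in> sets borel"
  shows "measure (normal_law 0 x) C = (\<integral>z. indicator C (sqrt x * z) \<partial>std_normal_distribution)"
proof -
  have [measurable]: "(\<lambda>z. sqrt x * z) -` C \<in> sets borel"
    using measurable_sets [of "\<lambda>z. sqrt x * z" borel borel C] by simp
  have "measure (normal_law 0 x) C = measure std_normal_distribution ((\<lambda>z. sqrt x * z) -` C)"
    unfolding normal_law_def by (subst measure_distr) auto
  also have "\<dots> = (\<integral>z. indicator ((\<lambda>z. sqrt x * z) -` C) z \<partial>std_normal_distribution)"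
    by simp
  also have "\<dots> = (\<integral>z. indicator C (sqrt x * z) \<partial>std_normal_distribution)"
    by (rule Bochner_Integration.integral_cong) (auto simp: indicator_def)
  finally show ?thesis .
qed

lemma measurable_normal_law [measurable]:
  assumes [measurable]: "C \<in> sets borel"
  shows "(\<lambda>x. measure (normal_law 0 x) C) \<in> borel_measurable borel"
proof -
  interpret std: real_distribution std_normal_distribution
    by (rule real_dist_normal_dist)
  show ?thesis
    unfolding measure_normal_law [OF assms] by measurable
qed

lemma normal_law_le_1: "\<bar>measure (normal_law 0 x) C\<bar> \<le> 1"
proof -
  interpret std: real_distribution std_normal_distribution
    by (rule real_dist_normal_dist)
  interpret prob_space "normal_law 0 x"
    unfolding normal_law_def by (rule std.prob_space_distr) simp
  show ?thesis by simp
qed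

context prob_space
begin

text \<open>Expresses expectations conditioned on one event through the original measure, the form
  in which the characteristic functions are given.\<close>

lemma integral_uniform_measure:
  fixes f :: "'a \<Rightarrow> 'b::{banach, second_countable_topology}"
  assumes [measurable]: "A \<in> events" "f \<in> borel_measurable M" and "0 < prob A"
  shows "integral\<^sup>L (uniform_measure M A) f = (\<integral>\<omega>. indicator A \<omega> *\<^sub>R f \<omega> \<partial>M) /\<^sub>R prob A"
proof -
  have "uniform_measure M A = density M (\<lambda>\<omega>. ennreal (indicator A \<omega> / prob A))"
    unfolding uniform_measure_def emeasure_eq_measure
    using \<open>0 < prob A\<close> by (intro density_cong) (auto simp: indicator_def divide_ennreal simp flip: ennreal_1)
  then have "integral\<^sup>L (uniform_measure M A) f = (\<integral>\<omega>. (indicator A \<omega> / prob A) *\<^sub>R f \<omega> \<partial>M)"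
    by (simp add: integral_density)
  also have "\<dots> = (\<integral>\<omega>. inverse (prob A) *\<^sub>R (indicator A \<omega> *\<^sub>R f \<omega>) \<partial>M)"
    by (simp add: divide_inverse mult.commute)
  finally show ?thesis by (simp only: integral_scaleR_right)
qed

text \<open>
  Conditionally on \<open>A\<close>, \<open>Z\<close> and \<open>sqrt s * z\<close> with \<open>z\<close> an independent standard normal variable have the
  same characteristic function, hence the same law.
\<close>

lemma conditionally_normal_char:
  assumes sub: "subalgebra M N" and Z [measurable]: "Z \<in> borel_measurable M"
    and s [measurable]: "s \<in> borel_measurable N" and s0: "AE \<omega> in M. 0 \<le> s \<omega>"
    and char: "\<And>A c. A \<in> sets N \<Longrightarrow> (\<integral>\<omega>. indicator A \<omega> * iexp (c * Z \<omega>) \<partial>M)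
      = complex_of_real (\<integral>\<omega>. indicator A \<omega> * exp (- (c\<^sup>2 * s \<omega> / 2)) \<partial>M)"
  shows "conditionally_normal M N Z (\<lambda>_. 0) s"
  unfolding conditionally_normal_def
proof (intro conjI ballI sub Z s0)
  fix C :: "real set" assume C [measurable]: "C \<in> sets borel"
  interpret fs: finite_measure_subalgebra M N
    by unfold_locales (rule sub)
  have sM [measurable]: "s \<in> borel_measurable M"
    using measurable_from_subalg [OF sub s] .
  show "AE \<omega> in M. real_cond_exp M N (indicator (Z -` C \<inter> space M)) \<omega> = measure (normal_law 0 (s \<omega>)) C"
  proof (rule fs.real_cond_exp_charact)
    show "integrable M (indicat_real (Z -` C \<inter> space M))"
      by (simp add: emeasure_eq_measure)
    show "integrable M (\<lambda>\<omega>. measure (normal_law 0 (s \<omega>)) C)"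
      by (rule integrable_const_bound [where B = 1]) (auto simp: normal_law_le_1 [simplified])
    show "(\<lambda>\<omega>. measure (normal_law 0 (s \<omega>)) C) \<in> borel_measurable N"
      by measurable
    fix A assume A: "A \<in> sets N"
    then have AM [measurable]: "A \<in> events"
      using sub by (auto simp: subalgebra_def)
    show "(LINT \<omega>:A|M. indicator (Z -` C \<inter> space M) \<omega>) = (LINT \<omega>:A|M. measure (normal_law 0 (s \<omega>)) C)"
    proof (cases "prob A = 0")
      case True
      then have "AE \<omega> in M. \<omega> \<notin> A"
        by (intro AE_not_in) (auto simp: null_sets_def emeasure_eq_measure)
      then have "(LINT \<omega>:A|M. f \<omega>) = 0" if [measurable]: "f \<in> borel_measurable M" for f :: "'a \<Rightarrow> real"
        unfolding set_lebesgue_integral_def by (intro integral_eq_zero_AE) (auto elim!: AE_mp)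
      then show ?thesis by simp
    next
      case False
      then have pA: "0 < prob A" by (simp add: zero_less_measure_iff)
      define Q where "Q = uniform_measure M A"
      have setsQ [measurable_cong]: "sets Q = sets M" by (simp add: Q_def)
      note intQ = integral_uniform_measure [OF AM _ pA, folded Q_def]
      have probQ: "prob_space Q"
        unfolding Q_def using pA by (intro prob_space_uniform_measure) (auto simp: emeasure_eq_measure)
      define std where "std = std_normal_distribution"
      have char_std: "(\<integral>z. iexp (c * z) \<partial>std) = complex_of_real (exp (- c\<^sup>2 / 2))" for c
        using fun_cong [OF char_std_normal_distribution, of c] unfolding char_def std_def .
      have std_dist: "real_distribution std"
        unfolding std_def by (rule real_dist_normal_dist)
      have law: "measure (normal_law 0 x) C = (\<integral>z. indicator C (sqrt x * z) \<partial>std)" for x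
        unfolding std_def by (rule measure_normal_law [OF C])
      interpret Q: prob_space Q by (rule probQ)
      interpret std: real_distribution std by (rule std_dist)
      interpret P: pair_prob_space Q std ..
      define \<mu> where "\<mu> = distr Q borel Z"
      define \<nu> where "\<nu> = distr (Q \<Otimes>\<^sub>M std) borel (\<lambda>(\<omega>, z). sqrt (s \<omega>) * z)"
      have m: "(\<lambda>(\<omega>, z). sqrt (s \<omega>) * z) \<in> borel_measurable (Q \<Otimes>\<^sub>M std)" by measurable
      have \<mu>: "real_distribution \<mu>"
        unfolding \<mu>_def by (rule Q.real_distribution_distr) measurable
      have \<nu>: "real_distribution \<nu>"
        unfolding \<nu>_def by (rule P.real_distribution_distr [OF m])
      have "Characteristic_Functions.char \<mu> c = Characteristic_Functions.char \<nu> c" for c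
      proof -
        have "Characteristic_Functions.char \<mu> c = (\<integral>\<omega>. iexp (c * Z \<omega>) \<partial>Q)"
          unfolding char_def \<mu>_def by (subst integral_distr) auto
        also have "\<dots> = (\<integral>\<omega>. indicator A \<omega> *\<^sub>R iexp (c * Z \<omega>) \<partial>M) /\<^sub>R prob A"
          by (rule intQ) measurable
        also have "(\<integral>\<omega>. indicator A \<omega> *\<^sub>R iexp (c * Z \<omega>) \<partial>M) = (\<integral>\<omega>. indicator A \<omega> * iexp (c * Z \<omega>) \<partial>M)"
          by (rule Bochner_Integration.integral_cong) (auto simp: indicator_def)
        also have "\<dots> = complex_of_real (\<integral>\<omega>. indicator A \<omega> * exp (- (c\<^sup>2 * s \<omega> / 2)) \<partial>M)"
          by (rule char [OF A])
        also have "\<dots> = (\<integral>\<omega>. indicator A \<omega> *\<^sub>R complex_of_real (exp (- (c\<^sup>2 * s \<omega> / 2))) \<partial>M)"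
          unfolding integral_complex_of_real [symmetric] by (rule Bochner_Integration.integral_cong) (auto simp: indicator_def)
        also have "\<dots> /\<^sub>R prob A = (\<integral>\<omega>. complex_of_real (exp (- (c\<^sup>2 * s \<omega> / 2))) \<partial>Q)"
          by (rule intQ [symmetric]) measurable
        also have "\<dots> = (\<integral>\<omega>. \<integral>z. iexp (c * (sqrt (s \<omega>) * z)) \<partial>std \<partial>Q)"
        proof (rule integral_cong_AE)
          \<comment> \<open>\<open>sqrt (s \<omega>)\<close> squares back to
            \<open>s \<omega>\<close> where \<open>s \<omega>\<close> is nonnegative, which is known
            almost surely; hence the two integrands are compared almost everywhere.\<close>
          have "AE \<omega> in Q. 0 \<le> s \<omega>"
            unfolding Q_def by (rule AE_uniform_measureI) (use s0 in auto)
          then show "AE \<omega> in Q. complex_of_real (exp (- (c\<^sup>2 * s \<omega> / 2))) = (\<integral>z. iexp (c * (sqrt (s \<omega>) * z)) \<partial>std)"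
          proof eventually_elim
            case (elim \<omega>)
            have "(\<integral>z. iexp (c * (sqrt (s \<omega>) * z)) \<partial>std) = (\<integral>z. iexp ((c * sqrt (s \<omega>)) * z) \<partial>std)"
              by (simp add: mult.assoc)
            also have "\<dots> = complex_of_real (exp (- (c * sqrt (s \<omega>))\<^sup>2 / 2))"
              by (rule char_std)
            finally show ?case using elim by (simp add: power_mult_distrib)
          qed
        qed measurable
        also have "\<dots> = (\<integral>p. iexp (c * (case p of (\<omega>, z) \<Rightarrow> sqrt (s \<omega>) * z)) \<partial>(Q \<Otimes>\<^sub>M std))"
        proof -
          have "integrable (Q \<Otimes>\<^sub>M std) (\<lambda>(\<omega>, z). iexp (c * (sqrt (s \<omega>) * z)))"
            by (rule P.integrable_const_bound [where B = 1]) auto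
          from P.integral_fst [OF this] show ?thesis
            by (simp add: case_prod_unfold)
        qed
        also have "\<dots> = Characteristic_Functions.char \<nu> c"
          unfolding char_def \<nu>_def using m by (subst integral_distr) auto
        finally show ?thesis .
      qed
      then have eq: "\<mu> = \<nu>"
        by (intro Levy_uniqueness \<mu> \<nu>) auto
      have "measure \<mu> C = (\<integral>\<omega>. indicator (Z -` C \<inter> space M) \<omega> \<partial>Q)"
        unfolding \<mu>_def by (subst measure_distr) (auto simp: Q_def)
      moreover have "measure \<nu> C = (\<integral>\<omega>. measure (normal_law 0 (s \<omega>)) C \<partial>Q)"
      proof -
        have "measure \<nu> C = (\<integral>x. indicator C x \<partial>\<nu>)"
          by (simp add: \<nu>_def)
        also have "\<dots> = (\<integral>p. indicator C (case p of (\<omega>, z) \<Rightarrow> sqrt (s \<omega>) * z) \<partial>(Q \<Otimes>\<^sub>M std))"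
          unfolding \<nu>_def using m by (subst integral_distr) auto
        also have "\<dots> = (\<integral>\<omega>. \<integral>z. indicator C (sqrt (s \<omega>) * z) \<partial>std \<partial>Q)"
        proof -
          have "integrable (Q \<Otimes>\<^sub>M std) (\<lambda>(\<omega>, z). indicat_real C (sqrt (s \<omega>) * z))"
            by (rule P.integrable_const_bound [where B = 1]) auto
          from P.integral_fst [OF this] show ?thesis
            by (simp add: case_prod_unfold)
        qed
        finally show ?thesis by (simp add: law)
      qed
      ultimately have "(\<integral>\<omega>. indicat_real (Z -` C \<inter> space M) \<omega> \<partial>Q) = (\<integral>\<omega>. measure (normal_law 0 (s \<omega>)) C \<partial>Q)"
        by (simp only: eq)
      moreover have m1: "indicat_real (Z -` C \<inter> space M) \<in> borel_measurable M"
        and m2: "(\<lambda>\<omega>. measure (normal_law 0 (s \<omega>)) C) \<in> borel_measurable M"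
        by measurable
      ultimately show ?thesis
        unfolding set_lebesgue_integral_def intQ [OF m1] intQ [OF m2]
        using pA by (simp only: scaleR_cancel_left inverse_zero_imp_zero) auto
    qed
  qed
qed

end

subsection \<open>The splitting scheme\<close>

text \<open>For invertible \<open>A\<close> this is the solution at time \<open>s\<close> of
  \<open>V' = c - A *v V\<close> with initial value \<open>v\<close>. It presents the variance in a
  half step as an explicit continuous function of its initial value.\<close>

definition flow :: "real^'n^'n \<Rightarrow> real^'n \<Rightarrow> real \<Rightarrow> real^'n \<Rightarrow> real^'n" where
  "flow A c s v = matrix_exp ((- s) *\<^sub>R A) *v v + matrix_inv A *v ((mat 1 - matrix_exp ((- s) *\<^sub>R A)) *v c)"

lemma continuous_on_matrix_exp_mult: "continuous_on S (\<lambda>s. matrix_exp ((a - s) *\<^sub>R A) *v v)"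
proof -
  have "isCont (\<lambda>s. matrix_exp (s *\<^sub>R A) $ i $ j) s" for i j s
    by (rule DERIV_isCont [OF DERIV_matrix_exp])
  then have "continuous_on UNIV (\<lambda>s. matrix_exp (s *\<^sub>R A) $ i $ j)" for i j
    by (simp add: continuous_at_imp_continuous_on)
  then have entry: "continuous_on S (\<lambda>s. matrix_exp ((a - s) *\<^sub>R A) $ i $ j)" for i j
    by (rule continuous_on_compose2) (auto intro!: continuous_intros)
  show ?thesis
    unfolding matrix_vector_mult_def
    by (intro continuous_on_vec_lambda continuous_on_sum continuous_on_mult continuous_on_const entry)
qed

lemma continuous_on_flow: "continuous_on S (\<lambda>u. flow A c (u - a) v)"
  unfolding flow_def minus_diff_eq matrix_vector_mult_diff_rdistrib
  by (intro continuous_intros continuous_on_matrix_exp_mult bounded_linear.continuous_on [OF matrix_vector_mul_bounded_linear])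

lemma borel_measurable_matrix_vector_mult [measurable (raw)]:
  fixes f :: "'a \<Rightarrow> real^'n"
  assumes "f \<in> borel_measurable N"
  shows "(\<lambda>\<omega>. (A::real^'n^'n) *v f \<omega>) \<in> borel_measurable N"
  by (rule measurable_compose [OF assms borel_measurable_continuous_onI])
     (intro linear_continuous_on matrix_vector_mul_bounded_linear)

lemma borel_measurable_flow [measurable (raw)]:
  "f \<in> borel_measurable N \<Longrightarrow> (\<lambda>\<omega>. flow A c s (f \<omega>)) \<in> borel_measurable N"
  unfolding flow_def by (intro borel_measurable_add borel_measurable_matrix_vector_mult) simp_all

text \<open>Every component feels the same aggregate \<open>w \<bullet> v\<close>, so the coupling
  matrix has all rows equal to \<open>w\<close>, while mean reversion is diagonal.\<close>

lemma drift_eq: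
  fixes w x v0 v :: "real^'n"
  assumes "A = lam *\<^sub>R (\<chi> i j. w $ j) + diag x" and "b = \<theta> *\<^sub>R vec 1 + diag x *v v0"
  shows "- x $ i * (v $ i - v0 $ i) + (\<theta> - lam * (w \<bullet> v)) = (b - A *v v) $ i"
proof -
  have diag: "(diag x *v y) $ i = x $ i * y $ i" for y
    by (simp add: diag_def matrix_vector_mult_def if_distrib if_distribR cong: if_cong)
  have "((lam *\<^sub>R (\<chi> i j. w $ j)) *v v) $ i = lam * (w \<bullet> v)"
    by (simp add: matrix_vector_mult_def inner_vec_def sum_distrib_left mult.assoc)
  then show ?thesis
    by (simp add: assms matrix_vector_mult_add_rdistrib diag algebra_simps)
qed

text \<open>The sign of the aggregate variance is kept in the same almost sure event, for all times
  at once, because the square root in the price coefficient will be squared under a time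
  integral.\<close>

lemma system1_variance:
  fixes V :: "real \<Rightarrow> 'a \<Rightarrow> real^'n"
  assumes sys: "system1 M F B w x v0 \<theta> lam \<rho> a c X V" and "a \<le> c"
    and A: "A = lam *\<^sub>R (\<chi> i j. w $ j) + diag x" and b: "b = \<theta> *\<^sub>R vec 1 + diag x *v v0" and inv: "invertible A"
  shows "AE \<omega> in M. (\<forall>u\<in>{a..c}. V u \<omega> = flow A b (u - a) (V a \<omega>) \<and> 0 \<le> w \<bullet> V u \<omega>) \<and>
    ((\<lambda>u. w \<bullet> V u \<omega>) has_integral w \<bullet> (matrix_inv A *v ((c - a) *\<^sub>R b - (V c \<omega> - V a \<omega>)))) {a..c}"
proof -
  have "AE \<omega> in M. \<forall>s\<in>{a..c}. \<forall>i. ((\<lambda>u. (b - A *v V u \<omega>) $ i) has_integral (V s \<omega> $ i - V a \<omega> $ i)) {a..s}"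
    and "AE \<omega> in M. \<forall>s\<in>{a..c}. 0 \<le> w \<bullet> V s \<omega>"
    using sys unfolding system1_def drift_eq [OF A b] by blast+
  then show ?thesis
    using AE_space
  proof eventually_elim
    case (elim \<omega>)
    have cont: "continuous_on {a..c} (\<lambda>u. V u \<omega>)"
      using sys elim(3) unfolding system1_def continuous_paths_def by blast
    have "V s \<omega> = flow A b (s - a) (V a \<omega>)" if s: "s \<in> {a..c}" for s
      unfolding flow_def minus_diff_eq
    proof (rule linear_ode_solution [OF inv])
      show "continuous_on {a..s} (\<lambda>u. V u \<omega>)"
        by (rule continuous_on_subset [OF cont]) (use s in auto)
    qed (use s elim(1) in auto)
    moreover have "((\<lambda>u. V u \<omega>) has_integral matrix_inv A *v ((c - a) *\<^sub>R b - (V c \<omega> - V a \<omega>))) {a..c}"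
      by (rule linear_ode_integral [OF inv \<open>a \<le> c\<close> cont]) (use elim(1) \<open>a \<le> c\<close> in auto)
    from has_integral_linear [OF this bounded_linear_inner_right [of w]]
    have "((\<lambda>u. w \<bullet> V u \<omega>) has_integral w \<bullet> (matrix_inv A *v ((c - a) *\<^sub>R b - (V c \<omega> - V a \<omega>)))) {a..c}"
      by (simp add: o_def)
    ultimately show ?case using elim(2) by blast
  qed
qed

context prob_space
begin

lemma system2_increment:
  fixes V :: "real \<Rightarrow> 'a \<Rightarrow> real^'n"
  assumes sys: "system2 M F B w \<nu> \<rho> a c X V" and s: "s \<in> {a..c}"
    and S: "S = (\<Sum>i\<in>UNIV. w $ i)" "S \<noteq> 0" and "\<nu> \<noteq> 0"
  shows "has_ito_integral M F B a s (\<lambda>u \<omega>. (\<nu> * S) * sqrt (w \<bullet> V u \<omega>)) (\<lambda>\<omega>. w \<bullet> V s \<omega> - w \<bullet> V a \<omega>)"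
    and "AE \<omega> in M. V s \<omega> = V a \<omega> + vec ((w \<bullet> V s \<omega> - w \<bullet> V a \<omega>) / S)"
    and "AE \<omega> in M. X s \<omega> - X a \<omega> = \<rho> / (\<nu> * S) * (w \<bullet> V s \<omega> - w \<bullet> V a \<omega>)"
proof -
  have B: "brownian_on M F B {a..c}" and sub: "{a..s} \<subseteq> {a..c}"
    using sys s by (auto simp: system2_def)
  have J: "has_ito_integral M F B a s (\<lambda>u \<omega>. \<nu> * sqrt (w \<bullet> V u \<omega>)) (\<lambda>\<omega>. V s \<omega> $ i - V a \<omega> $ i)" for i
    using sys s unfolding system2_def ito_differential_def by auto
  have JX: "has_ito_integral M F B a s (\<lambda>u \<omega>. \<rho> * sqrt (w \<bullet> V u \<omega>)) (\<lambda>\<omega>. X s \<omega> - X a \<omega>)"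
    using sys s unfolding system2_def ito_differential_def by auto
  have Vm: "V u \<in> borel_measurable M" if "u \<in> {a..c}" for u
    using sys that brownian_on_measurable [OF B] unfolding system2_def adapted_on_def by blast
  note [measurable] = Vm [OF s] Vm [of a]
  \<comment> \<open>Any component serves as representative. Uniqueness is invoked once per
    component, and finitely many null sets are merged.\<close>
  fix k :: 'n
  define K where "K \<omega> = V s \<omega> $ k - V a \<omega> $ k" for \<omega>
  have "AE \<omega> in M. \<forall>i. V s \<omega> $ i - V a \<omega> $ i = K \<omega>"
    unfolding K_def by (intro AE_finite_allI [of UNIV, simplified] has_ito_integral_unique [OF B sub J J]) auto
  then have K: "AE \<omega> in M. w \<bullet> V s \<omega> - w \<bullet> V a \<omega> = S * K \<omega> \<and> V s \<omega> = V a \<omega> + vec (K \<omega>)"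
  proof eventually_elim
    case (elim \<omega>)
    have "w \<bullet> V s \<omega> - w \<bullet> V a \<omega> = (\<Sum>i\<in>UNIV. w $ i * (V s \<omega> $ i - V a \<omega> $ i))"
      by (simp add: inner_vec_def sum_subtractf right_diff_distrib)
    also have "\<dots> = S * K \<omega>"
      by (simp add: elim S(1) sum_distrib_right)
    finally show ?case
      using elim by (auto simp: vec_eq_iff algebra_simps)
  qed
  have JK: "has_ito_integral M F B a s (\<lambda>u \<omega>. \<nu> * sqrt (w \<bullet> V u \<omega>)) K"
    unfolding K_def by (rule J)
  have "has_ito_integral M F B a s (\<lambda>u \<omega>. S * (\<nu> * sqrt (w \<bullet> V u \<omega>))) (\<lambda>\<omega>. w \<bullet> V s \<omega> - w \<bullet> V a \<omega>)"
  proof (rule has_ito_integral_cong_AE [OF has_ito_integral_cmult [OF JK]])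
    show "AE \<omega> in M. S * K \<omega> = w \<bullet> V s \<omega> - w \<bullet> V a \<omega>"
      using K by eventually_elim (elim conjE, erule sym)
    show "(\<lambda>\<omega>. w \<bullet> V s \<omega> - w \<bullet> V a \<omega>) \<in> borel_measurable M"
      using s by (intro borel_measurable_diff borel_measurable_inner Vm) auto
  qed
  then show "has_ito_integral M F B a s (\<lambda>u \<omega>. (\<nu> * S) * sqrt (w \<bullet> V u \<omega>)) (\<lambda>\<omega>. w \<bullet> V s \<omega> - w \<bullet> V a \<omega>)"
    by (simp only: mult_ac)
  show "AE \<omega> in M. V s \<omega> = V a \<omega> + vec ((w \<bullet> V s \<omega> - w \<bullet> V a \<omega>) / S)"
    using K
  proof eventually_elim
    case (elim \<omega>)
    have "K \<omega> = (w \<bullet> V s \<omega> - w \<bullet> V a \<omega>) / S"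
      unfolding conjunct1 [OF elim] using S(2) by simp
    with elim show ?case by metis
  qed
  \<comment> \<open>The price coefficient is \<open>\<rho> / \<nu>\<close> times that of a variance
    component, so uniqueness makes the price increment the same multiple of
    \<open>K\<close>.\<close>
  have "has_ito_integral M F B a s (\<lambda>u \<omega>. \<rho> / \<nu> * (\<nu> * sqrt (w \<bullet> V u \<omega>))) (\<lambda>\<omega>. \<rho> / \<nu> * K \<omega>)"
    by (rule has_ito_integral_cmult [OF JK])
  then have "has_ito_integral M F B a s (\<lambda>u \<omega>. \<rho> * sqrt (w \<bullet> V u \<omega>)) (\<lambda>\<omega>. \<rho> / \<nu> * K \<omega>)"
    using \<open>\<nu> \<noteq> 0\<close> by simp
  from has_ito_integral_unique [OF B sub JX this] K
  show "AE \<omega> in M. X s \<omega> - X a \<omega> = \<rho> / (\<nu> * S) * (w \<bullet> V s \<omega> - w \<bullet> V a \<omega>)"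
  proof eventually_elim
    case (elim \<omega>)
    show ?case
      unfolding elim(1) conjunct1 [OF elim(2)] using S(2) by simp
  qed
qed

end

text \<open>The conditioning includes \<open>Vt\<close> besides \<open>VNhat\<close> because
  \<open>I\<close> depends on both; the conditional variance is then measurable for the conditioning
  sigma-algebra.\<close>

theorem proposition4:
  fixes M :: "'a measure"
    and W Wp :: "real \<Rightarrow> 'a \<Rightarrow> real"
    and H G :: "real \<Rightarrow> 'a measure"
    and w x v0 :: "real^'n"
    and \<theta> lam \<nu> \<rho> t h :: real
    and Xt :: "'a \<Rightarrow> real" and Vt :: "'a \<Rightarrow> real^'n"
    and X1 X2 X3 :: "real \<Rightarrow> 'a \<Rightarrow> real"
    and V1 V2 V3 :: "real \<Rightarrow> 'a \<Rightarrow> real^'n"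
    and A E :: "real^'n^'n" and b :: "real^'n" and S :: real
    and Vtil Vhat Vsplit :: "'a \<Rightarrow> real^'n" and VNtil VNhat I :: "'a \<Rightarrow> real"
  assumes "prob_space M"
    and "brownian_motion M W" and "brownian_motion M Wp" and "independent_processes M W Wp"
    and "0 \<le> t" and "0 < h" and "driver_filtrations M H W G Wp t h"
    and "Xt \<in> borel_measurable (H t)" and "Vt \<in> borel_measurable (H t)"
    and "0 \<le> \<theta>" and "0 \<le> lam" and "\<And>i. 0 \<le> w $ i" and "\<And>i. 0 \<le> x $ i"
    and "- 1 \<le> \<rho>" and "\<rho> \<le> 1"
    and S: "S = (\<Sum>i\<in>UNIV. w $ i)"
    and A: "A = lam *\<^sub>R (\<chi> i j. w $ j) + diag x"
    and b: "b = \<theta> *\<^sub>R vec 1 + diag x *v v0"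
    and "\<nu> \<noteq> 0" and "S \<noteq> 0" and "invertible A"
    and step1: "system1 M G Wp w x v0 \<theta> lam \<rho> t (t + h / 2) X1 V1"
      "AE \<omega> in M. X1 t \<omega> = Xt \<omega> \<and> V1 t \<omega> = Vt \<omega>"
    and step2: "system2 M H W w \<nu> \<rho> t (t + h) X2 V2"
      "AE \<omega> in M. X2 t \<omega> = X1 (t + h / 2) \<omega> \<and> V2 t \<omega> = V1 (t + h / 2) \<omega>"
    and step3: "system1 M G Wp w x v0 \<theta> lam \<rho> (t + h / 2) (t + h) X3 V3"
      "AE \<omega> in M. X3 (t + h / 2) \<omega> = X2 (t + h) \<omega> \<and> V3 (t + h / 2) \<omega> = V2 (t + h) \<omega>"
    and E: "E = matrix_exp ((- h / 2) *\<^sub>R A)"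
    and Vtil: "\<And>\<omega>. Vtil \<omega> = E *v Vt \<omega> + matrix_inv A *v ((mat 1 - E) *v b)"
    and VNtil: "\<And>\<omega>. VNtil \<omega> = w \<bullet> Vtil \<omega>"
    and VNhat: "\<And>\<omega>. VNhat \<omega> = w \<bullet> V2 (t + h) \<omega>"
    and Vhat: "\<And>\<omega>. Vhat \<omega> = Vtil \<omega> + vec ((VNhat \<omega> - VNtil \<omega>) / S)"
    and Vsplit: "\<And>\<omega>. Vsplit \<omega> = E *v Vhat \<omega> + matrix_inv A *v ((mat 1 - E) *v b)"
    and I: "\<And>\<omega>. I \<omega> = w \<bullet> (matrix_inv A *v b) * h
      + w \<bullet> (matrix_inv A *v
          ((mat 1 - E) *v (Vt \<omega> + Vhat \<omega>) - 2 *\<^sub>R (matrix_inv A *v ((mat 1 - E) *v b))))"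
  shows "is_CIR M H W t 0 0 (\<nu> * S) h VNtil VNhat \<and>
    (\<exists>Z. conditionally_normal M
            (vimage_algebra (space M) (\<lambda>\<omega>. (Xt \<omega>, Vt \<omega>, VNhat \<omega>)) borel)
            Z (\<lambda>_. 0) (\<lambda>\<omega>. (1 - \<rho>\<^sup>2) * I \<omega>) \<and>
         (AE \<omega> in M. X3 (t + h) \<omega> =
            Xt \<omega> - I \<omega> / 2 + Z \<omega> + \<rho> / (\<nu> * S) * (VNhat \<omega> - VNtil \<omega>))) \<and>
    (AE \<omega> in M. V3 (t + h) \<omega> = Vsplit \<omega>) \<and>
    (AE \<omega> in M. (\<Sum>i\<in>UNIV. w $ i * V3 (t + h) \<omega> $ i) = w \<bullet> Vsplit \<omega>)"
proof -
  interpret prob_space M by fact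
  define m where "m = t + h / 2"
  define T where "T = t + h"
  have tm: "t \<le> m" "m \<le> T" "t \<le> T" "m - t = h / 2" "T - m = h / 2"
    using \<open>0 < h\<close> by (auto simp: m_def T_def)
  note step1 = step1 [folded m_def] and step2 = step2 [folded m_def T_def] and step3 = step3 [folded m_def T_def]
  note VNhat = VNhat [folded T_def]
  have BW: "brownian_on M H W {t..T}" and BG: "brownian_on M G Wp {t..T}" and HG: "sets (H T) \<subseteq> sets (G t)"
    using \<open>driver_filtrations M H W G Wp t h\<close> by (auto simp: driver_filtrations_def T_def)
  have flow_half: "flow A b (h / 2) v = E *v v + matrix_inv A *v ((mat 1 - E) *v b)" for v
    by (simp add: flow_def E)
  note var1 = system1_variance [OF step1(1) tm(1) A b \<open>invertible A\<close>]
    and var3 = system1_variance [OF step3(1) tm(2) A b \<open>invertible A\<close>]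
  have V1m: "AE \<omega> in M. V1 m \<omega> = Vtil \<omega>"
    using var1 step1(2)
  proof eventually_elim
    case (elim \<omega>)
    then have "V1 m \<omega> = flow A b (m - t) (Vt \<omega>)" using tm(1) by auto
    then show ?case by (simp add: tm flow_half Vtil)
  qed
  note inc = system2_increment [OF step2(1) _ S \<open>S \<noteq> 0\<close> \<open>\<nu> \<noteq> 0\<close>]
  have TT: "T \<in> {t..T}" using tm by simp
  have V2T: "AE \<omega> in M. V2 T \<omega> = Vhat \<omega>"
    using inc(2) [OF TT] step2(2) V1m
    by eventually_elim (simp add: Vhat VNhat VNtil)
  have V3T: "AE \<omega> in M. V3 T \<omega> = Vsplit \<omega>"
    using var3 step3(2) V2T
  proof eventually_elim
    case (elim \<omega>)
    then have "V3 T \<omega> = flow A b (T - m) (Vhat \<omega>)" using tm(2) by auto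
    then show ?case by (simp add: tm flow_half Vsplit)
  qed

  \<comment> \<open>The aggregate variance of the middle step is the required CIR path: its
    components have no drift and share one noise, so weighting by \<open>w\<close> gives the
    volatility \<open>\<nu> * S\<close>.\<close>
  have cir: "is_CIR M H W t 0 0 (\<nu> * S) h VNtil VNhat"
    unfolding is_CIR_def T_def [symmetric]
  proof (intro conjI exI [of _ "\<lambda>u \<omega>. w \<bullet> V2 u \<omega>"] BW)
    show "continuous_paths M t T (\<lambda>u \<omega>. w \<bullet> V2 u \<omega>)"
      using step2(1) unfolding system2_def continuous_paths_def by (auto intro!: continuous_intros)
    show "adapted_on H t T (\<lambda>u \<omega>. w \<bullet> V2 u \<omega>)"
      using step2(1) unfolding system2_def adapted_on_def by auto
    show "AE \<omega> in M. \<forall>s\<in>{t..T}. 0 \<le> w \<bullet> V2 s \<omega>"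
      using step2(1) unfolding system2_def by blast
    show "ito_differential M H W t T (\<lambda>u \<omega>. w \<bullet> V2 u \<omega>) (\<lambda>u \<omega>. 0 - 0 * (w \<bullet> V2 u \<omega>)) (\<lambda>u \<omega>. \<nu> * S * sqrt (w \<bullet> V2 u \<omega>))"
      unfolding ito_differential_def using inc(1) by auto
    show "AE \<omega> in M. w \<bullet> V2 t \<omega> = VNtil \<omega>"
      using step2(2) V1m by eventually_elim (simp add: VNtil)
    show "AE \<omega> in M. w \<bullet> V2 T \<omega> = VNhat \<omega>"
      by (simp add: VNhat)
  qed

  \<comment> \<open>Through \<open>HG\<close>, whatever \<open>W\<close> reveals over the whole step
    counts as initial information for the filtration of \<open>Wp\<close>.\<close>
  have liftG: "f \<in> measurable (G t) N" if "f \<in> measurable (H T) N" for f and N :: "'b measure"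
  proof -
    have "subalgebra (G t) (H T)"
      using HG brownian_on_subalgebra [OF BW, of T] brownian_on_subalgebra [OF BG, of t] by (simp add: subalgebra_def)
    then show ?thesis using that measurable_from_subalg by blast
  qed
  have XtG [measurable]: "Xt \<in> borel_measurable (G t)" and VtG [measurable]: "Vt \<in> borel_measurable (G t)"
    using liftG [OF brownian_on_measurable_mono [OF BW tm(3)]] \<open>Xt \<in> borel_measurable (H t)\<close> \<open>Vt \<in> borel_measurable (H t)\<close>
    by blast+
  have "V2 T \<in> borel_measurable (H T)"
    using step2(1) TT unfolding system2_def adapted_on_def by blast
  then have "VNhat \<in> borel_measurable (H T)"
    unfolding VNhat [abs_def] by simp
  then have VNhatG [measurable]: "VNhat \<in> borel_measurable (G t)"
    by (rule liftG)
  \<comment> \<open>Kept generic in \<open>N\<close>: it is used for \<open>G t\<close>, where the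
    integrands live, and for the conditioning sigma-algebra, where the variance must live.\<close>
  have Vhat_meas: "Vhat \<in> borel_measurable N" if [measurable]: "Vt \<in> borel_measurable N" "VNhat \<in> borel_measurable N" for N
  proof -
    have "(\<lambda>r. vec r :: real^'n) \<in> borel_measurable borel"
      by (rule borel_measurable_continuous_onI) (simp add: vec_def continuous_on_vec_lambda)
    from measurable_compose [OF _ this] have [measurable (raw)]: "f \<in> borel_measurable N \<Longrightarrow> (\<lambda>\<omega>. vec (f \<omega>) :: real^'n) \<in> borel_measurable N" for f .
    show ?thesis
      unfolding Vhat [abs_def] VNtil Vtil by measurable
  qed
  note VhatG [measurable] = Vhat_meas [OF VtG VNhatG]

  \<comment> \<open>The Gaussian part of the log-price\<close>
  let ?c = "sqrt (1 - \<rho>\<^sup>2)"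
  have \<rho>: "0 \<le> 1 - \<rho>\<^sup>2"
    using \<open>- 1 \<le> \<rho>\<close> \<open>\<rho> \<le> 1\<close> by (simp add: abs_square_le_1 abs_le_iff)
  \<comment> \<open>A price increment minus its drift is, by the integrated form of the equation, a
    version of the stochastic integral; so the noise is a genuine random variable without any choice
    of a version.\<close>
  define Z1 where "Z1 \<omega> = X1 m \<omega> - X1 t \<omega> - integral {t..m} (\<lambda>u. - (w \<bullet> V1 u \<omega>) / 2)" for \<omega>
  define Z3 where "Z3 \<omega> = X3 T \<omega> - X3 m \<omega> - integral {m..T} (\<lambda>u. - (w \<bullet> V3 u \<omega>) / 2)" for \<omega>
  define Z where "Z \<omega> = Z1 \<omega> + Z3 \<omega>" for \<omega>
  have J1: "has_ito_integral M G Wp t m (\<lambda>u \<omega>. ?c * sqrt (w \<bullet> V1 u \<omega>)) Z1"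
    unfolding Z1_def [abs_def] using step1(1) tm unfolding system1_def ito_differential_def by auto
  have J3: "has_ito_integral M G Wp m T (\<lambda>u \<omega>. ?c * sqrt (w \<bullet> V3 u \<omega>)) Z3"
    unfolding Z3_def [abs_def] using step3(1) tm unfolding system1_def ito_differential_def by auto
  \<comment> \<open>These versions are functions of data known at \<open>t\<close>. As
    \<open>sqrt\<close> is total and continuous on all reals, their paths are continuous for every
    \<open>\<omega>\<close>, also on the null set where the aggregate might be negative.\<close>
  define g1 where "g1 u \<omega> = ?c * sqrt (w \<bullet> flow A b (u - t) (Vt \<omega>))" for u \<omega>
  define g3 where "g3 u \<omega> = ?c * sqrt (w \<bullet> flow A b (u - m) (Vhat \<omega>))" for u \<omega>
  have int1: "AE \<omega> in M. (\<forall>u\<in>{t..m}. V1 u \<omega> = flow A b (u - t) (Vt \<omega>) \<and> 0 \<le> w \<bullet> V1 u \<omega>) \<and>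
      ((\<lambda>u. w \<bullet> V1 u \<omega>) has_integral w \<bullet> (matrix_inv A *v ((h / 2) *\<^sub>R b - (Vtil \<omega> - Vt \<omega>)))) {t..m}"
    using var1 step1(2) V1m by eventually_elim (auto simp: tm)
  have int3: "AE \<omega> in M. (\<forall>u\<in>{m..T}. V3 u \<omega> = flow A b (u - m) (Vhat \<omega>) \<and> 0 \<le> w \<bullet> V3 u \<omega>) \<and>
      ((\<lambda>u. w \<bullet> V3 u \<omega>) has_integral w \<bullet> (matrix_inv A *v ((h / 2) *\<^sub>R b - (Vsplit \<omega> - Vhat \<omega>)))) {m..T}"
    using var3 step3(2) V2T V3T by eventually_elim (auto simp: tm)
  \<comment> \<open>The half steps contribute \<open>h / 2\<close> each to the term in
    \<open>b\<close>. The affine term occurs once in \<open>Vtil\<close> and once in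
    \<open>Vsplit\<close>, whence the factor 2 in \<open>I\<close>.\<close>
  have I_eq: "w \<bullet> (matrix_inv A *v ((h / 2) *\<^sub>R b - (Vtil \<omega> - Vt \<omega>))) + w \<bullet> (matrix_inv A *v ((h / 2) *\<^sub>R b - (Vsplit \<omega> - Vhat \<omega>))) = I \<omega>" for \<omega>
  proof -
    have "w \<bullet> (matrix_inv A *v ((h / 2) *\<^sub>R b - (Vtil \<omega> - Vt \<omega>))) + w \<bullet> (matrix_inv A *v ((h / 2) *\<^sub>R b - (Vsplit \<omega> - Vhat \<omega>)))
       = w \<bullet> (matrix_inv A *v (h *\<^sub>R b + ((Vt \<omega> - Vtil \<omega>) + (Vhat \<omega> - Vsplit \<omega>))))"
      unfolding inner_add_right [symmetric] matrix_vector_right_distrib [symmetric]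
      by (simp add: algebra_simps flip: scaleR_add_left)
    also have "(Vt \<omega> - Vtil \<omega>) + (Vhat \<omega> - Vsplit \<omega>) = (mat 1 - E) *v (Vt \<omega> + Vhat \<omega>) - 2 *\<^sub>R (matrix_inv A *v ((mat 1 - E) *v b))"
      unfolding Vtil [of \<omega>] Vsplit [of \<omega>] by (simp add: algebra_simps scaleR_2)
    finally show ?thesis
      unfolding I by (simp add: matrix_vector_right_distrib inner_add_right matrix_vector_mult_scaleR mult.commute)
  qed
  \<comment> \<open>The sign is read off from \<open>I\<close> as a sum of two time integrals of the
    aggregate variance, not from the closed formula.\<close>
  have I0: "AE \<omega> in M. 0 \<le> I \<omega>"
    using int1 int3
  proof eventually_elim
    case (elim \<omega>)
    then show ?case
      unfolding I_eq [symmetric] by (intro add_nonneg_nonneg) (auto elim!: has_integral_nonneg)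
  qed
  \<comment> \<open>The characteristic function is available on all events of \<open>G t\<close>; it
    is tested only on this smaller sigma-algebra, with respect to which \<open>I\<close> is still
    measurable.\<close>
  let ?f = "\<lambda>\<omega>. (Xt \<omega>, Vt \<omega>, VNhat \<omega>)"
  let ?N = "vimage_algebra (space M) ?f borel"
  have fN: "?f \<in> measurable ?N borel"
    by (rule measurable_vimage_algebra1) simp
  have fG: "?f \<in> borel_measurable (G t)"
    by (intro borel_measurable_Pair XtG VtG VNhatG)
  have spG: "space (G t) = space M"
    using brownian_on_subalgebra [OF BG, of t] by (simp add: subalgebra_def)
  have NG: "N' \<in> sets (G t)" if N': "N' \<in> sets ?N" for N'
  proof -
    obtain C where "N' = ?f -` C \<inter> space M" "C \<in> sets borel"
      using N' sets_vimage_algebra2 [of ?f "space M" borel] by auto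
    then show ?thesis using measurable_sets [OF fG] by (simp add: spG)
  qed
  have sub: "subalgebra M ?N"
    unfolding subalgebra_def using NG brownian_on_subalgebra [OF BG, of t] by (auto simp: subalgebra_def)
  have VtN: "Vt \<in> borel_measurable ?N" and VNhatN: "VNhat \<in> borel_measurable ?N"
  proof -
    have "(\<lambda>p::real \<times> (real^'n) \<times> real. fst (snd p)) \<in> borel_measurable borel" "(\<lambda>p::real \<times> (real^'n) \<times> real. snd (snd p)) \<in> borel_measurable borel"
      by (auto intro!: borel_measurable_continuous_onI continuous_intros)
    from measurable_compose [OF fN this(1)] measurable_compose [OF fN this(2)]
    show "Vt \<in> borel_measurable ?N" "VNhat \<in> borel_measurable ?N" by simp_all
  qed
  note [measurable] = VtN VNhatN Vhat_meas [OF VtN VNhatN]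
  have IN [measurable]: "(\<lambda>\<omega>. (1 - \<rho>\<^sup>2) * I \<omega>) \<in> borel_measurable ?N"
    unfolding I by measurable
  have IM: "(\<lambda>\<omega>. (1 - \<rho>\<^sup>2) * I \<omega>) \<in> borel_measurable M"
    using measurable_from_subalg [OF sub IN] .
  have ZM: "Z \<in> borel_measurable M"
  proof -
    have "Z1 \<in> borel_measurable M" "Z3 \<in> borel_measurable M"
      using J1 J3 unfolding has_ito_integral_def tendsto_in_prob_def by auto
    then show ?thesis unfolding Z_def [abs_def] by simp
  qed
  have normal: "conditionally_normal M ?N Z (\<lambda>_. 0) (\<lambda>\<omega>. (1 - \<rho>\<^sup>2) * I \<omega>)"
  proof (rule conditionally_normal_char [OF sub ZM IN])
    show "AE \<omega> in M. 0 \<le> (1 - \<rho>\<^sup>2) * I \<omega>"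
      using I0 by eventually_elim (use \<rho> in simp)
    fix C c assume "C \<in> sets ?N"
    show "(\<integral>\<omega>. indicator C \<omega> * iexp (c * Z \<omega>) \<partial>M) = complex_of_real (\<integral>\<omega>. indicator C \<omega> * exp (- (c\<^sup>2 * ((1 - \<rho>\<^sup>2) * I \<omega>) / 2)) \<partial>M)"
      unfolding Z_def
    proof (rule ito_sum_char [OF BG tm(1,2) J1 J3, of g1 g3 "\<lambda>\<omega>. (1 - \<rho>\<^sup>2) * I \<omega>"])
      show "g1 u \<in> borel_measurable (G t)" "g3 u \<in> borel_measurable (G t)" for u
        unfolding g1_def [abs_def] g3_def [abs_def] by measurable
      show "continuous_on {t..m} (\<lambda>u. g1 u \<omega>)" "continuous_on {m..T} (\<lambda>u. g3 u \<omega>)" for \<omega>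
        unfolding g1_def g3_def by (intro continuous_intros continuous_on_flow)+
      show "AE \<omega> in M. \<forall>u\<in>{t..m}. ?c * sqrt (w \<bullet> V1 u \<omega>) = g1 u \<omega>"
        using int1 by eventually_elim (simp add: g1_def)
      show "AE \<omega> in M. \<forall>u\<in>{m..T}. ?c * sqrt (w \<bullet> V3 u \<omega>) = g3 u \<omega>"
        using int3 by eventually_elim (simp add: g3_def)
      show "AE \<omega> in M. integral {t..m} (\<lambda>u. (g1 u \<omega>)\<^sup>2) + integral {m..T} (\<lambda>u. (g3 u \<omega>)\<^sup>2) = (1 - \<rho>\<^sup>2) * I \<omega>"
        using int1 int3
      proof eventually_elim
        case (elim \<omega>)
        have "(g1 u \<omega>)\<^sup>2 = (1 - \<rho>\<^sup>2) * (w \<bullet> V1 u \<omega>)" if "u \<in> {t..m}" for u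
        proof -
          have "g1 u \<omega> = ?c * sqrt (w \<bullet> V1 u \<omega>)" "0 \<le> w \<bullet> V1 u \<omega>"
            using conjunct1 [OF elim(1), THEN bspec, OF that] unfolding g1_def by metis+
          then show ?thesis using \<rho> by (simp add: power_mult_distrib)
        qed
        then have "integral {t..m} (\<lambda>u. (g1 u \<omega>)\<^sup>2) = (1 - \<rho>\<^sup>2) * integral {t..m} (\<lambda>u. w \<bullet> V1 u \<omega>)"
          unfolding integral_mult_right [symmetric] by (rule integral_cong)
        moreover have "(g3 u \<omega>)\<^sup>2 = (1 - \<rho>\<^sup>2) * (w \<bullet> V3 u \<omega>)" if "u \<in> {m..T}" for u
        proof -
          have "g3 u \<omega> = ?c * sqrt (w \<bullet> V3 u \<omega>)" "0 \<le> w \<bullet> V3 u \<omega>"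
            using conjunct1 [OF elim(2), THEN bspec, OF that] unfolding g3_def by metis+
          then show ?thesis using \<rho> by (simp add: power_mult_distrib)
        qed
        then have "integral {m..T} (\<lambda>u. (g3 u \<omega>)\<^sup>2) = (1 - \<rho>\<^sup>2) * integral {m..T} (\<lambda>u. w \<bullet> V3 u \<omega>)"
          unfolding integral_mult_right [symmetric] by (rule integral_cong)
        ultimately show ?case
          by (simp only: integral_unique [OF conjunct2 [OF elim(1)]] integral_unique [OF conjunct2 [OF elim(2)]]
              distrib_left I_eq [symmetric])
      qed
      show "C \<in> sets (G t)" by (rule NG) fact
    qed (rule IM)
  qed
  \<comment> \<open>Matching initial values make the three price increments telescope. The two drift
    integrals give \<open>- I / 2\<close>, and the middle increment is the multiple of
    \<open>VNhat - VNtil\<close>.\<close>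
  have price: "AE \<omega> in M. X3 T \<omega> = Xt \<omega> - I \<omega> / 2 + Z \<omega> + \<rho> / (\<nu> * S) * (VNhat \<omega> - VNtil \<omega>)"
    using int1 int3 step1(2) step2(2) step3(2) inc(3) [OF TT] V1m
  proof eventually_elim
    case (elim \<omega>)
    have "integral {t..m} (\<lambda>u. - (w \<bullet> V1 u \<omega>) / 2) + integral {m..T} (\<lambda>u. - (w \<bullet> V3 u \<omega>) / 2) =
        - (integral {t..m} (\<lambda>u. w \<bullet> V1 u \<omega>) + integral {m..T} (\<lambda>u. w \<bullet> V3 u \<omega>)) / 2"
      by (simp add: add_divide_distrib)
    also have "\<dots> = - I \<omega> / 2"
      by (simp only: integral_unique [OF conjunct2 [OF elim(1)]] integral_unique [OF conjunct2 [OF elim(2)]] I_eq)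
    finally have "integral {t..m} (\<lambda>u. - (w \<bullet> V1 u \<omega>) / 2) + integral {m..T} (\<lambda>u. - (w \<bullet> V3 u \<omega>) / 2) = - I \<omega> / 2" .
    then show ?case
      using elim(3-) unfolding Z_def Z1_def Z3_def by (simp add: VNhat VNtil)
  qed
  have "AE \<omega> in M. (\<Sum>i\<in>UNIV. w $ i * V3 T \<omega> $ i) = w \<bullet> Vsplit \<omega>"
    using V3T by eventually_elim (simp add: inner_vec_def)
  with cir normal price V3T show ?thesis
    unfolding T_def [symmetric] by (intro conjI exI [of _ Z])
qed

end
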